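(* Let $\omega$ be a primitive cube root of unity. The Hessian arrangement, i.e. the $12$ lines of $\mathbb{CP}^2$ given by $x=0$, $y=0$, $z=0$ and $x+\omega^i y+\omega^j z=0$ for $i,j\in\{0,1,2\}$, partitioned into the four classes $\{x=0,y=0,z=0\}$ and $\{x+\omega^iy+\omega^jz=0 : i+j\equiv a \pmod 3\}$ for $a=0,1,2$, is a $(4,3)$-net in $\mathbb{CP}^2$, and every $(4,3)$-net in $\mathbb{CP}^2$ is projectively isomorphic to it. Moreover, for $k=4,5,6$ there is no $(4,k)$-net in $\mathbb{CP}^2$.
   Context: For $n\ge 3$, an $(n,k)$-net in $\mathbb{CP}^2$ consists of a set $\mathcal{A}$ of (distinct) lines in $\mathbb{CP}^2$ and a finite set $\chi$ of points lying on lines of $\mathcal{A}$, such that $\mathcal{A}$ is partitioned as $\mathcal{A}=\bigcup_{i=1}^n\mathcal{A}_i$ with $|\mathcal{A}_i|=k$ for all $i$, subject to: (1) if $\ell_1\in\mathcal{A}_i$, $\ell_2\in\mathcal{A}_j$ with $i\neq j$, then $\ell_1\cap\ell_2\in\chi$; (2) for every $X\in\chi$ and every $i\in\{1,\dots,n\}$ there is exactly one line $\ell\in\mathcal{A}_i$ with $X\in\ell$. Two nets are projectively isomorphic if some projective transformation of $\mathbb{CP}^2$ (element of $PGL_3(\mathbb{C})$) maps the lines of one onto the lines of the other, carrying the partition classes of one onto the partition classes of the other. *)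

theory Defs
  imports "HOL-Analysis.Analysis"
begin

text \<open>
  The complex projective plane is taken as the projectivisation of \<open>complex ^ 3\<close>: points and
  lines are the complex linear subspaces of dimension 1 and 2, a point \<open>X\<close> lies on a
  line \<open>l\<close> iff \<open>X \<subseteq> l\<close>, and the common point of two distinct lines is their intersection as
  subspaces.  \<open>vec.subspace\<close> and \<open>vec.dim\<close> refer to the complex scalars.
\<close>

definition cp2_points :: "(complex ^ 3) set set" where
  "cp2_points = {X. vec.subspace X \<and> vec.dim X = 1}"

definition cp2_lines :: "(complex ^ 3) set set" where
  "cp2_lines = {l. vec.subspace l \<and> vec.dim l = 2}"

definition is_net ::
  "nat \<Rightarrow> nat \<Rightarrow> (complex ^ 3) set set \<Rightarrow> (nat \<Rightarrow> (complex ^ 3) set set) \<Rightarrow> (complex ^ 3) set set \<Rightarrow> bool"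
where
  "is_net n k L A chi \<longleftrightarrow>
     n \<ge> 3 \<and>
     L \<subseteq> cp2_lines \<and>
     chi \<subseteq> cp2_points \<and> finite chi \<and> (\<forall>X\<in>chi. \<exists>l\<in>L. X \<subseteq> l) \<and>
     L = (\<Union>i\<in>{1..n}. A i) \<and> disjoint_family_on A {1..n} \<and>
     (\<forall>i\<in>{1..n}. finite (A i) \<and> card (A i) = k) \<and>
     (\<forall>i\<in>{1..n}. \<forall>j\<in>{1..n}. i \<noteq> j \<longrightarrow> (\<forall>l1\<in>A i. \<forall>l2\<in>A j. l1 \<inter> l2 \<in> chi)) \<and>
     (\<forall>X\<in>chi. \<forall>i\<in>{1..n}. \<exists>!l. l \<in> A i \<and> X \<subseteq> l)"

text \<open>
  An element of \<open>PGL\<^sub>3\<close> is given by a representing invertible matrix, acting on subspaces by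
  direct image.  It has to respect the unordered collection of classes; their numbering may
  be permuted.
\<close>

definition proj_map :: "complex ^ 3 ^ 3 \<Rightarrow> (complex ^ 3) set \<Rightarrow> (complex ^ 3) set" where
  "proj_map M X = (\<lambda>v. M *v v) ` X"

definition proj_isomorphic ::
  "nat \<Rightarrow> (complex ^ 3) set set \<Rightarrow> (nat \<Rightarrow> (complex ^ 3) set set)
     \<Rightarrow> (complex ^ 3) set set \<Rightarrow> (nat \<Rightarrow> (complex ^ 3) set set) \<Rightarrow> bool"
where
  "proj_isomorphic n L A L' A' \<longleftrightarrow>
     (\<exists>M. invertible M \<and>
        proj_map M ` L = L' \<and>
        (\<lambda>i. proj_map M ` A i) ` {1..n} = A' ` {1..n})"

definition line_eq :: "complex \<Rightarrow> complex \<Rightarrow> complex \<Rightarrow> (complex ^ 3) set" where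
  "line_eq a b c = {v. a * v $ 1 + b * v $ 2 + c * v $ 3 = 0}"

definition coord_lines :: "(complex ^ 3) set set" where
  "coord_lines = {line_eq 1 0 0, line_eq 0 1 0, line_eq 0 0 1}"

definition hessian_lines :: "complex \<Rightarrow> (complex ^ 3) set set" where
  "hessian_lines \<omega> =
     coord_lines \<union> {line_eq 1 (\<omega> ^ i) (\<omega> ^ j) | i j. i \<in> {0,1,2} \<and> j \<in> {0,1,2}}"

text \<open>Class 1 is the coordinate triangle; class \<open>a + 2\<close> is the one with \<open>i + j \<equiv> a\<close> modulo 3.\<close>

definition hessian_class :: "complex \<Rightarrow> nat \<Rightarrow> (complex ^ 3) set set" where
  "hessian_class \<omega> m =
     (if m = 1 then coord_lines
      else {line_eq 1 (\<omega> ^ i) (\<omega> ^ j) | i j.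
              i \<in> {0,1,2} \<and> j \<in> {0,1,2} \<and> (i + j) mod 3 = (m - 2) mod 3})"

definition primitive_root_of_unity :: "nat \<Rightarrow> complex \<Rightarrow> bool" where
  "primitive_root_of_unity n z \<longleftrightarrow> n > 0 \<and> z ^ n = 1 \<and> (\<forall>m. 0 < m \<and> m < n \<longrightarrow> z ^ m \<noteq> 1)"

end

theory Submission
  imports Defs
begin

text \<open>
  Let \<open>F\<^sub>i\<close> be the product of the linear forms of class \<open>i\<close>.  Two lines of class \<open>i\<close> meet outside
  \<open>\<chi>\<close>, and every other class cuts a line of class \<open>i\<close> in the same \<open>k\<close> points; hence \<open>F\<^sub>j / F\<^sub>l\<close> is
  one constant on all lines of class \<open>i\<close>, and the four lines through a point of \<open>\<chi>\<close> have a cross-ratio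
  independent of the point.  Project one line \<open>a\<close> of the first class onto another one \<open>a'\<close> along the
  lines of the other three classes: in an affine coordinate \<open>y\<close> of \<open>a'\<close> that has \<open>a \<inter> a'\<close> at infinity,
  the three images of a point of \<open>a\<close> divide in the constant ratio.  So the pair of orthogonal Latin
  squares that describes the net satisfies a system of linear equations
  \<open>y (\<pi> j) = (1 - t) y j + t y (\<sigma> j)\<close> with \<open>y\<close> injective.

  For \<open>k = 4\<close> the permutations \<open>\<sigma>\<close> and \<open>\<pi>\<close> are distinct fixed-point-free involutions of a Klein
  group, and the equations make \<open>y\<close> non-injective.  For \<open>k = 5\<close> the squares are cyclic, \<open>y\<close> runs
  through a regular pentagon, and two choices of \<open>a\<close> give incompatible pentagons on \<open>a'\<close>.  For
  \<open>k = 6\<close>, the rank of the incidence matrix modulo 2 yields two lines of each class such that every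
  point of \<open>\<chi>\<close> lies on none or two of them; the equations for the two lines of the first class are
  contradictory.  For \<open>k = 3\<close>, the lines of one class serve as coordinate triangle, and then
  the coefficients of the other nine lines form a multiplicative group of order three.
\<close>

section \<open>Vectors, lines and points\<close>

text \<open>On a line of another class each product of forms has degree \<open>k\<close> and simple
  zeros at the same \<open>k\<close> base points, which is why two of them are proportional there.
  At a base point just one factor of each product vanishes, so proportional products have
  proportional differentials; comparing two classes of lines through the point gives the
  cross-ratio. If \<open>c\<close> and \<open>c'\<close> are the constants on classes 0 and 3 for
  the quotient of classes 1 and 2, the cross-ratio is \<open>c / c'\<close> and the number
  \<open>t\<close> of the overview is \<open>c' / (c' - c)\<close>. The pair \<open>c\<close>,
  \<open>c'\<close> is kept to avoid the division.

  The equations concern two rows at a time, and how much they exclude depends on the squares. In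
  order four two rows are contradictory. In order five two rows admit the regular pentagon as a true
  solution, so the Moebius map between the coordinates for two choices of \<open>a\<close> is needed
  as well. In order six an enumeration of squares would be far too long; the parity argument
  isolates six points of \<open>a'\<close>, and six equations settle them. In order three the field
  enters through its characteristic: a concurrent class would yield a subgroup of order three in the
  additive group of the complex numbers.\<close>

definition dot3 :: "complex^3 \<Rightarrow> complex^3 \<Rightarrow> complex" where
  "dot3 u v = u$1 * v$1 + u$2 * v$2 + u$3 * v$3"

text \<open>Lines and points share the coordinate space \<open>complex^3\<close>, paired by the
  bilinear \<open>dot3\<close> without conjugation. The cross product is then the meet of two lines
  as well as the join of two points, and it vanishes exactly when these coincide.\<close>

definition crs :: "complex^3 \<Rightarrow> complex^3 \<Rightarrow> complex^3" where
  "crs u v = vector [u$2 * v$3 - u$3 * v$2, u$3 * v$1 - u$1 * v$3, u$1 * v$2 - u$2 * v$1]"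

definition plane :: "complex^3 \<Rightarrow> (complex^3) set" where
  "plane n = {v. dot3 n v = 0}"

lemma crs_nth [simp]:
  "crs u v $ 1 = u$2 * v$3 - u$3 * v$2"
  "crs u v $ 2 = u$3 * v$1 - u$1 * v$3"
  "crs u v $ 3 = u$1 * v$2 - u$2 * v$1"
  by (simp_all add: crs_def vector_3)

lemma vec3_eq_iff: "(u::complex^3) = v \<longleftrightarrow> u$1 = v$1 \<and> u$2 = v$2 \<and> u$3 = v$3"
  by (simp add: vec_eq_iff forall_3)

lemma dot3_simps [simp]:
  "dot3 u (v + w) = dot3 u v + dot3 u w"
  "dot3 u (v - w) = dot3 u v - dot3 u w"
  "dot3 u (a *s v) = a * dot3 u v"
  "dot3 (u + u') v = dot3 u v + dot3 u' v"
  "dot3 (u - u') v = dot3 u v - dot3 u' v"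
  "dot3 (a *s u) v = a * dot3 u v"
  "dot3 u 0 = 0" "dot3 0 u = 0" "dot3 u (- v) = - dot3 u v"
  by (simp_all add: dot3_def algebra_simps)

lemma dot3_commute: "dot3 u v = dot3 v u"
  by (simp add: dot3_def mult.commute)

lemma dot3_crs [simp]: "dot3 u (crs u v) = 0" "dot3 v (crs u v) = 0"
  "dot3 (crs u v) u = 0" "dot3 (crs u v) v = 0"
  by (simp_all add: dot3_def algebra_simps)

lemma crs_swap: "crs v u = - crs u v"
  by (simp add: vec3_eq_iff)

lemma crs_eq_0_swap: "crs v u = 0 \<longleftrightarrow> crs u v = 0"
  by (simp add: crs_swap[of v u])

lemma crs_self [simp]: "crs u u = 0"
  by (simp add: vec3_eq_iff)

lemma crs_zero [simp]: "crs 0 u = 0" "crs u 0 = 0"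
  by (simp_all add: vec3_eq_iff)

lemma crs_crs: "crs u (crs v w) = dot3 u w *s v - dot3 u v *s w"
  by (simp add: vec3_eq_iff dot3_def algebra_simps)

lemma crs_scaleL: "crs (a *s u) v = a *s crs u v"
  by (simp add: vec3_eq_iff algebra_simps)

lemma nonzero_component:
  assumes "(w::complex^3) \<noteq> 0" obtains z where "dot3 z w = 1"
proof -
  obtain i where i: "w $ i \<noteq> 0" using assms by (auto simp: vec_eq_iff)
  have "\<exists>z. dot3 z w = 1"
  proof -
    have "i = 1 \<or> i = 2 \<or> i = 3" by (rule exhaust_3)
    then show ?thesis
    proof (elim disjE)
      assume "i = 1" then show ?thesis using i
        by (intro exI[of _ "vector [1 / w$1, 0, 0]"]) (simp add: dot3_def vector_3)
    next
      assume "i = 2" then show ?thesis using i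
        by (intro exI[of _ "vector [0, 1 / w$2, 0]"]) (simp add: dot3_def vector_3)
    next
      assume "i = 3" then show ?thesis using i
        by (intro exI[of _ "vector [0, 0, 1 / w$3]"]) (simp add: dot3_def vector_3)
    qed
  qed
  then show thesis using that by blast
qed

lemma crs_eq_0_imp_parallel:
  assumes "crs u v = 0" "u \<noteq> 0" obtains a where "v = a *s u"
proof -
  obtain z where z: "dot3 z u = 1" using nonzero_component[OF assms(2)] by metis
  have "crs z (crs u v) = 0" by (simp add: assms)
  then have "dot3 z v *s u = v" by (simp add: crs_crs z)
  then show thesis using that by metis
qed

lemma dot3_both_0:
  assumes "crs u v \<noteq> 0" "dot3 u p = 0" "dot3 v p = 0" obtains a where "p = a *s crs u v"
proof -
  have "crs p (crs u v) = 0" using assms by (simp add: crs_crs dot3_commute)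
  then show thesis using crs_eq_0_imp_parallel[OF _ assms(1)] that
    by (metis crs_eq_0_swap)
qed

lemma plane_span:
  assumes "n \<noteq> 0" "dot3 n p = 0" "dot3 n q = 0" "crs p q \<noteq> 0" "dot3 n x = 0"
  obtains a b where "x = a *s p + b *s q"
proof -
  obtain l where l: "n = l *s crs p q"
    using dot3_both_0[OF assms(4)] assms(2,3) by (metis dot3_commute)
  have l0: "l \<noteq> 0" using l assms(1) by auto
  obtain z where z: "dot3 z (crs p q) = 1" using nonzero_component[OF assms(4)] by metis
  have x: "dot3 (crs p q) x = 0" using assms(5) l l0 by simp
  \<comment> \<open>Cramer's rule for \<open>x\<close> in the frame \<open>p\<close>,
    \<open>q\<close>, \<open>z\<close>. The coefficient of \<open>z\<close> vanishes because
    \<open>crs p q\<close> is proportional to \<open>n\<close>.\<close>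
  have "dot3 z (crs p q) *s x = dot3 z (crs x q) *s p + dot3 z (crs p x) *s q + dot3 (crs p q) x *s z"
    by (simp add: vec3_eq_iff dot3_def algebra_simps)
  then have "x = dot3 z (crs x q) *s p + dot3 z (crs p x) *s q" using z x by simp
  then show thesis using that by blast
qed

lemma plane_scale: "a \<noteq> 0 \<Longrightarrow> plane (a *s n) = plane n"
  by (simp add: plane_def)

lemma subspace_plane: "vec.subspace (plane n)"
  by (auto simp: vec.subspace_def plane_def)

lemma dim_plane:
  assumes "n \<noteq> 0" shows "vec.dim (plane n) = 2"
proof -
  have "\<exists>p q. dot3 n p = 0 \<and> dot3 n q = 0 \<and> crs p q \<noteq> 0"
  proof -
    obtain z where z: "dot3 z n = 1" using nonzero_component[OF assms] by metis
    let ?e = "\<lambda>a b c. (vector [a,b,c] :: complex^3)"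
    \<comment> \<open>Crossing with \<open>n\<close> produces vectors of the plane; by this identity
      two of them are independent as soon as \<open>n\<close> is not orthogonal to
      \<open>crs z' w\<close>.\<close>
    have a: "crs (crs z' n) (crs w n) = dot3 n (crs z' w) *s n" for z' w
      by (simp add: vec3_eq_iff dot3_def algebra_simps)
    have "\<exists>z' w. dot3 n (crs z' w) \<noteq> 0"
    proof (rule ccontr)
      assume "\<not> ?thesis"
      then have *: "dot3 n (crs z' w) = 0" for z' w by blast
      from *[of "?e 1 0 0" "?e 0 1 0"] *[of "?e 0 1 0" "?e 0 0 1"] *[of "?e 0 0 1" "?e 1 0 0"]
      have "n = 0" by (simp add: dot3_def vector_3 vec3_eq_iff)
      then show False using assms by simp
    qed
    then obtain z' w where "dot3 n (crs z' w) \<noteq> 0" by blast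
    then have "crs (crs z' n) (crs w n) \<noteq> 0" using a assms by simp
    then show ?thesis by (metis dot3_crs(2))
  qed
  then obtain p q where pq: "dot3 n p = 0" "dot3 n q = 0" "crs p q \<noteq> 0" by blast
  have neq: "p \<noteq> q" using pq(3) by auto
  have "vec.independent {p, q}"
  proof -
    have "q \<noteq> 0" using pq(3) by auto
    moreover have "p \<notin> vec.span {q}"
    proof
      assume "p \<in> vec.span {q}"
      then obtain a where "p = a *s q" by (auto simp: vec.span_singleton)
      then show False using pq(3) by (simp add: crs_scaleL)
    qed
    ultimately show ?thesis by (simp add: vec.independent_insert neq)
  qed
  moreover have "{p, q} \<subseteq> plane n" using pq by (simp add: plane_def)
  moreover have "plane n \<subseteq> vec.span {p, q}"
  proof
    fix x assume "x \<in> plane n"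
    then obtain a b where "x = a *s p + b *s q"
      using plane_span[OF assms pq] by (auto simp: plane_def)
    then show "x \<in> vec.span {p, q}"
      by (simp add: vec.span_add vec.span_base vec.span_scale)
  qed
  ultimately show ?thesis using neq vec.dim_unique[of "{p,q}" "plane n" 2] by simp
qed

lemma plane_in_cp2_lines: "n \<noteq> 0 \<Longrightarrow> plane n \<in> cp2_lines"
  by (simp add: cp2_lines_def subspace_plane dim_plane)

lemma cp2_lines_plane:
  assumes "l \<in> cp2_lines" obtains n where "n \<noteq> 0" "l = plane n"
proof -
  have l: "vec.subspace l" "vec.dim l = 2" using assms by (auto simp: cp2_lines_def)
  obtain B where B: "B \<subseteq> l" "vec.independent B" "l \<subseteq> vec.span B" "card B = 2"
    using vec.basis_exists[of l] l(2) by metis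
  then obtain p q where pq: "B = {p, q}" "p \<noteq> q" by (meson card_2_iff)
  have q0: "q \<noteq> 0" "p \<noteq> 0" using B(2) pq vec.dependent_zero by auto
  have c: "crs p q \<noteq> 0"
  proof
    assume "crs p q = 0"
    then obtain a where "q = a *s p" using crs_eq_0_imp_parallel q0 by metis
    then have "q \<in> vec.span {p}" by (simp add: vec.span_base vec.span_scale)
    moreover have "vec.independent {q, p}" using B(2) pq by (simp add: insert_commute)
    ultimately show False using pq(2) by (simp add: vec.independent_insert split: if_splits)
  qed
  have sp: "l = vec.span B" using B l(1) by (metis vec.span_minimal subset_antisym)
  have "l = plane (crs p q)"
  proof
    show "l \<subseteq> plane (crs p q)" unfolding sp
      by (rule vec.span_minimal) (auto simp: pq subspace_plane, auto simp: plane_def)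
    show "plane (crs p q) \<subseteq> l"
    proof
      fix x assume "x \<in> plane (crs p q)"
      then obtain a b where "x = a *s p + b *s q"
        using plane_span[OF c, of p q x] c by (auto simp: plane_def)
      then show "x \<in> l" unfolding sp pq by (simp add: vec.span_add vec.span_base vec.span_scale)
    qed
  qed
  then show thesis using that c by blast
qed

lemma plane_Int:
  assumes "crs m n \<noteq> 0" shows "plane m \<inter> plane n = vec.span {crs m n}"
proof -
  have "x \<in> vec.span {crs m n}" if "dot3 m x = 0" "dot3 n x = 0" for x
    using dot3_both_0[OF assms that] by (metis vec.span_base vec.span_scale insertI1)
  moreover have "x \<in> plane m \<inter> plane n" if "x \<in> vec.span {crs m n}" for x
    using that by (auto simp: vec.span_singleton plane_def)
  ultimately show ?thesis by (auto simp: plane_def)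
qed

lemma span_singleton_cp2_points: "p \<noteq> 0 \<Longrightarrow> vec.span {p} \<in> cp2_points"
  using vec.dim_eq_card_independent[of "{p}"] by (simp add: cp2_points_def vec.dim_span)

lemma span_singleton_subset_plane: "vec.span {p} \<subseteq> plane n \<longleftrightarrow> dot3 n p = 0"
  by (auto simp: plane_def vec.span_singleton)
   (metis (mono_tags, lifting) UNIV_I image_subset_iff mem_Collect_eq vector_smult_lid)

lemma plane_eq_iff:
  assumes "m \<noteq> 0" "n \<noteq> 0" shows "plane m = plane n \<longleftrightarrow> crs m n = 0"
proof
  assume e: "plane m = plane n"
  show "crs m n = 0"
  proof (rule ccontr)
    assume c: "crs m n \<noteq> 0"
    have "plane m = vec.span {crs m n}" using plane_Int[OF c] e by simp
    then have "vec.dim (plane m) = 1"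
      using span_singleton_cp2_points[OF c] by (simp add: cp2_points_def)
    then show False using dim_plane[OF assms(1)] by simp
  qed
next
  assume "crs m n = 0"
  then obtain a where a: "n = a *s m" using crs_eq_0_imp_parallel assms by metis
  then have "a \<noteq> 0" using assms(2) by auto
  then show "plane m = plane n" using a plane_scale by metis
qed

section \<open>Nets in coordinates and their constant cross-ratio\<close>

text \<open>The set of base points is eliminated: a base point is the cross product of two lines of
  different classes, and the second clause is the net axiom at that point. Classes count from 0, so
  class \<open>w\<close> here is class \<open>Suc w\<close> of \<open>is_net\<close>.\<close>

definition vnet :: "nat \<Rightarrow> (nat \<Rightarrow> nat \<Rightarrow> complex^3) \<Rightarrow> bool" where
  "vnet k n \<longleftrightarrow>
     (\<forall>w<4. \<forall>x<4. \<forall>i<k. \<forall>j<k. (w, i) \<noteq> (x, j) \<longrightarrow> crs (n w i) (n x j) \<noteq> 0) \<and>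
     (\<forall>w<4. \<forall>x<4. \<forall>z<4. \<forall>i<k. \<forall>j<k. w \<noteq> x \<longrightarrow>
        (\<exists>!m. m < k \<and> dot3 (n z m) (crs (n w i) (n x j)) = 0))"

lemma is_net_imp_vnet:
  assumes "is_net 4 k L A chi"
  obtains n where "vnet k n" "\<And>w. w < 4 \<Longrightarrow> bij_betw (\<lambda>i. plane (n w i)) {..<k} (A (Suc w))"
proof -
  note D = assms[unfolded is_net_def]
  have A1: "L \<subseteq> cp2_lines" and A3: "L = (\<Union>i\<in>{1..4}. A i)" and A4: "disjoint_family_on A {1..4}"
    and A5: "\<forall>i\<in>{1..4}. finite (A i) \<and> card (A i) = k"
    and A6: "\<forall>i\<in>{1..4}. \<forall>j\<in>{1..4}. i \<noteq> j \<longrightarrow> (\<forall>l1\<in>A i. \<forall>l2\<in>A j. l1 \<inter> l2 \<in> chi)"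
    and A7: "\<forall>X\<in>chi. \<forall>i\<in>{1..4}. \<exists>!l. l \<in> A i \<and> X \<subseteq> l"
    using D by - (elim conjE, assumption)+
  have "\<exists>g. bij_betw g {..<k} (A (Suc w))" if "w < 4" for w
    using A5 that ex_bij_betw_nat_finite[of "A (Suc w)"] by (auto simp: lessThan_atLeast0)
  then obtain g where g: "\<And>w. w < 4 \<Longrightarrow> bij_betw (g w) {..<k} (A (Suc w))" by metis
  have gA: "g w i \<in> A (Suc w)" if "w < 4" "i < k" for w i
    using bij_betwE[OF g[OF that(1)]] that(2) by blast
  have "\<exists>v. v \<noteq> 0 \<and> g w i = plane v" if "w < 4" "i < k" for w i
  proof -
    have "g w i \<in> L" using gA[OF that] A3 that(1) by force
    then show ?thesis using A1 cp2_lines_plane by (metis subsetD)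
  qed
  then obtain n where n: "\<And>w i. w < 4 \<Longrightarrow> i < k \<Longrightarrow> n w i \<noteq> 0 \<and> g w i = plane (n w i)" by metis
  have ne: "g w i \<noteq> g x j" if "w < 4" "x < 4" "i < k" "j < k" "(w, i) \<noteq> (x, j)" for w x i j
  proof (cases "w = x")
    case True
    then show ?thesis using g[OF that(1)] that by (auto simp: bij_betw_def inj_on_def)
  next
    case False
    then have "A (Suc w) \<inter> A (Suc x) = {}"
      using that(1,2) by (intro disjoint_family_onD[OF A4]) auto
    then show ?thesis using gA that by (metis IntI emptyE)
  qed
  have c: "crs (n w i) (n x j) \<noteq> 0" if "w < 4" "x < 4" "i < k" "j < k" "(w, i) \<noteq> (x, j)" for w x i j
    using ne[OF that] n that by (metis plane_eq_iff)
  have u: "\<exists>!m. m < k \<and> dot3 (n z m) (crs (n w i) (n x j)) = 0"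
    if h: "w < 4" "x < 4" "z < 4" "i < k" "j < k" "w \<noteq> x" for w x z i j
  proof -
    have cr: "crs (n w i) (n x j) \<noteq> 0" using c h by simp
    have "g w i \<inter> g x j \<in> chi" using A6[rule_format, of "Suc w" "Suc x"] gA h by auto
    then have "vec.span {crs (n w i) (n x j)} \<in> chi"
      using plane_Int[OF cr] n h by simp
    then have "\<exists>!l. l \<in> A (Suc z) \<and> vec.span {crs (n w i) (n x j)} \<subseteq> l" using A7 h by simp
    then obtain l where l: "l \<in> A (Suc z)" "vec.span {crs (n w i) (n x j)} \<subseteq> l"
      and un: "\<And>l'. l' \<in> A (Suc z) \<Longrightarrow> vec.span {crs (n w i) (n x j)} \<subseteq> l' \<Longrightarrow> l' = l" by metis
    obtain m where m: "m < k" "g z m = l" using g[OF h(3)] l(1)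
      by (metis bij_betw_def imageE lessThan_iff)
    show ?thesis
    proof (intro ex1I[of _ m] conjI)
      show "m < k" by fact
      show "dot3 (n z m) (crs (n w i) (n x j)) = 0"
        using l(2) m n[OF h(3) m(1)] span_singleton_subset_plane by metis
      fix m' assume m': "m' < k \<and> dot3 (n z m') (crs (n w i) (n x j)) = 0"
      then have "g z m' = l" using un[OF gA[OF h(3)]] n[OF h(3)] span_singleton_subset_plane by metis
      then show "m' = m" using g[OF h(3)] m m' by (auto simp: bij_betw_def inj_on_def)
    qed
  qed
  have v: "vnet k n" unfolding vnet_def by (intro conjI allI impI) (fact c, fact u)
  have "bij_betw (\<lambda>i. plane (n w i)) {..<k} (A (Suc w))" if "w < 4" for w
    using g[OF that] by (rule bij_betw_cong[THEN iffD1, rotated]) (use n that in auto)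
  then show thesis using that v by blast
qed

locale net =
  fixes k :: nat and n :: "nat \<Rightarrow> nat \<Rightarrow> complex^3"
  assumes vnet: "vnet k n" and k2: "2 \<le> k"
begin

lemma crs_nz: "w < 4 \<Longrightarrow> x < 4 \<Longrightarrow> i < k \<Longrightarrow> j < k \<Longrightarrow> (w, i) \<noteq> (x, j) \<Longrightarrow> crs (n w i) (n x j) \<noteq> 0"
  using vnet unfolding vnet_def by blast

lemma n_nz: "w < 4 \<Longrightarrow> i < k \<Longrightarrow> n w i \<noteq> 0"
  using crs_nz[of w w i 0] crs_nz[of w w i 1] k2 by (cases "i = 0") auto

definition chi :: "complex^3 \<Rightarrow> bool" where
  "chi p \<longleftrightarrow> p \<noteq> 0 \<and> (\<exists>w<4. \<exists>x<4. \<exists>i<k. \<exists>j<k. w \<noteq> x \<and> dot3 (n w i) p = 0 \<and> dot3 (n x j) p = 0)"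

definition idx :: "nat \<Rightarrow> complex^3 \<Rightarrow> nat" where
  "idx z p = (THE m. m < k \<and> dot3 (n z m) p = 0)"

lemma chiI: "p \<noteq> 0 \<Longrightarrow> w < 4 \<Longrightarrow> x < 4 \<Longrightarrow> i < k \<Longrightarrow> j < k \<Longrightarrow> w \<noteq> x \<Longrightarrow>
    dot3 (n w i) p = 0 \<Longrightarrow> dot3 (n x j) p = 0 \<Longrightarrow> chi p"
  unfolding chi_def by blast

lemma chi_crs: "w < 4 \<Longrightarrow> x < 4 \<Longrightarrow> i < k \<Longrightarrow> j < k \<Longrightarrow> w \<noteq> x \<Longrightarrow> chi (crs (n w i) (n x j))"
  by (rule chiI[of _ w x i j]) (auto simp: crs_nz)

lemma chi_ex1:
  assumes "chi p" "z < 4" shows "\<exists>!m. m < k \<and> dot3 (n z m) p = 0"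
proof -
  obtain w x i j where h: "p \<noteq> 0" "w < 4" "x < 4" "i < k" "j < k" "w \<noteq> x"
    "dot3 (n w i) p = 0" "dot3 (n x j) p = 0" using assms(1) unfolding chi_def by blast
  obtain a where a: "p = a *s crs (n w i) (n x j)"
    using dot3_both_0[OF crs_nz[of w x i j]] h by blast
  then have "a \<noteq> 0" using h(1) by auto
  then show ?thesis using vnet a h assms(2) unfolding vnet_def by simp
qed

lemma idx: assumes "chi p" "z < 4" shows "idx z p < k" "dot3 (n z (idx z p)) p = 0"
  using theI'[OF chi_ex1[OF assms]] unfolding idx_def by auto

lemma idx_eq: "chi p \<Longrightarrow> z < 4 \<Longrightarrow> m < k \<Longrightarrow> dot3 (n z m) p = 0 \<Longrightarrow> idx z p = m"
  using chi_ex1 idx by blast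

lemma chi_parallel:
  assumes "chi p" "chi q" "w < 4" "x < 4" "w \<noteq> x" "idx w p = idx w q" "idx x p = idx x q"
  obtains a where "a \<noteq> 0" "p = a *s q"
proof -
  let ?c = "crs (n w (idx w p)) (n x (idx x p))"
  have c: "?c \<noteq> 0" using assms idx by (intro crs_nz) auto
  obtain a b where ab: "p = a *s ?c" "q = b *s ?c"
    using dot3_both_0[OF c] idx assms by metis
  have "a \<noteq> 0" "b \<noteq> 0" using ab assms(1,2) unfolding chi_def by auto
  then have "a / b \<noteq> 0" "p = (a / b) *s q" using ab by auto
  then show thesis using that by blast
qed

lemma idx_parallel:
  assumes "chi q" "p = a *s q" "a \<noteq> 0" "z < 4" shows "chi p" "idx z p = idx z q"
proof -
  show "chi p" using assms(1-3) unfolding chi_def by simp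
  then show "idx z p = idx z q" using assms idx[OF assms(1,4)] by (intro idx_eq) auto
qed

text \<open>At such a point the products of all classes other than \<open>w\<close> are nonzero, so
  their quotients can be evaluated. The meets of two lines of class \<open>w\<close> are of this
  kind.\<close>

definition free :: "nat \<Rightarrow> complex^3 \<Rightarrow> bool" where
  "free w q \<longleftrightarrow> q \<noteq> 0 \<and> (\<forall>x<4. \<forall>m<k. x \<noteq> w \<longrightarrow> dot3 (n x m) q \<noteq> 0)"

lemma free_crs:
  assumes "w < 4" "i < k" "j < k" "i \<noteq> j" shows "free w (crs (n w i) (n w j))"
proof -
  let ?q = "crs (n w i) (n w j)"
  have q: "?q \<noteq> 0" using assms by (intro crs_nz) auto
  have "dot3 (n x m) ?q \<noteq> 0" if "x < 4" "m < k" "x \<noteq> w" for x m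
  proof
    assume "dot3 (n x m) ?q = 0"
    then have "chi ?q" using assms that q by (intro chiI[of _ w x i m]) auto
    then have "idx w ?q = i" "idx w ?q = j" using assms by (auto intro: idx_eq)
    then show False using assms(4) by simp
  qed
  then show ?thesis using q unfolding free_def by blast
qed

section \<open>Comparing the products of two classes along a line of a third\<close>

definition F :: "nat \<Rightarrow> complex^3 \<Rightarrow> complex" where
  "F x q = (\<Prod>m<k. dot3 (n x m) q)"

text \<open>The cofactor of the factor of \<open>F x\<close> that vanishes at the base point
  \<open>p\<close>: the differential of \<open>F x\<close> at \<open>p\<close> in direction
  \<open>v\<close> is \<open>dot3 (n x (idx x p)) v * R x p\<close>.\<close>

definition R :: "nat \<Rightarrow> complex^3 \<Rightarrow> complex" where
  "R x p = (\<Prod>m\<in>{..<k} - {idx x p}. dot3 (n x m) p)"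

lemma R_nz: "chi p \<Longrightarrow> x < 4 \<Longrightarrow> R x p \<noteq> 0"
  unfolding R_def using idx_eq by auto

lemma F_nz: "free w q \<Longrightarrow> x < 4 \<Longrightarrow> x \<noteq> w \<Longrightarrow> F x q \<noteq> 0"
  unfolding F_def free_def by auto

text \<open>On the line parametrised by \<open>p - r *s q\<close>, the number \<open>f x m\<close>
  is the parameter of the point on line \<open>m\<close> of class \<open>x\<close>. All classes
  other than \<open>w\<close> cut out the same base points, so the set of parameters is independent
  of \<open>x\<close>, and the parameter 0 belongs to \<open>p\<close>. Hence the differential of
  \<open>F x\<close> in direction \<open>q\<close> is \<open>F x q\<close> times a factor common to
  these classes.\<close>

lemma residue_product:
  assumes w: "w < 4" "x < 4" "x \<noteq> w" and p: "chi p" and q: "free w q" "dot3 (n w (idx w p)) q = 0"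
  defines "f \<equiv> \<lambda>x m. dot3 (n x m) p / dot3 (n x m) q"
  shows "inj_on (f x) {..<k}"
    and "dot3 (n x (idx x p)) q * R x p = F x q * \<Prod>(f x ` {..<k} - {0})"
    and "\<And>z. z < 4 \<Longrightarrow> z \<noteq> w \<Longrightarrow> f x ` {..<k} \<subseteq> f z ` {..<k}"
proof -
  have qx: "dot3 (n x m) q \<noteq> 0" if "m < k" "x < 4" "x \<noteq> w" for x m
    using q(1) that unfolding free_def by blast
  have ch: "chi (p - f x m *s q)" "dot3 (n x m) (p - f x m *s q) = 0" if m: "m < k" for m
  proof -
    show 1: "dot3 (n x m) (p - f x m *s q) = 0" using qx[OF m] w by (simp add: f_def)
    have "p - f x m *s q \<noteq> 0"
    proof
      assume "p - f x m *s q = 0"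
      then have e: "p = f x m *s q" by simp
      then have "f x m \<noteq> 0" using p unfolding chi_def by auto
      moreover have "dot3 (n x (idx x p)) (f x m *s q) = 0" using idx(2)[OF p w(2)] e by simp
      ultimately show False using qx[of "idx x p" x] idx[OF p w(2)] w by simp
    qed
    moreover have "dot3 (n w (idx w p)) (p - f x m *s q) = 0" using idx(2)[OF p w(1)] q(2) by simp
    ultimately show "chi (p - f x m *s q)"
      using 1 w m idx(1)[OF p w(1)] by (intro chiI[of _ w x "idx w p" m]) auto
  qed
  show inj: "inj_on (f x) {..<k}"
  proof (rule inj_onI)
    fix m m' assume h: "m \<in> {..<k}" "m' \<in> {..<k}" "f x m = f x m'"
    then show "m = m'" using ch[of m] ch[of m'] idx_eq[of "p - f x m *s q" x] w by auto
  qed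
  have f0: "f x m = 0 \<longleftrightarrow> m = idx x p" if "m < k" for m
  proof -
    have "f x m = 0 \<longleftrightarrow> dot3 (n x m) p = 0" using qx[OF that w(2,3)] by (simp add: f_def)
    also have "\<dots> \<longleftrightarrow> m = idx x p" using idx(2)[OF p w(2)] idx_eq[OF p w(2) that] by metis
    finally show ?thesis .
  qed
  have im: "f x ` {..<k} - {0} = f x ` ({..<k} - {idx x p})" using f0 by auto
  have "\<Prod>(f x ` {..<k} - {0}) = (\<Prod>m\<in>{..<k} - {idx x p}. f x m)"
    unfolding im by (subst prod.reindex) (use inj in \<open>auto intro: inj_on_subset\<close>)
  also have "\<dots> = R x p / (\<Prod>m\<in>{..<k} - {idx x p}. dot3 (n x m) q)"
    unfolding R_def f_def by (rule prod_dividef)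
  finally have e: "\<Prod>(f x ` {..<k} - {0}) = R x p / (\<Prod>m\<in>{..<k} - {idx x p}. dot3 (n x m) q)" .
  have "(\<Prod>m\<in>{..<k} - {idx x p}. dot3 (n x m) q) \<noteq> 0" using qx w by simp
  moreover have "F x q = dot3 (n x (idx x p)) q * (\<Prod>m\<in>{..<k} - {idx x p}. dot3 (n x m) q)"
    unfolding F_def using idx(1)[OF p w(2)] by (intro prod.remove) auto
  ultimately show "dot3 (n x (idx x p)) q * R x p = F x q * \<Prod>(f x ` {..<k} - {0})"
    unfolding e by simp
  show "f x ` {..<k} \<subseteq> f z ` {..<k}" if z: "z < 4" "z \<noteq> w" for z
  proof
    fix r assume "r \<in> f x ` {..<k}"
    then obtain m where m: "m < k" "r = f x m" by auto
    let ?m = "idx z (p - r *s q)"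
    have "?m < k" "dot3 (n z ?m) (p - r *s q) = 0" using idx[OF ch(1)[OF m(1)] z(1)] m(2) by simp_all
    then have "r = f z ?m" using qx[of ?m z] z by (simp add: f_def)
    then show "r \<in> f z ` {..<k}" using \<open>?m < k\<close> by blast
  qed
qed

text \<open>A vector \<open>v\<close> of the line is a combination of \<open>p\<close> and
  \<open>q\<close>, and both differentials vanish on \<open>p\<close>. The comparison in direction
  \<open>q\<close> therefore decides every direction.\<close>

lemma residue_ratio:
  assumes w: "w < 4" "x < 4" "x \<noteq> w" "z < 4" "z \<noteq> w"
    and p: "chi p" and q: "free w q" "dot3 (n w (idx w p)) q = 0" and v: "dot3 (n w (idx w p)) v = 0"
  shows "dot3 (n x (idx x p)) v * R x p = F x q / F z q * (dot3 (n z (idx z p)) v * R z p)"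
proof -
  let ?f = "\<lambda>x m. dot3 (n x m) p / dot3 (n x m) q"
  have "?f x ` {..<k} = ?f z ` {..<k}"
    using residue_product(3)[OF w(1-3) p q w(4,5)] residue_product(3)[OF w(1,4,5) p q w(2,3)]
    by blast
  then have 1: "dot3 (n x (idx x p)) q * R x p = F x q / F z q * (dot3 (n z (idx z p)) q * R z p)"
    using residue_product(2)[OF w(1-3) p q] residue_product(2)[OF w(1,4,5) p q] F_nz[OF q(1) w(4,5)]
    by simp
  have "crs p q \<noteq> 0"
  proof
    assume "crs p q = 0"
    then obtain a where a: "q = a *s p" using crs_eq_0_imp_parallel p unfolding chi_def by metis
    then have "dot3 (n x (idx x p)) q = 0" using idx(2)[OF p w(2)] by simp
    then show False using q(1) idx(1)[OF p w(2)] w unfolding free_def by blast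
  qed
  then obtain a b where v: "v = a *s p + b *s q"
    using plane_span[OF n_nz[OF w(1) idx(1)[OF p w(1)]] idx(2)[OF p w(1)] q(2) _ v] by metis
  have "dot3 (n y (idx y p)) v = b * dot3 (n y (idx y p)) q" if "y < 4" for y
    using idx(2)[OF p that] v by simp
  then have 2: "dot3 (n x (idx x p)) v * R x p = b * (dot3 (n x (idx x p)) q * R x p)"
    and 3: "dot3 (n z (idx z p)) v * R z p = b * (dot3 (n z (idx z p)) q * R z p)" using w by simp_all
  show ?thesis unfolding 2 3 1 by (simp only: mult.left_commute)
qed

text \<open>The constant does not depend on the line of class \<open>w\<close>, because any two lines of one class
  meet outside the base points.\<close>

lemma class_constant:
  assumes w: "w < 4" "x < 4" "x \<noteq> w" "z < 4" "z \<noteq> w"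
  obtains c where "c \<noteq> 0" "\<And>p v. chi p \<Longrightarrow> dot3 (n w (idx w p)) v = 0 \<Longrightarrow>
     dot3 (n x (idx x p)) v * R x p = c * (dot3 (n z (idx z p)) v * R z p)"
proof -
  let ?c = "\<lambda>q. F x q / F z q"
  have same: "?c q = ?c q'" if h: "i < k" "free w q" "free w q'" "dot3 (n w i) q = 0" "dot3 (n w i) q' = 0"
    for i q q'
  proof -
    let ?p = "crs (n w i) (n x 0)"
    have p: "chi ?p" using chi_crs[of w x i 0] w h k2 by simp
    have i: "idx w ?p = i" using idx_eq[OF p w(1) h(1)] by simp
    have "?c q * (dot3 (n z (idx z ?p)) q * R z ?p) = ?c q' * (dot3 (n z (idx z ?p)) q * R z ?p)"
      using residue_ratio[OF w p h(2), of q] residue_ratio[OF w p h(3), of q] h i by simp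
    moreover have "dot3 (n z (idx z ?p)) q \<noteq> 0"
      using h(2) w idx(1)[OF p w(4)] unfolding free_def by blast
    ultimately show ?thesis using R_nz[OF p w(4)] by (metis mult_cancel_right mult_eq_0_iff)
  qed
  let ?q = "\<lambda>i. crs (n w 0) (n w i)"
  have fr: "free w (?q i)" if "0 < i" "i < k" for i
    using free_crs[of w 0 i] w that by simp
  have "\<exists>q. free w q \<and> dot3 (n w i) q = 0 \<and> ?c q = ?c (?q 1)" if i: "i < k" for i
  proof (cases "i = 0")
    case True then show ?thesis using fr[of 1] k2 by (intro exI[of _ "?q 1"]) simp
  next
    case False
    then show ?thesis using fr[of i] fr[of 1] same[of 0 "?q i" "?q 1"] i k2
      by (intro exI[of _ "?q i"]) simp
  qed
  then have "dot3 (n x (idx x p)) v * R x p = ?c (?q 1) * (dot3 (n z (idx z p)) v * R z p)"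
    if "chi p" "dot3 (n w (idx w p)) v = 0" for p v
    using residue_ratio[OF w] that idx(1)[OF that(1) w(1)] by metis
  moreover have "?c (?q 1) \<noteq> 0" using F_nz[OF fr[of 1]] w k2 by simp
  ultimately show thesis using that by blast
qed

lemma chi_eq_index:
  assumes c: "chi p" "chi q" "w < 4" "x < 4" "w \<noteq> x" "idx w p = idx w q" "idx x p = idx x q" "z < 4"
  shows "idx z p = idx z q"
proof -
  obtain a where "a \<noteq> 0" "p = a *s q" using chi_parallel[OF c(1-7)] .
  then show ?thesis using idx_parallel(2)[OF c(2) _ _ c(8)] by blast
qed

section \<open>Base points as cells of a table, and coordinates within one row\<close>

definition pt :: "nat \<times> nat \<Rightarrow> complex^3" where
  "pt = (\<lambda>(i, j). crs (n 0 i) (n 1 j))"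

definition lab :: "nat \<Rightarrow> nat \<times> nat \<Rightarrow> nat" where
  "lab w p = idx w (pt p)"

lemma chi_pt: "p \<in> {..<k} \<times> {..<k} \<Longrightarrow> chi (pt p)"
  unfolding pt_def using chi_crs[of 0 1] by auto

lemma lab_pt:
  assumes "p \<in> {..<k} \<times> {..<k}" shows "(lab 0 p, lab 1 p) = p"
  using chi_pt[OF assms] assms idx_eq[of "pt p" 0 "fst p"] idx_eq[of "pt p" 1 "snd p"]
  unfolding lab_def by (auto simp: pt_def)

lemma bij_lab:
  assumes w: "w < 4" "x < 4" "w \<noteq> x"
  shows "bij_betw (\<lambda>p. (lab w p, lab x p)) ({..<k} \<times> {..<k}) ({..<k} \<times> {..<k})"
proof -
  let ?P = "{..<k} \<times> {..<k}" and ?h = "\<lambda>p. (lab w p, lab x p)"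
  have "inj_on ?h ?P"
  proof (rule inj_onI)
    fix p q assume h: "p \<in> ?P" "q \<in> ?P" "?h p = ?h q"
    then have "lab 0 p = lab 0 q" "lab 1 p = lab 1 q" unfolding lab_def
      using chi_eq_index[OF chi_pt[OF h(1)] chi_pt[OF h(2)] w] by simp_all
    then show "p = q" using lab_pt h(1,2) by metis
  qed
  moreover have "?h ` ?P \<subseteq> ?P" using idx(1)[OF chi_pt] w by (auto simp: lab_def)
  ultimately show ?thesis
    by (simp add: bij_betw_def endo_inj_surj)
qed

text \<open>Affine coordinate on the line \<open>a'\<close> of class 0, with origin at its point on line 0 of class 1 and
  with infinity at its intersection with the line \<open>a\<close>.\<close>

definition coord :: "nat \<Rightarrow> nat \<Rightarrow> nat \<Rightarrow> complex" where
  "coord a a' m = - (dot3 (n 1 m) (crs (n 0 a') (n 1 0)) / dot3 (n 1 m) (crs (n 0 a) (n 0 a')))"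

lemma coord:
  assumes "a < k" "a' < k" "a \<noteq> a'" "chi p" "idx 0 p = a'"
  obtains s where "s \<noteq> 0"
    "p = s *s (crs (n 0 a') (n 1 0) + coord a a' (idx 1 p) *s crs (n 0 a) (n 0 a'))"
proof -
  let ?x = "crs (n 0 a') (n 1 0)" and ?q = "crs (n 0 a) (n 0 a')" and ?m = "idx 1 p"
  let ?y = "?x + coord a a' ?m *s ?q"
  have q: "free 0 ?q" using free_crs[of 0 a a'] assms by simp
  have m: "?m < k" using idx(1)[OF assms(4)] by simp
  have nq: "dot3 (n 1 j) ?q \<noteq> 0" if "j < k" for j using q that unfolding free_def by simp
  have x: "chi ?x" using chi_crs[of 0 1] assms k2 by simp
  have y1: "dot3 (n 1 ?m) ?y = 0" using nq[OF m] by (simp add: coord_def)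
  have y0: "dot3 (n 0 a') ?y = 0" by simp
  have "?y \<noteq> 0"
  proof
    assume "?y = 0"
    then have e: "?x = (- coord a a' ?m) *s ?q"
      by (simp add: eq_neg_iff_add_eq_0)
    have "coord a a' ?m \<noteq> 0" using e x unfolding chi_def by auto
    moreover have "dot3 (n 1 0) ?x = 0" by simp
    ultimately have "dot3 (n 1 0) ?q = 0" unfolding e by simp
    then show False using nq[of 0] k2 by simp
  qed
  then have y: "chi ?y" using y0 y1 m assms by (intro chiI[of _ 0 1 a' ?m]) auto
  moreover have "idx 0 ?y = idx 0 p" "idx 1 ?y = idx 1 p"
    using idx_eq[OF y _ _ y0] idx_eq[OF y _ m y1] assms by auto
  ultimately show thesis using chi_parallel[OF assms(4) y, of 0 1] that by auto
qed

lemma coord_inj: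
  assumes "a < k" "a' < k" "a \<noteq> a'" "chi p" "idx 0 p = a'" "chi p'" "idx 0 p' = a'"
    "coord a a' (idx 1 p) = coord a a' (idx 1 p')"
  shows "idx 1 p = idx 1 p'"
proof -
  let ?y = "crs (n 0 a') (n 1 0) + coord a a' (idx 1 p) *s crs (n 0 a) (n 0 a')"
  obtain s where s: "s \<noteq> 0" "p = s *s ?y" using coord[OF assms(1-5)] by metis
  obtain s' where s': "s' \<noteq> 0" "p' = s' *s ?y" using coord[OF assms(1-3,6,7)] assms(8) by metis
  have "p = (s / s') *s p'"
    by (subst s'(2), subst s(2)) (use s'(1) in simp)
  then show ?thesis using idx_parallel(2)[OF assms(6), of p "s / s'" 1] s(1) s'(1) by simp
qed

text \<open>Replacing \<open>a\<close> by \<open>b\<close> moves the point at infinity of the line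
  \<open>a'\<close>, which is a Moebius change of coordinate. Differences under such a map are
  multiplied by one global constant and by one factor for each of the two points.\<close>

lemma coord_cross_ratio:
  assumes "a < k" "b < k" "a' < k" "a \<noteq> a'" "b \<noteq> a'"
  obtains \<beta> e where "\<And>m m'. m < k \<Longrightarrow> m' < k \<Longrightarrow>
      coord b a' m - coord b a' m' = \<beta> * e m * e m' * (coord a a' m - coord a a' m')"
proof -
  let ?x = "crs (n 0 a') (n 1 0)" and ?q = "\<lambda>a. crs (n 0 a) (n 0 a')"
  have q: "free 0 (?q c)" if "c < k" "c \<noteq> a'" for c using free_crs[of 0 c a'] assms that by simp
  have nq: "dot3 (n 1 j) (?q c) \<noteq> 0" if "j < k" "c < k" "c \<noteq> a'" for j c
    using q[OF that(2,3)] that unfolding free_def by simp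
  have x: "chi ?x" using chi_crs[of 0 1] assms k2 by simp
  have "crs ?x (?q a) \<noteq> 0"
  proof
    assume "crs ?x (?q a) = 0"
    then obtain r where "?q a = r *s ?x" using crs_eq_0_imp_parallel x unfolding chi_def by metis
    then have "dot3 (n 1 0) (?q a) = 0" by simp
    then show False using nq[of 0 a] assms k2 by simp
  qed
  then obtain u v where uv: "?q b = u *s ?x + v *s ?q a"
    using plane_span[of "n 0 a'" ?x "?q a" "?q b"] n_nz[of 0 a'] assms by auto
  let ?e = "\<lambda>m. dot3 (n 1 m) (?q a) / dot3 (n 1 m) (?q b)"
  have "coord b a' m - coord b a' m' = v * ?e m * ?e m' * (coord a a' m - coord a a' m')"
    if "m < k" "m' < k" for m m'
  proof -
    define N Q N' Q' where d: "N = dot3 (n 1 m) ?x" "Q = dot3 (n 1 m) (?q a)"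
      "N' = dot3 (n 1 m') ?x" "Q' = dot3 (n 1 m') (?q a)"
    have nz: "Q \<noteq> 0" "Q' \<noteq> 0" "u * N + v * Q \<noteq> 0" "u * N' + v * Q' \<noteq> 0"
      using nq[of m a] nq[of m' a] nq[of m b] nq[of m' b] that assms unfolding d uv by simp_all
    show ?thesis unfolding coord_def uv dot3_simps d[symmetric]
      using nz by (simp add: divide_simps) (simp add: algebra_simps)
  qed
  then show thesis by (rule that)
qed

text \<open>At \<open>p\<close> the differentials of classes 1 and 2 have ratio \<open>c\<close>
  along the line of class 0 and ratio \<open>c'\<close> along the line of class 3. The first
  direction is the point at infinity of \<open>a'\<close>, the second one is the point
  \<open>p3\<close>; writing both in the coordinate of \<open>a'\<close> gives the equation. The
  quantifier order matters: \<open>c\<close> and \<open>c'\<close> serve all lines and points at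
  once.\<close>

lemma row_equation:
  "\<exists>c c'. c \<noteq> 0 \<and> c' \<noteq> 0 \<and> (\<forall>a a' p p1 p2 p3. a < k \<longrightarrow> a' < k \<longrightarrow> a \<noteq> a' \<longrightarrow>
       chi p \<longrightarrow> chi p1 \<longrightarrow> chi p2 \<longrightarrow> chi p3 \<longrightarrow>
       idx 0 p = a \<longrightarrow> idx 0 p1 = a' \<longrightarrow> idx 0 p2 = a' \<longrightarrow> idx 0 p3 = a' \<longrightarrow>
       idx 1 p1 = idx 1 p \<longrightarrow> idx 2 p2 = idx 2 p \<longrightarrow> idx 3 p3 = idx 3 p \<longrightarrow>
       c * (coord a a' (idx 1 p3) - coord a a' (idx 1 p1)) = c' * (coord a a' (idx 1 p3) - coord a a' (idx 1 p2)))"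
proof -
  obtain c where c: "c \<noteq> 0" "\<And>p v. chi p \<Longrightarrow> dot3 (n 0 (idx 0 p)) v = 0 \<Longrightarrow>
     dot3 (n 1 (idx 1 p)) v * R 1 p = c * (dot3 (n 2 (idx 2 p)) v * R 2 p)"
    using class_constant[of 0 1 2] by auto
  obtain c' where c': "c' \<noteq> 0" "\<And>p v. chi p \<Longrightarrow> dot3 (n 3 (idx 3 p)) v = 0 \<Longrightarrow>
     dot3 (n 1 (idx 1 p)) v * R 1 p = c' * (dot3 (n 2 (idx 2 p)) v * R 2 p)"
    using class_constant[of 3 1 2] by auto
  have "c * (coord a a' (idx 1 p3) - coord a a' (idx 1 p1)) = c' * (coord a a' (idx 1 p3) - coord a a' (idx 1 p2))"
    if h: "a < k" "a' < k" "a \<noteq> a'" "chi p" "chi p1" "chi p2" "chi p3"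
       "idx 0 p = a" "idx 0 p1 = a'" "idx 0 p2 = a'" "idx 0 p3 = a'"
       "idx 1 p1 = idx 1 p" "idx 2 p2 = idx 2 p" "idx 3 p3 = idx 3 p" for a a' p p1 p2 p3
  proof -
    let ?x = "crs (n 0 a') (n 1 0)" and ?q = "crs (n 0 a) (n 0 a')"
    define y1 y2 y3 where y: "y1 = coord a a' (idx 1 p1)" "y2 = coord a a' (idx 1 p2)" "y3 = coord a a' (idx 1 p3)"
    have q: "free 0 ?q" using free_crs[of 0 a a'] h by simp
    have on: "dot3 (n w (idx w p')) (?x + coord a a' (idx 1 p') *s ?q) = 0"
      if p': "chi p'" "idx 0 p' = a'" "w < 4" for p' w
    proof -
      obtain s where s: "s \<noteq> 0" "p' = s *s (?x + coord a a' (idx 1 p') *s ?q)"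
        using coord[OF h(1-3) p'(1,2)] by metis
      have "s * dot3 (n w (idx w p')) (?x + coord a a' (idx 1 p') *s ?q) = dot3 (n w (idx w p')) p'"
        by (subst (4) s(2)) (simp add: algebra_simps)
      then show ?thesis using s(1) idx(2)[OF p'(1,3)] by simp
    qed
    let ?b = "n 1 (idx 1 p)" and ?c = "n 2 (idx 2 p)"
    have b: "dot3 ?b ?x = - y1 * dot3 ?b ?q" using on[OF h(5,9), of 1] h(12)
      by (simp add: y add_eq_0_iff)
    have cc: "dot3 ?c ?x = - y2 * dot3 ?c ?q" using on[OF h(6,10), of 2] h(13)
      by (simp add: y add_eq_0_iff)
    have d: "dot3 (n 3 (idx 3 p)) (?x + y3 *s ?q) = 0" using on[OF h(7,11), of 3] h(14) by (simp add: y)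
    have e1: "dot3 ?b ?q * R 1 p = c * (dot3 ?c ?q * R 2 p)" using c(2)[OF h(4), of ?q] h(8) by simp
    have e2: "dot3 ?b (?x + y3 *s ?q) * R 1 p = c' * (dot3 ?c (?x + y3 *s ?q) * R 2 p)"
      by (rule c'(2)[OF h(4) d])
    have "(y3 - y1) * (dot3 ?b ?q * R 1 p) = c' * (y3 - y2) * (dot3 ?c ?q * R 2 p)"
      using e2 unfolding dot3_simps b cc by (simp add: algebra_simps)
    then have "(c * (y3 - y1)) * (dot3 ?c ?q * R 2 p) = (c' * (y3 - y2)) * (dot3 ?c ?q * R 2 p)"
      unfolding e1 by (simp add: algebra_simps)
    moreover have "dot3 ?c ?q \<noteq> 0" using q idx(1)[OF h(4), of 2] unfolding free_def by simp
    ultimately show ?thesis using R_nz[OF h(4), of 2] by (simp add: y)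
  qed
  then show ?thesis using c(1) c'(1) by (intro exI[of _ c] exI[of _ c'] conjI allI impI)
qed

end

section \<open>The pair of orthogonal Latin squares of a net\<close>

text \<open>Rows are the lines of class 0 and columns those of class 1; \<open>C i j\<close> and
  \<open>D i j\<close> name the lines of classes 2 and 3 through the cell.\<close>

definition mols :: "nat \<Rightarrow> (nat \<Rightarrow> nat \<Rightarrow> nat) \<Rightarrow> (nat \<Rightarrow> nat \<Rightarrow> nat) \<Rightarrow> bool" where
  "mols k C D \<longleftrightarrow>
     (\<forall>i<k. \<forall>j<k. C i j < k \<and> D i j < k) \<and>
     (\<forall>i<k. \<forall>j<k. \<forall>j'<k. C i j = C i j' \<or> D i j = D i j' \<longrightarrow> j = j') \<and>
     (\<forall>i<k. \<forall>i'<k. \<forall>j<k. C i j = C i' j \<or> D i j = D i' j \<longrightarrow> i = i') \<and>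
     (\<forall>i<k. \<forall>i'<k. \<forall>j<k. \<forall>j'<k. C i j = C i' j' \<longrightarrow> D i j = D i' j' \<longrightarrow> i = i' \<and> j = j')"

lemma molsD:
  assumes "mols k C D"
  shows "i < k \<Longrightarrow> j < k \<Longrightarrow> C i j < k" "i < k \<Longrightarrow> j < k \<Longrightarrow> D i j < k"
    "i < k \<Longrightarrow> j < k \<Longrightarrow> j' < k \<Longrightarrow> C i j = C i j' \<longleftrightarrow> j = j'"
    "i < k \<Longrightarrow> j < k \<Longrightarrow> j' < k \<Longrightarrow> D i j = D i j' \<longleftrightarrow> j = j'"
    "i < k \<Longrightarrow> i' < k \<Longrightarrow> j < k \<Longrightarrow> C i j = C i' j \<longleftrightarrow> i = i'"
    "i < k \<Longrightarrow> i' < k \<Longrightarrow> j < k \<Longrightarrow> D i j = D i' j \<longleftrightarrow> i = i'"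
    "i < k \<Longrightarrow> i' < k \<Longrightarrow> j < k \<Longrightarrow> j' < k \<Longrightarrow> C i j = C i' j' \<Longrightarrow> D i j = D i' j' \<Longrightarrow> i = i' \<and> j = j'"
  using assms unfolding mols_def by metis+

text \<open>\<open>Y a b j\<close> is the coordinate of the point in row \<open>b\<close> and column
  \<open>j\<close> when the meet of rows \<open>a\<close> and \<open>b\<close> is at infinity. The
  second block is the linear system of a pair of rows, the third one the Moebius relation between
  two coordinates of the same row.\<close>

definition row_coords :: "nat \<Rightarrow> (nat \<Rightarrow> nat \<Rightarrow> nat) \<Rightarrow> (nat \<Rightarrow> nat \<Rightarrow> nat) \<Rightarrow>
    complex \<Rightarrow> complex \<Rightarrow> (nat \<Rightarrow> nat \<Rightarrow> nat \<Rightarrow> complex) \<Rightarrow> bool" where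
  "row_coords k C D c c' Y \<longleftrightarrow> c \<noteq> 0 \<and> c' \<noteq> 0 \<and>
     (\<forall>a<k. \<forall>b<k. a \<noteq> b \<longrightarrow> inj_on (Y a b) {..<k} \<and>
        (\<forall>j<k. \<forall>j1<k. \<forall>j2<k. C b j1 = C a j \<longrightarrow> D b j2 = D a j \<longrightarrow>
           c * (Y a b j2 - Y a b j) = c' * (Y a b j2 - Y a b j1))) \<and>
     (\<forall>a<k. \<forall>a'<k. \<forall>b<k. a \<noteq> b \<longrightarrow> a' \<noteq> b \<longrightarrow>
        (\<exists>\<beta> e. \<forall>j<k. \<forall>j'<k. Y a' b j - Y a' b j' = \<beta> * e j * e j' * (Y a b j - Y a b j')))"

text \<open>This is all that the exclusion of orders four, five and six retains of the
  plane.\<close>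

definition geo_mols :: "nat \<Rightarrow> (nat \<Rightarrow> nat \<Rightarrow> nat) \<Rightarrow> (nat \<Rightarrow> nat \<Rightarrow> nat) \<Rightarrow> bool" where
  "geo_mols k C D \<longleftrightarrow> mols k C D \<and> (\<exists>c c' Y. row_coords k C D c c' Y)"

lemma (in net) geo_mols: "geo_mols k (\<lambda>i j. lab 2 (i, j)) (\<lambda>i j. lab 3 (i, j))"
proof -
  let ?C = "\<lambda>i j. lab 2 (i, j)" and ?D = "\<lambda>i j. lab 3 (i, j)"
  have l01: "lab 0 (i, j) = i" "lab 1 (i, j) = j" if "i < k" "j < k" for i j
    using lab_pt[of "(i, j)"] that by auto
  have bij: "inj_on (\<lambda>p. (lab w p, lab x p)) ({..<k} \<times> {..<k})" if "w < 4" "x < 4" "w \<noteq> x" for w x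
    using bij_lab[OF that] by (simp add: bij_betw_def)
  have lk: "lab w (i, j) < k" if "w < 4" "i < k" "j < k" for w i j
    using idx(1)[OF chi_pt[of "(i, j)"] that(1)] that by (simp add: lab_def)
  have r: "j = j'" if "w \<in> {2, 3}" "i < k" "j < k" "j' < k" "lab w (i, j) = lab w (i, j')" for w i j j'
    using bij[of 0 w] that l01[of i j] l01[of i j'] unfolding inj_on_def by force
  have cl: "i = i'" if "w \<in> {2, 3}" "i < k" "i' < k" "j < k" "lab w (i, j) = lab w (i', j)" for w i i' j
    using bij[of 1 w] that l01[of i j] l01[of i' j] unfolding inj_on_def by force
  have o: "i = i' \<and> j = j'" if "i < k" "i' < k" "j < k" "j' < k" "?C i j = ?C i' j'" "?D i j = ?D i' j'" for i i' j j'
    using inj_onD[OF bij[of 2 3], of "(i, j)" "(i', j')"] that by simp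
  have "mols k ?C ?D" unfolding mols_def
  proof (intro conjI allI impI)
    fix i j j' assume "i < k" "j < k" "j' < k" "?C i j = ?C i j' \<or> ?D i j = ?D i j'"
    then show "j = j'" using r[of 2 i j j'] r[of 3 i j j'] by auto
  next
    fix i i' j assume "i < k" "i' < k" "j < k" "?C i j = ?C i' j \<or> ?D i j = ?D i' j"
    then show "i = i'" using cl[of 2 i i' j] cl[of 3 i i' j] by auto
  next
    fix i i' j j' assume "i < k" "i' < k" "j < k" "j' < k" "?C i j = ?C i' j'" "?D i j = ?D i' j'"
    from o[OF this] show "i = i'" "j = j'" by simp_all
  qed (use lk[of 2] lk[of 3] in simp_all)
  moreover
  obtain c c' where c: "c \<noteq> 0" "c' \<noteq> 0"
    and eq: "\<forall>a a' p p1 p2 p3. a < k \<longrightarrow> a' < k \<longrightarrow> a \<noteq> a' \<longrightarrow>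
       chi p \<longrightarrow> chi p1 \<longrightarrow> chi p2 \<longrightarrow> chi p3 \<longrightarrow>
       idx 0 p = a \<longrightarrow> idx 0 p1 = a' \<longrightarrow> idx 0 p2 = a' \<longrightarrow> idx 0 p3 = a' \<longrightarrow>
       idx 1 p1 = idx 1 p \<longrightarrow> idx 2 p2 = idx 2 p \<longrightarrow> idx 3 p3 = idx 3 p \<longrightarrow>
       c * (coord a a' (idx 1 p3) - coord a a' (idx 1 p1)) = c' * (coord a a' (idx 1 p3) - coord a a' (idx 1 p2))"
    using row_equation by (elim exE conjE)
  have "row_coords k ?C ?D c c' coord"
    unfolding row_coords_def
  proof (intro conjI allI impI)
    fix a b assume ab: "a < k" "b < k" "a \<noteq> b"
    show "inj_on (coord a b) {..<k}"
    proof (rule inj_onI)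
      fix j j' assume j: "j \<in> {..<k}" "j' \<in> {..<k}" "coord a b j = coord a b j'"
      have "idx 1 (pt (b, j)) = idx 1 (pt (b, j'))"
        using coord_inj[OF ab chi_pt _ chi_pt, of "(b, j)" "(b, j')"] j l01[of b j] l01[of b j'] ab
        unfolding lab_def by simp
      then show "j = j'" using l01[of b j] l01[of b j'] j ab unfolding lab_def by simp
    qed
    fix j j1 j2 assume j: "j < k" "j1 < k" "j2 < k" "?C b j1 = ?C a j" "?D b j2 = ?D a j"
    show "c * (coord a b j2 - coord a b j) = c' * (coord a b j2 - coord a b j1)"
      using eq[rule_format, OF ab, of "pt (a, j)" "pt (b, j)" "pt (b, j1)" "pt (b, j2)"]
        chi_pt l01[of b j] l01[of b j1] l01[of b j2] l01[of a j] ab j unfolding lab_def by simp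
  next
    fix a a' b assume ab: "a < k" "a' < k" "b < k" "a \<noteq> b" "a' \<noteq> b"
    show "\<exists>\<beta> e. \<forall>j<k. \<forall>j'<k. coord a' b j - coord a' b j' = \<beta> * e j * e j' * (coord a b j - coord a b j')"
      by (rule coord_cross_ratio[OF ab]) blast
  qed (use c in auto)
  ultimately show ?thesis unfolding geo_mols_def by blast
qed

lemma is_net_imp_geo_mols:
  assumes "is_net 4 k L A chi" "2 \<le> k" shows "\<exists>C D. geo_mols k C D"
proof -
  obtain n where "vnet k n" using is_net_imp_vnet[OF assms(1)] by metis
  then interpret net k n by unfold_locales (use assms(2) in auto)
  show ?thesis using geo_mols by blast
qed

lemma mols_relabel:
  fixes g :: "nat \<Rightarrow> nat \<Rightarrow> nat"
  assumes m: "mols k C D"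
    and g: "\<And>w. w < 4 \<Longrightarrow> bij_betw (g w) {..<k} {..<k}"
  shows "mols k (\<lambda>i j. g 2 (C (g 0 i) (g 1 j))) (\<lambda>i j. g 3 (D (g 0 i) (g 1 j)))"
proof -
  have gk: "g w i < k" if "w < 4" "i < k" for w i using bij_betwE[OF g[OF that(1)]] that by blast
  have gi: "g w i = g w j \<longleftrightarrow> i = j" if "w < 4" "i < k" "j < k" for w i j
    using inj_onD[OF bij_betw_imp_inj_on[OF g[OF that(1)]], of i j] that by auto
  note mo = molsD[OF m]
  show ?thesis unfolding mols_def
  proof (intro conjI allI impI)
    fix i i' j j' assume h: "i < k" "i' < k" "j < k" "j' < k"
      "g 2 (C (g 0 i) (g 1 j)) = g 2 (C (g 0 i') (g 1 j'))"
      "g 3 (D (g 0 i) (g 1 j)) = g 3 (D (g 0 i') (g 1 j'))"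
    have "C (g 0 i) (g 1 j) = C (g 0 i') (g 1 j')" "D (g 0 i) (g 1 j) = D (g 0 i') (g 1 j')"
      using h gi[of 2] gi[of 3] by (simp_all add: gk mo(1-6))
    then have "g 0 i = g 0 i' \<and> g 1 j = g 1 j'" using h by (intro mo(7)) (simp_all add: gk)
    then show "i = i'" "j = j'" using h gi[of 0 i i'] gi[of 1 j j'] by simp_all
  next
    fix i j j' assume "i < k" "j < k" "j' < k"
      "g 2 (C (g 0 i) (g 1 j)) = g 2 (C (g 0 i) (g 1 j')) \<or> g 3 (D (g 0 i) (g 1 j)) = g 3 (D (g 0 i) (g 1 j'))"
    then show "j = j'" by (simp add: gi gk mo(1-6))
  next
    fix i i' j assume "i < k" "i' < k" "j < k"
      "g 2 (C (g 0 i) (g 1 j)) = g 2 (C (g 0 i') (g 1 j)) \<or> g 3 (D (g 0 i) (g 1 j)) = g 3 (D (g 0 i') (g 1 j))"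
    then show "i = i'" by (simp add: gi gk mo(1-6))
  qed (simp_all add: gk mo(1-6))
qed

text \<open>Symbols enter the equations only through equality, and the coordinates are attached to
  rows and columns; so it suffices to reindex \<open>Y\<close> by the row and column
  permutations.\<close>

lemma geo_mols_relabel:
  fixes g :: "nat \<Rightarrow> nat \<Rightarrow> nat"
  assumes m: "geo_mols k C D"
    and g: "\<And>w. w < 4 \<Longrightarrow> bij_betw (g w) {..<k} {..<k}"
  shows "geo_mols k (\<lambda>i j. g 2 (C (g 0 i) (g 1 j))) (\<lambda>i j. g 3 (D (g 0 i) (g 1 j)))"
proof -
  have mo: "mols k C D" using m by (simp add: geo_mols_def)
  obtain c c' Y where "row_coords k C D c c' Y" using m by (auto simp: geo_mols_def)
  then have c: "c \<noteq> 0" "c' \<noteq> 0"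
    and inj: "\<And>a b. a < k \<Longrightarrow> b < k \<Longrightarrow> a \<noteq> b \<Longrightarrow> inj_on (Y a b) {..<k}"
    and eq: "\<And>a b j j1 j2. a < k \<Longrightarrow> b < k \<Longrightarrow> a \<noteq> b \<Longrightarrow> j < k \<Longrightarrow> j1 < k \<Longrightarrow> j2 < k \<Longrightarrow>
       C b j1 = C a j \<Longrightarrow> D b j2 = D a j \<Longrightarrow> c * (Y a b j2 - Y a b j) = c' * (Y a b j2 - Y a b j1)"
    and cr: "\<And>a a' b. a < k \<Longrightarrow> a' < k \<Longrightarrow> b < k \<Longrightarrow> a \<noteq> b \<Longrightarrow> a' \<noteq> b \<Longrightarrow>
       \<exists>\<beta> e. \<forall>j<k. \<forall>j'<k. Y a' b j - Y a' b j' = \<beta> * e j * e j' * (Y a b j - Y a b j')"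
    unfolding row_coords_def by blast+
  have gk: "g w i < k" if "w < 4" "i < k" for w i using bij_betwE[OF g[OF that(1)]] that by blast
  have gi: "g w i = g w j \<longleftrightarrow> i = j" if "w < 4" "i < k" "j < k" for w i j
    using g[OF that(1)] that unfolding bij_betw_def inj_on_def by blast
  note ck = molsD(1,2)[OF mo]
  let ?Y = "\<lambda>a b j. Y (g 0 a) (g 0 b) (g 1 j)"
  have "row_coords k (\<lambda>i j. g 2 (C (g 0 i) (g 1 j))) (\<lambda>i j. g 3 (D (g 0 i) (g 1 j))) c c' ?Y"
    unfolding row_coords_def
  proof (intro conjI allI impI)
    fix a b assume ab: "a < k" "b < k" "a \<noteq> b"
    have ab': "g 0 a < k" "g 0 b < k" "g 0 a \<noteq> g 0 b" using ab gk[of 0] gi[of 0] by auto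
    show "inj_on (?Y a b) {..<k}"
    proof (rule inj_onI)
      fix x y assume xy: "x \<in> {..<k}" "y \<in> {..<k}" "?Y a b x = ?Y a b y"
      then have "g 1 x = g 1 y" using inj_onD[OF inj[OF ab'] xy(3)] gk[of 1] by simp
      then show "x = y" using gi[of 1 x y] xy by simp
    qed
    fix j j1 j2 assume j: "j < k" "j1 < k" "j2 < k"
      "g 2 (C (g 0 b) (g 1 j1)) = g 2 (C (g 0 a) (g 1 j))" "g 3 (D (g 0 b) (g 1 j2)) = g 3 (D (g 0 a) (g 1 j))"
    then show "c * (?Y a b j2 - ?Y a b j) = c' * (?Y a b j2 - ?Y a b j1)"
      using eq[OF ab', of "g 1 j" "g 1 j1" "g 1 j2"] gi[of 2] gi[of 3] gk[of 1] ck ab' by simp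
  next
    fix a a' b assume ab: "a < k" "a' < k" "b < k" "a \<noteq> b" "a' \<noteq> b"
    then obtain \<beta> e where "\<forall>j<k. \<forall>j'<k. Y (g 0 a') (g 0 b) j - Y (g 0 a') (g 0 b) j' =
        \<beta> * e j * e j' * (Y (g 0 a) (g 0 b) j - Y (g 0 a) (g 0 b) j')"
      using cr[of "g 0 a" "g 0 a'" "g 0 b"] gk[of 0] gi[of 0] by auto
    then show "\<exists>\<beta> e. \<forall>j<k. \<forall>j'<k. ?Y a' b j - ?Y a' b j' = \<beta> * e j * e j' * (?Y a b j - ?Y a b j')"
      by (intro exI[of _ \<beta>] exI[of _ "e \<circ> g 1"]) (simp add: gk)
  qed (use c in auto)
  moreover have "mols k (\<lambda>i j. g 2 (C (g 0 i) (g 1 j))) (\<lambda>i j. g 3 (D (g 0 i) (g 1 j)))"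
    by (rule mols_relabel[OF mo]) (rule g)
  ultimately show ?thesis unfolding geo_mols_def by blast
qed

lemma bij_betw_row:
  assumes "mols k C D" "i < k"
  shows "bij_betw (C i) {..<k} {..<k}" "bij_betw (D i) {..<k} {..<k}"
proof -
  have 1: "inj_on (C i) {..<k}" "inj_on (D i) {..<k}" "C i ` {..<k} \<subseteq> {..<k}" "D i ` {..<k} \<subseteq> {..<k}"
    using molsD(1-4)[OF assms(1)] assms(2) by (auto simp: inj_on_def)
  then show "bij_betw (C i) {..<k} {..<k}" "bij_betw (D i) {..<k} {..<k}"
    by (simp_all add: bij_betw_def endo_inj_surj)
qed

text \<open>Rows and columns may be permuted at will by \<open>h\<close> and \<open>f\<close>;
  renaming the symbols of each square by the inverse of its row 0 then makes both initial rows the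
  identity. The last clause transports the equality pattern of \<open>C\<close>, so that
  \<open>h\<close> and \<open>f\<close> can be chosen to give \<open>C'\<close> a prescribed
  shape.\<close>

lemma geo_mols_normalise:
  assumes m: "geo_mols k C D" and f: "bij_betw f {..<k} {..<k}" and k: "0 < k"
    and h: "bij_betw h {..<k} {..<k}"
  shows "\<exists>C' D'. geo_mols k C' D' \<and> (\<forall>j<k. C' 0 j = j \<and> D' 0 j = j) \<and>
     (\<forall>i<k. \<forall>j<k. \<forall>i'<k. \<forall>j'<k. C' i j = C' i' j' \<longleftrightarrow> C (h i) (f j) = C (h i') (f j'))"
proof -
  have mo: "mols k C D" using m by (simp add: geo_mols_def)
  have hk: "h i < k" if "i < k" for i using bij_betwE[OF h] that by blast
  have fk: "f i < k" if "i < k" for i using bij_betwE[OF f] that by blast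
  let ?c = "\<lambda>j. C (h 0) (f j)" and ?d = "\<lambda>j. D (h 0) (f j)"
  have bc: "bij_betw ?c {..<k} {..<k}" and bd: "bij_betw ?d {..<k} {..<k}"
    using bij_betw_trans[OF f bij_betw_row(1)[OF mo hk[OF k]]]
      bij_betw_trans[OF f bij_betw_row(2)[OF mo hk[OF k]]] by (simp_all add: o_def)
  define g where "g = (\<lambda>w::nat. if w = 0 then h else if w = 1 then f else
      if w = 2 then the_inv_into {..<k} ?c else the_inv_into {..<k} ?d)"
  have g: "bij_betw (g w) {..<k} {..<k}" for w
    unfolding g_def using f h bij_betw_the_inv_into[OF bc] bij_betw_the_inv_into[OF bd] by auto
  let ?C = "\<lambda>i j. g 2 (C (g 0 i) (g 1 j))" and ?D = "\<lambda>i j. g 3 (D (g 0 i) (g 1 j))"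
  have "geo_mols k ?C ?D" by (rule geo_mols_relabel[OF m g])
  moreover have "?C 0 j = j \<and> ?D 0 j = j" if "j < k" for j
    using the_inv_into_f_f[of ?c "{..<k}" j] the_inv_into_f_f[of ?d "{..<k}" j] bc bd that
    by (simp add: g_def bij_betw_def)
  moreover have "?C i j = ?C i' j' \<longleftrightarrow> C (h i) (f j) = C (h i') (f j')"
    if "i < k" "j < k" "i' < k" "j' < k" for i j i' j'
  proof -
    have "C (h i) (f j) < k" "C (h i') (f j') < k" using molsD(1)[OF mo] hk fk that by simp_all
    moreover have "inj_on (g 2) {..<k}" using g[of 2] by (simp add: bij_betw_def)
    ultimately have "g 2 (C (h i) (f j)) = g 2 (C (h i') (f j')) \<longleftrightarrow> C (h i) (f j) = C (h i') (f j')"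
      by (auto simp: inj_on_def)
    then show ?thesis by (simp add: g_def)
  qed
  ultimately show ?thesis by (intro exI[of _ ?C] exI[of _ ?D] conjI allI impI) auto
qed

section \<open>Order four\<close>

text \<open>For \<open>n = k\<close> these are the permutations of \<open>{..<k}\<close> as lists,
  in a form that evaluation can run through.\<close>

fun injwords :: "nat \<Rightarrow> nat \<Rightarrow> nat list list" where
  "injwords k 0 = [[]]"
| "injwords k (Suc n) = concat (map (\<lambda>w. map (\<lambda>x. x # w) (filter (\<lambda>x. x \<notin> set w) [0..<k])) (injwords k n))"

lemma set_injwords: "set (injwords k n) = {w. length w = n \<and> distinct w \<and> set w \<subseteq> {..<k}}"
proof (induction n)
  case (Suc n)
  show ?case
  proof (intro set_eqI iffI)
    fix w assume "w \<in> {w. length w = Suc n \<and> distinct w \<and> set w \<subseteq> {..<k}}"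
    then show "w \<in> set (injwords k (Suc n))" using Suc by (cases w) auto
  qed (use Suc in auto)
qed auto

definition avoids :: "nat list list \<Rightarrow> nat list \<Rightarrow> bool" where
  "avoids rs r \<longleftrightarrow> list_all (\<lambda>s. list_all2 (\<noteq>) s r) rs"

definition transversal :: "nat list list \<Rightarrow> nat list \<Rightarrow> bool" where
  "transversal rs t \<longleftrightarrow> distinct (map2 (!) rs t)"

lemma mols_swap:
  assumes "mols k C D" shows "mols k D C"
  unfolding mols_def
proof (intro conjI allI impI)
  fix i i' j j' assume h: "i < k" "i' < k" "j < k" "j' < k" "D i j = D i' j'" "C i j = C i' j'"
  show "i = i'" "j = j'" using molsD(7)[OF assms h(1-4,6,5)] by simp_all
qed (use molsD(1-6)[OF assms] in auto)

lemma row_in_injwords: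
  assumes "mols k C D" "i < k" shows "map (C i) [0..<k] \<in> set (injwords k k)"
  using molsD(1,3)[OF assms] by (auto simp: set_injwords distinct_map inj_on_def)

lemma avoids_rows:
  assumes m: "mols k C D" and i: "i < k" "set is \<subseteq> {..<k} - {i}"
  shows "avoids (map (\<lambda>i'. map (C i') [0..<k]) is) (map (C i) [0..<k])"
proof -
  have "list_all2 (\<noteq>) (map (C i') [0..<k]) (map (C i) [0..<k])" if "i' \<in> set is" for i'
    using molsD(5)[OF m _ i(1), of i'] i(2) that by (auto simp: list_all2_conv_all_nth)
  then show ?thesis by (simp add: avoids_def list_all_iff)
qed

lemma column_of:
  assumes "mols k C D" "i < k" "d < k" obtains j where "j < k" "D i j = d"
proof -
  have "d \<in> D i ` {..<k}" using bij_betw_row(2)[OF assms(1,2)] assms(3) by (simp add: bij_betw_def)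
  then show thesis using that by auto
qed

text \<open>By orthogonality the cells carrying one symbol of \<open>D\<close> show every symbol of
  \<open>C\<close> once.\<close>

lemma transversal_D:
  assumes m: "mols k C D" and d: "d < k"
  obtains t where "\<And>i. i < k \<Longrightarrow> t i < k \<and> D i (t i) = d" "map t [0..<k] \<in> set (injwords k k)"
    "transversal (map (\<lambda>i. map (C i) [0..<k]) [0..<k]) (map t [0..<k])"
proof -
  have "\<exists>j<k. D i j = d" if "i < k" for i using column_of[OF m that d] by metis
  then obtain t where t: "\<And>i. i < k \<Longrightarrow> t i < k \<and> D i (t i) = d" by metis
  have inj: "i = i'" if "i < k" "i' < k" "t i = t i' \<or> C i (t i) = C i' (t i')" for i i'
  proof -
    have "D i (t i) = D i' (t i')" "t i < k" "t i' < k" using t that by auto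
    then show ?thesis using molsD(6)[OF m that(1,2)] molsD(7)[OF m that(1,2)] that(3) by metis
  qed
  have e: "map2 (!) (map (\<lambda>i. map (C i) [0..<k]) [0..<k]) (map t [0..<k]) = map (\<lambda>i. C i (t i)) [0..<k]"
    using t by (intro nth_equalityI) auto
  have "transversal (map (\<lambda>i. map (C i) [0..<k]) [0..<k]) (map t [0..<k])"
    unfolding transversal_def e using inj by (auto simp: distinct_map inj_on_def)
  moreover have "map t [0..<k] \<in> set (injwords k k)"
    using t inj by (auto simp: set_injwords distinct_map inj_on_def)
  ultimately show thesis using t by (intro that)
qed

text \<open>The four-cycles give the table of the cyclic group, which has no transversal.  The
  conditionals keep the evaluation lazy.\<close>

lemma order4_search:
  "list_all (\<lambda>t. list_all (\<lambda>a. if avoids [[0,1,2,3]] a \<and> a \<notin> set [[1,0,3,2],[2,3,0,1],[3,2,1,0]] then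
     list_all (\<lambda>b. if avoids [[0,1,2,3],a] b then
       list_all (\<lambda>c. if avoids [[0,1,2,3],a,b] c then \<not> transversal [[0,1,2,3],a,b,c] t else True)
         (injwords 4 4) else True) (injwords 4 4) else True) (injwords 4 4)) (injwords 4 4)"
  by code_simp

text \<open>A permutation of four letters without fixed points is a double transposition or a
  four-cycle. The mate \<open>D\<close> supplies a transversal, which excludes the
  four-cycles.\<close>

lemma order4_row:
  assumes m: "mols 4 C D" and C0: "\<And>j. j < 4 \<Longrightarrow> C 0 j = j"
  shows "map (C 1) [0..<4] \<in> set [[1,0,3,2],[2,3,0,1],[3,2,1,0]]"
proof (rule ccontr)
  let ?r = "\<lambda>i. map (C i) [0..<4]"
  assume n: "?r 1 \<notin> set [[1,0,3,2],[2,3,0,1],[3,2,1,0]]"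
  have u: "[0..<4] = [0,1,2,3::nat]" by code_simp
  have g4: "map g [0..<4] = [g 0, g 1, g 2, g 3]" for g :: "nat \<Rightarrow> nat list" unfolding u by simp
  have r0: "?r 0 = [0,1,2,3]" using C0 unfolding u by simp
  obtain t where t: "map t [0..<4] \<in> set (injwords 4 4)"
    "transversal (map ?r [0..<4]) (map t [0..<4])" using transversal_D[OF m, of 0] by auto
  have r: "map ?r [0..<4] = [[0,1,2,3], ?r 1, ?r 2, ?r 3]" using g4[of ?r] r0 by simp
  have av: "avoids [[0,1,2,3]] (?r 1)" "avoids [[0,1,2,3], ?r 1] (?r 2)"
    "avoids [[0,1,2,3], ?r 1, ?r 2] (?r 3)"
    using avoids_rows[OF m, of 1 "[0]"] avoids_rows[OF m, of 2 "[0,1]"] avoids_rows[OF m, of 3 "[0,1,2]"]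
    unfolding list.map r0 by simp_all
  have w: "?r 1 \<in> set (injwords 4 4)" "?r 2 \<in> set (injwords 4 4)" "?r 3 \<in> set (injwords 4 4)"
    using row_in_injwords[OF m] by simp_all
  note S = order4_search[unfolded list_all_iff if_bool_eq_conj, rule_format, OF t(1)]
  from S[OF w(1), THEN conjunct1, rule_format, OF conjI[OF av(1) n] w(2), THEN conjunct1, rule_format,
      OF av(2) w(3), THEN conjunct1, rule_format, OF av(3)] t(2) r
  show False by simp
qed

lemma no_geo_mols_4: "\<not> geo_mols 4 C0 D0"
proof
  assume "geo_mols 4 C0 D0"
  then obtain C D where g: "geo_mols 4 C D" and CD0: "\<And>j. j < 4 \<Longrightarrow> C 0 j = j \<and> D 0 j = j"
    using geo_mols_normalise[of 4 C0 D0 id id] by auto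
  then have m: "mols 4 C D" unfolding geo_mols_def by blast
  obtain c c' Y where y: "row_coords 4 C D c c' Y" using g unfolding geo_mols_def by blast
  have u: "[0..<4] = [0,1,2,3::nat]" by code_simp
  let ?y = "Y 0 1"
  have c: "c \<noteq> 0" "c' \<noteq> 0" and inj: "inj_on ?y {..<4}"
    and eq: "\<And>j j1 j2. j < 4 \<Longrightarrow> j1 < 4 \<Longrightarrow> j2 < 4 \<Longrightarrow> C 1 j1 = C 0 j \<Longrightarrow> D 1 j2 = D 0 j \<Longrightarrow>
      c * (?y j2 - ?y j) = c' * (?y j2 - ?y j1)"
    using y unfolding row_coords_def by auto
  have ne: "?y i \<noteq> ?y j" if "i < 4" "j < 4" "i \<noteq> j" for i j using inj that by (auto simp: inj_on_def)
  have C1: "map (C 1) [0..<4] \<in> set [[1,0,3,2],[2,3,0,1],[3,2,1,0]]" and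
    D1: "map (D 1) [0..<4] \<in> set [[1,0,3,2],[2,3,0,1],[3,2,1,0]]"
    using order4_row[OF m] order4_row[OF mols_swap[OF m]] CD0 by blast+
  \<comment> \<open>The first and third equations add up to
    \<open>?y q - ?y p = ?y r - ?y 0\<close>. Then the first two have equal right-hand sides, so
    \<open>?y r - ?y p = ?y q - ?y 0\<close>, and the two parallelograms give
    \<open>2 * ?y p = 2 * ?y 0\<close>.\<close>
  have key: False if h: "p < 4" "q < 4" "r < 4" "p \<noteq> 0"
    "C 1 p = 0" "C 1 0 = p" "C 1 q = r" "C 1 r = q" "D 1 q = 0" "D 1 0 = q" "D 1 p = r" "D 1 r = p" for p q r
  proof -
    have "c * (?y q - ?y 0) = c' * (?y q - ?y p)" "c * (?y r - ?y p) = c' * (?y r - ?y 0)"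
      "c * (?y 0 - ?y q) = c' * (?y 0 - ?y r)"
      using eq[of 0 p q] eq[of p 0 r] eq[of q r 0] h CD0 by auto
    moreover from this have "c' * (?y q - ?y p) = c' * (?y r - ?y 0)" by algebra
    ultimately have "c * (?y r - ?y p) = c * (?y q - ?y 0)" "?y q - ?y p = ?y r - ?y 0" using c by auto
    then have "?y r - ?y p = ?y q - ?y 0" "?y q - ?y p = ?y r - ?y 0" using c by auto
    then have "2 * ?y p = 2 * ?y 0" by algebra
    then have "?y p = ?y 0" by simp
    then show False using ne[of p 0] h by simp
  qed
  \<comment> \<open>Row 0 already carries every pair of two equal symbols, so orthogonality forbids
    such a pair in row 1.\<close>
  have neq: "C 1 j \<noteq> D 1 j" if "j < 4" for j
  proof
    assume e: "C 1 j = D 1 j"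
    have "C 1 j < 4" using molsD(1)[OF m, of 1 j] that by simp
    then have "C 1 j = C 0 (C 1 j)" "D 1 j = D 0 (C 1 j)" using CD0 e by simp_all
    then have "(1::nat) = 0 \<and> j = C 1 j" using that \<open>C 1 j < 4\<close> by (intro molsD(7)[OF m]) simp_all
    then show False by simp
  qed
  from C1 D1 show False
    using key[of 1 2 3] key[of 1 3 2] key[of 2 1 3] key[of 2 3 1] key[of 3 1 2] key[of 3 2 1] neq[of 0]
    by (auto simp: u)
qed

section \<open>Order five\<close>

text \<open>A subsquare of order two uses four symbols of the mate; the line of the fifth one would meet
  both symbols of the subsquare outside its rows and columns, where it has only one cell.\<close>

lemma no_intercalate_5:
  assumes m: "mols 5 C D" and h: "i < 5" "i' < 5" "j < 5" "j' < 5" "i \<noteq> i'" "j \<noteq> j'"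
    "C i j = C i' j'"
  shows "C i j' \<noteq> C i' j"
proof
  assume e: "C i j' = C i' j"
  have "card ({..<5} - {D i j, D i j', D i' j, D i' j'}) > 0"
  proof -
    have "card {D i j, D i j', D i' j, D i' j'} \<le> 4" by (simp add: card_insert_if)
    moreover have "card {..<5::nat} - card {D i j, D i j', D i' j, D i' j'} \<le> card ({..<5} - {D i j, D i j', D i' j, D i' j'})"
      by (intro diff_card_le_card_Diff) simp
    ultimately show ?thesis by simp
  qed
  then obtain d where d: "d < 5" "d \<notin> {D i j, D i j', D i' j, D i' j'}"
    by (metis Diff_iff card_gt_0_iff ex_in_conv lessThan_iff)
  obtain t where t: "\<And>i. i < 5 \<Longrightarrow> t i < 5 \<and> D i (t i) = d" using transversal_D[OF m d(1)] by metis
  have tinj: "a = b" if "a < 5" "b < 5" "t a = t b" for a b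
    using molsD(6)[OF m that(1,2), of "t a"] t[OF that(1)] t[OF that(2)] that(3) by simp
  have orth: "a = b" if "a < 5" "b < 5" "C a (t a) = C b (t b)" for a b
    using molsD(7)[OF m that(1,2), of "t a" "t b"] t[OF that(1)] t[OF that(2)] that(3) by simp
  have "\<exists>u<5. C u (t u) = x" if "x < 5" for x
  proof -
    have "inj_on (\<lambda>u. C u (t u)) {..<5}" using orth by (auto intro: inj_onI)
    moreover have "(\<lambda>u. C u (t u)) ` {..<5} \<subseteq> {..<5}" using molsD(1)[OF m] t by auto
    ultimately have "(\<lambda>u. C u (t u)) ` {..<5} = {..<5}" by (simp add: endo_inj_surj)
    then have "x \<in> (\<lambda>u. C u (t u)) ` {..<5}" using that by simp
    then show ?thesis by auto
  qed
  \<comment> \<open>The rows in which the transversal of \<open>d\<close> shows the two symbols of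
    the subsquare. These cells avoid its rows and columns, and so do the columns chosen in rows
    \<open>i\<close> and \<open>i'\<close>. Four distinct rows thus need four distinct columns among
    the three other than \<open>j\<close> and \<open>j'\<close>.\<close>
  then obtain u v where uv: "u < 5" "v < 5" "C u (t u) = C i j" "C v (t v) = C i j'"
    using molsD(1)[OF m h(1,3)] molsD(1)[OF m h(1,4)] by metis
  have tu: "t u < 5" "t v < 5" "t i < 5" "t i' < 5" using t uv h by simp_all
  have Dt: "D u (t u) = d" "D v (t v) = d" "D i (t i) = d" "D i' (t i') = d" using t uv h by simp_all
  have ti: "t i \<noteq> j" "t i \<noteq> j'" "t i' \<noteq> j" "t i' \<noteq> j'" using Dt d by auto
  have u1: "u \<noteq> i" using uv(3) molsD(3)[OF m h(1) tu(1) h(3)] ti by auto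
  have u2: "u \<noteq> i'" using uv(3) h(7) molsD(3)[OF m h(2) tu(1) h(4)] ti by auto
  have v1: "v \<noteq> i" using uv(4) molsD(3)[OF m h(1) tu(2) h(4)] ti by auto
  have v2: "v \<noteq> i'" using uv(4) e molsD(3)[OF m h(2) tu(2) h(3)] ti by auto
  have w1: "t u \<noteq> j" using uv(3) molsD(5)[OF m uv(1) h(1,3)] u1 by auto
  have w2: "t u \<noteq> j'" using uv(3) h(7) molsD(5)[OF m uv(1) h(2,4)] u2 by auto
  have w3: "t v \<noteq> j'" using uv(4) molsD(5)[OF m uv(2) h(1,4)] v1 by auto
  have w4: "t v \<noteq> j" using uv(4) e molsD(5)[OF m uv(2) h(2,3)] v2 by auto
  have uv': "u \<noteq> v" using uv molsD(3)[OF m h(1,3,4)] h(6) by auto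
  have "card (t ` {u, v, i, i'}) = 4"
    using tinj uv h u1 u2 v1 v2 uv' by (subst card_image) (auto intro!: inj_onI)
  moreover have "t ` {u, v, i, i'} \<subseteq> {..<5} - {j, j'}" using tu ti w1 w2 w3 w4 by auto
  then have "card (t ` {u, v, i, i'}) \<le> card ({..<5} - {j, j'})" by (rule card_mono[rotated]) simp
  moreover have "card ({..<5} - {j, j'}) = 3" using h by (subst card_Diff_subset) auto
  ultimately show False by simp
qed

text \<open>Cycle lengths that are at least three and add up to five leave only one cycle of length
  five.\<close>

lemma cycle5_search:
  "list_all (\<lambda>a. if list_all (\<lambda>i. a ! i \<noteq> i \<and> a ! (a ! i) \<noteq> i) [0..<5] then
     distinct [0, a!0, a!(a!0), a!(a!(a!0)), a!(a!(a!(a!0)))] \<and> a!(a!(a!(a!(a!0)))) = 0 else True) (injwords 5 5)"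
  by code_simp

definition no_swap5 :: "nat list \<Rightarrow> nat list \<Rightarrow> bool" where
  "no_swap5 r s \<longleftrightarrow> list_all (\<lambda>i. list_all (\<lambda>j. if i < j \<and> r!i = s!j then r!j \<noteq> s!i else True) [0..<5]) [0..<5]"

text \<open>Candidates for the other three rows once rows 0 and 1 are the identity and a shift and
  no subsquare of order two occurs. Three of the eight are shifts, and only these combine to a Latin
  square.\<close>

definition rows5 :: "nat list list" where
  "rows5 = [[1,2,3,4,0], [1,3,0,4,2], [1,4,3,0,2], [2,3,4,0,1], [2,4,3,1,0], [3,2,0,4,1], [3,2,4,1,0], [3,4,0,1,2]]"

lemma row5_search:
  "list_all (\<lambda>a. if avoids [[0,1,2,3,4],[4,0,1,2,3]] a then
     if no_swap5 [0,1,2,3,4] a \<and> no_swap5 [4,0,1,2,3] a then a \<in> set rows5 else True else True) (injwords 5 5)"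
  by code_simp

lemma order5_search:
  "list_all (\<lambda>a. list_all (\<lambda>b. if avoids [a] b then list_all (\<lambda>c. if avoids [a,b] c then
         list_all (\<lambda>r. r = map (\<lambda>j. (r!0 + j) mod 5) [0,1,2,3,4]) [a,b,c] else True)
         rows5 else True) rows5) rows5"
  by code_simp

text \<open>Every transversal of the cyclic square is a line over the integers modulo 5. Slope 0
  would be a column and slope 1 a line of constant symbol, which leaves 2, 3 and 4.\<close>

lemma transversal5_search:
  "list_all (\<lambda>t. if transversal [[0,1,2,3,4],[4,0,1,2,3],[3,4,0,1,2],[2,3,4,0,1],[1,2,3,4,0]] t then
   list_ex (\<lambda>d. t = map (\<lambda>i. (t!0 + d * i) mod 5) [0,1,2,3,4]) [2,3,4] else True) (injwords 5 5)"
  by code_simp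

text \<open>Both \<open>u\<close> and \<open>w\<close> are affine images of the fifth roots of unity, taken in different cyclic
  orders, and they are related by a projective map; comparing one cross-ratio gives a polynomial
  equation for \<open>s\<close> that is incompatible with \<open>1 + s + s\<^sup>2 + s\<^sup>3 + s\<^sup>4 = 0\<close>.\<close>

lemma pentagon_contradiction:
  fixes u w e :: "nat \<Rightarrow> complex"
  assumes u: "u 2 - u 1 = s * (u 1 - u 0)" "u 3 - u 2 = s * (u 2 - u 1)" "u 4 - u 3 = s * (u 3 - u 2)"
      "u 0 - u 4 = s * (u 4 - u 3)"
    and w: "w 4 - w 2 = s * (w 2 - w 0)" "w 1 - w 4 = s * (w 4 - w 2)" "w 3 - w 1 = s * (w 1 - w 4)"
      "w 0 - w 3 = s * (w 3 - w 1)"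
    and ne: "u 1 \<noteq> u 0" "u 2 \<noteq> u 1" "w 2 \<noteq> w 0"
    and cr: "\<And>i j. i < 5 \<Longrightarrow> j < 5 \<Longrightarrow> w i - w j = \<beta> * e i * e j * (u i - u j)"
  shows False
proof -
  define p q where pq: "p = u 1 - u 0" "q = w 2 - w 0"
  have s0: "s \<noteq> 0" and pq0: "p \<noteq> 0" "q \<noteq> 0" using u(1) ne by (auto simp: pq)
  note u' = u[unfolded diff_eq_eq] and w' = w[unfolded diff_eq_eq]
  have U1: "u 1 = u 0 + p" by (simp add: pq)
  have U2: "u 2 = u 0 + (1 + s) * p" unfolding u'(1) U1 by (simp add: algebra_simps)
  have U3: "u 3 = u 0 + (1 + s + s^2) * p" unfolding u'(2) U1 U2 by (simp add: algebra_simps power2_eq_square)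
  have U4: "u 4 = u 0 + (1 + s + s^2 + s^3) * p"
    unfolding u'(3) U2 U3 by (simp add: algebra_simps power2_eq_square power3_eq_cube)
  have "s * (u 4 - u 3) + u 4 = u 0 + (1 + s + s^2 + s^3 + s^4) * p"
    unfolding U3 U4 by (simp add: algebra_simps power2_eq_square power3_eq_cube power4_eq_xxxx)
  then have U5: "(1 + s + s^2 + s^3 + s^4) * p = 0" using u'(4) by (metis add_cancel_right_right)
  have W2: "w 2 = w 0 + q" by (simp add: pq)
  have W4: "w 4 = w 0 + (1 + s) * q" unfolding w'(1) W2 by (simp add: algebra_simps)
  have W1: "w 1 = w 0 + (1 + s + s^2) * q" unfolding w'(2) W2 W4 by (simp add: algebra_simps power2_eq_square)
  have W3: "w 3 = w 0 + (1 + s + s^2 + s^3) * q"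
    unfolding w'(3) W1 W4 by (simp add: algebra_simps power2_eq_square power3_eq_cube)
  have 1: "1 + s + s^2 + s^3 + s^4 = 0" using U5 pq0 by simp
  have "(u 0 - u 2) * (u 1 - u 3) * ((w 0 - w 3) * (w 1 - w 2)) = (w 0 - w 2) * (w 1 - w 3) * ((u 0 - u 3) * (u 1 - u 2))"
    using cr[of 0 2] cr[of 1 3] cr[of 0 3] cr[of 1 2] by (simp add: mult_ac)
  then have "(p^2 * q^2 * s^2) * ((1 + s)^3 * (-1-s-s^2-s^3)) = (p^2 * q^2 * s^2) * (s^2 * (1 + s + s^2))"
    unfolding U1 U2 U3 W1 W2 W3 by algebra
  then have "(1 + s)^3 * (-1-s-s^2-s^3) = s^2 * (1 + s + s^2)" using s0 pq0 by simp
  with 1 show False by algebra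
qed

text \<open>The offset \<open>\<delta> + 4\<close> is \<delta> - 1 modulo 5. The three indices in
  each equation are consecutive for a step \<open>g\<close> that depends on \<open>\<delta>\<close>,
  so the equation says that successive differences of \<open>y\<close> have a fixed ratio
  \<open>s\<close>. For \<open>z\<close> all offsets are doubled: the same \<open>s\<close> occurs
  with step \<open>2 * g\<close>.\<close>

lemma order5_geometry:
  fixes y z e :: "nat \<Rightarrow> complex"
  assumes \<delta>: "\<delta> \<in> {2, 3, 4::nat}" and c: "c \<noteq> 0" "c' \<noteq> 0"
    and y: "\<And>d. d < 5 \<Longrightarrow> c * (y d - y ((d + \<delta>) mod 5)) = c' * (y d - y ((d + (\<delta> + 4)) mod 5))"
    and z: "\<And>d. d < 5 \<Longrightarrow> c * (z d - z ((d + \<delta> * 2) mod 5)) = c' * (z d - z ((d + (\<delta> + 4) * 2) mod 5))"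
    and inj: "inj_on y {..<5}" "inj_on z {..<5}"
    and cr: "\<And>i j. i < 5 \<Longrightarrow> j < 5 \<Longrightarrow> z i - z j = \<beta> * e i * e j * (y i - y j)"
  shows False
proof -
  have "\<exists>g\<in>{1, 3, 4}. \<exists>s. (\<forall>d<5. y ((d + 2 * g) mod 5) - y ((d + g) mod 5) = s * (y ((d + g) mod 5) - y d)) \<and>
     (\<forall>d<5. z ((d + 4 * g) mod 5) - z ((d + 2 * g) mod 5) = s * (z ((d + 2 * g) mod 5) - z d))"
  proof -
    have ex: "(\<forall>d<5. P d) \<longleftrightarrow> P 0 \<and> P 1 \<and> P 2 \<and> P 3 \<and> P (4::nat)" for P
      by (simp add: numeral_eq_Suc All_less_Suc2)
    \<comment> \<open>\<open>p\<close>, \<open>q\<close>, \<open>r\<close> are consecutive for the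
      step \<open>g\<close>. The three versions differ in which of them plays the role of
      \<open>d\<close>, of \<open>d + \<delta>\<close> and of
      \<open>d + \<delta> - 1\<close>.\<close>
    have a2: "r - q = (c' - c) / c * (q - p)" if "c * (p - r) = c' * (p - q)" for p q r
      using that c by (simp add: field_simps)
    have a3: "r - q = - (c' / c) * (q - p)" if "c * (q - r) = c' * (q - p)" for p q r
      using that c by (simp add: field_simps)
    have a4: "r - q = (c - c') / c' * (q - p)" if "c * (p - q) = c' * (p - r)" for p q r
      using that c by (simp add: field_simps)
    from \<delta> consider "\<delta> = 2" | "\<delta> = 3" | "\<delta> = 4" by blast
    then show ?thesis
    proof cases
      case 1
      have "(\<forall>d<5. y ((d + 2 * 1) mod 5) - y ((d + 1) mod 5) = (c' - c) / c * (y ((d + 1) mod 5) - y d)) \<and>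
        (\<forall>d<5. z ((d + 4 * 1) mod 5) - z ((d + 2 * 1) mod 5) = (c' - c) / c * (z ((d + 2 * 1) mod 5) - z d))"
        unfolding ex using y[of 0] y[of 1] y[of 2] y[of 3] y[of 4] z[of 0] z[of 1] z[of 2] z[of 3] z[of 4]
        by (intro conjI a2) (simp_all add: 1 One_nat_def[symmetric] Suc_1 del: One_nat_def)
      then show ?thesis by blast
    next
      case 2
      have "(\<forall>d<5. y ((d + 2 * 3) mod 5) - y ((d + 3) mod 5) = - (c' / c) * (y ((d + 3) mod 5) - y d)) \<and>
        (\<forall>d<5. z ((d + 4 * 3) mod 5) - z ((d + 2 * 3) mod 5) = - (c' / c) * (z ((d + 2 * 3) mod 5) - z d))"
        unfolding ex using y[of 0] y[of 1] y[of 2] y[of 3] y[of 4] z[of 0] z[of 1] z[of 2] z[of 3] z[of 4]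
        by (intro conjI a3) (simp_all add: 2 One_nat_def[symmetric] Suc_1 del: One_nat_def)
      then show ?thesis by blast
    next
      case 3
      have "(\<forall>d<5. y ((d + 2 * 4) mod 5) - y ((d + 4) mod 5) = (c - c') / c' * (y ((d + 4) mod 5) - y d)) \<and>
        (\<forall>d<5. z ((d + 4 * 4) mod 5) - z ((d + 2 * 4) mod 5) = (c - c') / c' * (z ((d + 2 * 4) mod 5) - z d))"
        unfolding ex using y[of 0] y[of 1] y[of 2] y[of 3] y[of 4] z[of 0] z[of 1] z[of 2] z[of 3] z[of 4]
        by (intro conjI a4) (simp_all add: 3 One_nat_def[symmetric] Suc_1 del: One_nat_def)
      then show ?thesis by blast
    qed
  qed
  then obtain g s where g: "g \<in> {1, 3, 4}"
    and ys: "\<And>d. d < 5 \<Longrightarrow> y ((d + 2 * g) mod 5) - y ((d + g) mod 5) = s * (y ((d + g) mod 5) - y d)"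
    and zs: "\<And>d. d < 5 \<Longrightarrow> z ((d + 4 * g) mod 5) - z ((d + 2 * g) mod 5) = s * (z ((d + 2 * g) mod 5) - z d)"
    by blast
  have ne: "y i \<noteq> y j" "z i \<noteq> z j" if "i < 5" "j < 5" "i \<noteq> j" for i j
    using inj that by (auto simp: inj_on_def)
  \<comment> \<open>Indexing by multiples of \<open>g\<close> makes 0, 1, 2, 3, 4 the cyclic order
    of \<open>u\<close>, while that of \<open>w\<close> becomes 0, 2, 4, 1, 3.\<close>
  define u w where uw: "u m = y ((g * m) mod 5)" "w m = z ((g * m) mod 5)" for m
  have sh: "((g * m) mod 5 + r * g) mod 5 = (g * (m + r)) mod 5" for m r
    by (simp add: mod_simps algebra_simps)
  have u: "u (m + 2) - u (m + 1) = s * (u (m + 1) - u m)" for m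
    using ys[of "(g * m) mod 5"] sh[of m 1] sh[of m 2] by (simp add: uw)
  have w: "w (m + 4) - w (m + 2) = s * (w (m + 2) - w m)" for m
    using zs[of "(g * m) mod 5"] sh[of m 2] sh[of m 4] by (simp add: uw)
  have per: "(g * (m + 5)) mod 5 = (g * m) mod 5" for m
    by (simp add: distrib_left)
  have per: "u 5 = u 0" "w 5 = w 0" "w 6 = w 1" "w 8 = w 3"
    using per[of 0] per[of 1] per[of 3] by (simp_all add: uw)
  have gne: "(g * i) mod 5 \<noteq> (g * j) mod 5" if "(i, j) \<in> {(1,0), (2,1), (2,0)}" for i j
    using g that by auto
  have U: "u 2 - u 1 = s * (u 1 - u 0)" "u 3 - u 2 = s * (u 2 - u 1)" "u 4 - u 3 = s * (u 3 - u 2)"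
    using u[of 0] u[of 1] u[of 2] by (simp_all add: numeral_eq_Suc)
  have U4: "u 0 - u 4 = s * (u 4 - u 3)" using u[of 3] per(1) by (simp add: numeral_eq_Suc)
  have W1: "w 4 - w 2 = s * (w 2 - w 0)" using w[of 0] by (simp add: numeral_eq_Suc)
  have W2: "w 1 - w 4 = s * (w 4 - w 2)" using w[of 2] per(3) by (simp add: numeral_eq_Suc)
  have W3: "w 3 - w 1 = s * (w 1 - w 4)" using w[of 4] per(3,4) by (simp add: numeral_eq_Suc)
  have W4: "w 0 - w 3 = s * (w 3 - w 1)" using w[of 1] per(2) by (simp add: numeral_eq_Suc)
  have ne': "u 1 \<noteq> u 0" "u 2 \<noteq> u 1" "w 2 \<noteq> w 0" unfolding uw by (intro ne gne; simp)+
  have "w i - w j = \<beta> * e ((g * i) mod 5) * e ((g * j) mod 5) * (u i - u j)" for i j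
    unfolding uw by (rule cr) simp_all
  then show False by (rule pentagon_contradiction[OF U U4 W1 W2 W3 W4 ne'])
qed

text \<open>Two lines with different slopes over the integers modulo 5 meet.\<close>

lemma slope5_search:
  "list_all (\<lambda>d. list_all (\<lambda>a. list_all (\<lambda>b. a = b \<or> list_ex (\<lambda>i. (d + a * i) mod 5 = (b * i) mod 5) [0,1,2,3,4])
     [2,3,4]) [2,3,4]) [1,2,3,4::nat]"
  by code_simp

lemma five_cases: "(d::nat) < 5 \<longleftrightarrow> d = 0 \<or> d = 1 \<or> d = 2 \<or> d = 3 \<or> d = 4"
  by auto

lemma upt5: "[0..<5] = [0,1,2,3,4]"
  by code_simp

text \<open>The map \<open>s\<close> sends a column of row 0 to the column of row 1 with the same
  symbol. It has no fixed point, and a two-cycle would be a subsquare of order two; so it is a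
  five-cycle, and listing the columns along it turns row 1 into a shift.\<close>

lemma geo_mols_5_shift:
  assumes g: "geo_mols 5 C0 D0"
  obtains C D where "geo_mols 5 C D" "\<And>j. j < 5 \<Longrightarrow> C 0 j = j" "map (C 1) [0..<5] = [4,0,1,2,3]"
proof -
  have m: "mols 5 C0 D0" using g by (simp add: geo_mols_def)
  have "\<exists>j'<5. C0 1 j' = C0 0 j" if "j < 5" for j
    using column_of[OF mols_swap[OF m], of 1 "C0 0 j"] molsD(1)[OF m, of 0 j] that by auto
  then obtain s where s: "\<And>j. j < 5 \<Longrightarrow> s j < 5 \<and> C0 1 (s j) = C0 0 j" by metis
  have sinj: "i = j" if "i < 5" "j < 5" "s i = s j" for i j
    using s[OF that(1)] s[OF that(2)] that molsD(3)[OF m, of 0 i j] by simp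
  have s1: "s j \<noteq> j" if "j < 5" for j using s[OF that] molsD(5)[OF m, of 1 0 j] that by auto
  have s2: "s (s j) \<noteq> j" if "j < 5" for j
  proof
    assume e: "s (s j) = j"
    have "C0 0 (s j) \<noteq> C0 1 j"
      using no_intercalate_5[OF m, of 0 1 j "s j"] s[OF that] s1[OF that] that by simp
    moreover have "C0 1 (s (s j)) = C0 0 (s j)" using s[of "s j"] s[OF that] by simp
    ultimately show False using e by simp
  qed
  have "map s [0..<5] \<in> set (injwords 5 5)"
    using s sinj by (auto simp: set_injwords distinct_map inj_on_def)
  moreover have sn: "map s [0..<5] ! j = s j" if "j < 5" for j using that by simp
  have sk: "s j < 5" if "j < 5" for j using s[OF that] by simp
  have "list_all (\<lambda>i. map s [0..<5] ! i \<noteq> i \<and> map s [0..<5] ! (map s [0..<5] ! i) \<noteq> i) [0..<5]"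
    using s1 s2 by (auto simp: list_all_iff sn sk)
  ultimately have cyc: "distinct [0, s 0, s (s 0), s (s (s 0)), s (s (s (s 0)))] \<and> s (s (s (s (s 0)))) = 0"
    using cycle5_search[unfolded list_all_iff, rule_format, of "map s [0..<5]"]
    by (simp only: list_all_iff if_True sn sk zero_less_numeral)
  define f where "f m = [0, s 0, s (s 0), s (s (s 0)), s (s (s (s 0)))] ! m" for m
  have fs: "s (f m) = f ((m + 1) mod 5)" "f m < 5" if "m < 5" for m
    using that cyc by (auto simp: five_cases[of m] f_def sk)
  have finj: "inj_on f {..<5}"
    using cyc unfolding f_def[abs_def] by (intro inj_onI) (simp add: nth_eq_iff_index_eq)
  moreover have "f ` {..<5} \<subseteq> {..<5}" using fs(2) by auto
  ultimately have f: "bij_betw f {..<5} {..<5}" by (simp add: bij_betw_def endo_inj_surj)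
  have id: "bij_betw id {..<5::nat} {..<5}" by simp
  obtain C D where CD: "geo_mols 5 C D" "\<And>j. j < 5 \<Longrightarrow> C 0 j = j \<and> D 0 j = j"
    "\<And>i j i' j'. i < 5 \<Longrightarrow> j < 5 \<Longrightarrow> i' < 5 \<Longrightarrow> j' < 5 \<Longrightarrow>
       C i j = C i' j' \<longleftrightarrow> C0 (id i) (f j) = C0 (id i') (f j')"
    using geo_mols_normalise[OF g f _ id] by (simp only: zero_less_numeral) blast
  have "C 1 ((j + 1) mod 5) = j" if "j < 5" for j
  proof -
    have "C0 1 (f ((j + 1) mod 5)) = C0 0 (f j)" using fs[OF that] s[of "f j"] by metis
    then have "C 1 ((j + 1) mod 5) = C 0 j" using CD(3)[of 1 "(j + 1) mod 5" 0 j] that by simp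
    then show ?thesis using CD(2)[OF that] by simp
  qed
  from this[of 0] this[of 1] this[of 2] this[of 3] this[of 4]
  have "map (C 1) [0..<5] = [4,0,1,2,3]" unfolding upt5 by (simp add: numeral_2_eq_2)
  from that[OF CD(1) _ this] show thesis using CD(2) by simp
qed

text \<open>All rows are shifts of row 0, so a permutation of the rows arranges them by their
  initial symbols. The factor 4 stands for -1 and agrees with the row
  \<open>[4,0,1,2,3]\<close>.\<close>

lemma geo_mols_5_cyclic:
  assumes g0: "geo_mols 5 C0 D0"
  obtains C D where "geo_mols 5 C D" "\<And>i j. i < 5 \<Longrightarrow> j < 5 \<Longrightarrow> C i j = (4 * i + j) mod 5" "\<And>j. j < 5 \<Longrightarrow> D 0 j = j"
proof -
  obtain C1 D1 where g: "geo_mols 5 C1 D1" and C10: "\<And>j. j < 5 \<Longrightarrow> C1 0 j = j" and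
    r1: "map (C1 1) [0..<5] = [4,0,1,2,3]" using geo_mols_5_shift[OF g0] by blast
  have m: "mols 5 C1 D1" using g by (simp add: geo_mols_def)
  let ?r = "\<lambda>i. map (C1 i) [0..<5]"
  have r0: "?r 0 = [0,1,2,3,4]" using C10 unfolding upt5 by simp
  have ns: "no_swap5 (?r i) (?r i')" if "i < 5" "i' < 5" "i \<noteq> i'" for i i'
    using no_intercalate_5[OF m that(1,2) _ _ that(3)] unfolding no_swap5_def list_all_iff by auto
  have w: "?r i \<in> set (injwords 5 5)" if "i < 5" for i using row_in_injwords[OF m that] .
  have ns': "no_swap5 [0,1,2,3,4] (?r i) \<and> no_swap5 [4,0,1,2,3] (?r i)" if "i \<in> {2,3,4}" for i
    using ns[of 0 i] ns[of 1 i] that unfolding r0 r1 by auto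
  have w': "?r i \<in> set rows5" if "i \<in> {2,3,4}" for i
  proof -
    have i: "i < 5" using that by auto
    have "avoids [[0,1,2,3,4],[4,0,1,2,3]] (?r i)"
      using avoids_rows[OF m, of i "[0,1]"] that unfolding list.map r0 r1 by auto
    from row5_search[unfolded list_all_iff if_bool_eq_conj, rule_format, OF w[OF i], THEN conjunct1, rule_format,
        OF this, THEN conjunct1, rule_format, OF ns'[OF that]] show ?thesis .
  qed
  have w2: "?r 2 \<in> set rows5" and w3: "?r 3 \<in> set rows5" and w4: "?r 4 \<in> set rows5"
    by (rule w'; simp)+
  have av: "avoids [?r 2] (?r 3)" "avoids [?r 2, ?r 3] (?r 4)"
    using avoids_rows[OF m, of 3 "[2]"] avoids_rows[OF m, of 4 "[2,3]"] by simp_all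
  have lin: "\<forall>r\<in>set [?r 2, ?r 3, ?r 4]. r = map (\<lambda>j. (r!0 + j) mod 5) [0,1,2,3,4]"
    using order5_search[unfolded list_all_iff if_bool_eq_conj, rule_format, OF w2 w3, THEN conjunct1, rule_format,
      OF av(1) w4, THEN conjunct1, rule_format, OF av(2)] by blast
  have lin': "C1 i j = (C1 i 0 + j) mod 5" if "i < 5" "j < 5" for i j
  proof (cases "i = 0 \<or> i = 1")
    case True
    then show ?thesis using r1 C10 that unfolding upt5 by (auto simp: five_cases[of j])
  next
    case False
    then have "?r i \<in> set [?r 2, ?r 3, ?r 4]" using that(1) by (auto simp: five_cases[of i])
    then have "?r i = map (\<lambda>j. (?r i ! 0 + j) mod 5) [0,1,2,3,4]" using lin by blast
    from arg_cong[OF this, of "\<lambda>xs. xs ! j"]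
    have "?r i ! j = map (\<lambda>j. (?r i ! 0 + j) mod 5) [0,1,2,3,4] ! j" .
    then show ?thesis using that(2) by (auto simp: five_cases[of j])
  qed
  have "inj_on (\<lambda>i. C1 i 0) {..<5}" using molsD(5)[OF m] by (auto intro: inj_onI)
  moreover have "(\<lambda>i. C1 i 0) ` {..<5} \<subseteq> {..<5}" using molsD(1)[OF m] by auto
  ultimately have "(\<lambda>i. C1 i 0) ` {..<5} = {..<5}" by (simp add: endo_inj_surj)
  then have "\<exists>r<5. C1 r 0 = (4 * i) mod 5" for i
    by (metis (no_types, lifting) imageE lessThan_iff mod_less_divisor zero_less_numeral)
  then obtain h where h: "\<And>i. h i < 5 \<and> C1 (h i) 0 = (4 * i) mod 5" by metis
  have "inj_on h {..<5}"
  proof (rule inj_onI)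
    fix i j assume ij: "i \<in> {..<5}" "j \<in> {..<5}" "h i = h j"
    then have "(4 * i) mod 5 = (4 * j) mod 5" using h by metis
    then show "i = j" using ij by (auto simp: five_cases)
  qed
  moreover have "h ` {..<5} \<subseteq> {..<5}" using h by auto
  ultimately have hb: "bij_betw h {..<5} {..<5}" by (simp add: bij_betw_def endo_inj_surj)
  have id: "bij_betw id {..<5::nat} {..<5}" by simp
  obtain C D where CD: "geo_mols 5 C D" "\<And>j. j < 5 \<Longrightarrow> C 0 j = j \<and> D 0 j = j"
    "\<And>i j i' j'. i < 5 \<Longrightarrow> j < 5 \<Longrightarrow> i' < 5 \<Longrightarrow> j' < 5 \<Longrightarrow>
       C i j = C i' j' \<longleftrightarrow> C1 (h i) (id j) = C1 (h i') (id j')"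
    using geo_mols_normalise[OF g id _ hb] by (simp only: zero_less_numeral) blast
  have "C i j = (4 * i + j) mod 5" if "i < 5" "j < 5" for i j
  proof -
    have "C1 (h i) j = C1 (h 0) ((4 * i + j) mod 5)"
      using lin'[of "h i" j] lin'[of "h 0" "(4 * i + j) mod 5"] h[of i] h[of 0] that
      by (simp add: mod_simps)
    then have "C i j = C 0 ((4 * i + j) mod 5)" using CD(3)[of i j 0 "(4 * i + j) mod 5"] that by simp
    then show ?thesis using CD(2)[of "(4 * i + j) mod 5"] by simp
  qed
  from that[OF CD(1) this] show thesis using CD(2) by simp
qed

lemma no_geo_mols_5: "\<not> geo_mols 5 C0 D0"
proof
  assume "geo_mols 5 C0 D0"
  then obtain C D where g: "geo_mols 5 C D" and C: "\<And>i j. i < 5 \<Longrightarrow> j < 5 \<Longrightarrow> C i j = (4 * i + j) mod 5"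
    and D0: "\<And>j. j < 5 \<Longrightarrow> D 0 j = j" using geo_mols_5_cyclic by blast
  have m: "mols 5 C D" using g by (simp add: geo_mols_def)
  have rows: "map (\<lambda>i. map (C i) [0..<5]) [0..<5] =
      [[0,1,2,3,4],[4,0,1,2,3],[3,4,0,1,2],[2,3,4,0,1],[1,2,3,4,0]]"
    unfolding upt5 by (simp add: C)
  \<comment> \<open>The cells of a symbol of \<open>D\<close> form a transversal of
    \<open>C\<close>, hence a line of some slope. Lines of different symbols are disjoint, so all
    slopes will turn out equal.\<close>
  have "\<exists>\<delta>\<in>{2,3,4}. \<forall>i<5. D i ((d + \<delta> * i) mod 5) = d" if d: "d < 5" for d
  proof -
    obtain t where t: "\<And>i. i < 5 \<Longrightarrow> t i < 5 \<and> D i (t i) = d" "map t [0..<5] \<in> set (injwords 5 5)"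
      "transversal [[0,1,2,3,4],[4,0,1,2,3],[3,4,0,1,2],[2,3,4,0,1],[1,2,3,4,0]] (map t [0..<5])"
      using transversal_D[OF m d] unfolding rows by metis
    have t0: "t 0 = d" using t(1)[of 0] D0[of "t 0"] by simp
    have "\<exists>\<delta>\<in>set [2,3,4]. map t [0..<5] = map (\<lambda>i. (map t [0..<5] ! 0 + \<delta> * i) mod 5) [0,1,2,3,4]"
      using transversal5_search[unfolded list_all_iff if_bool_eq_conj list_ex_iff, rule_format, OF t(2),
        THEN conjunct1, rule_format, OF t(3)] .
    then obtain \<delta> where \<delta>: "\<delta> \<in> {2,3,4}" "map t [0..<5] = map (\<lambda>i. (map t [0..<5] ! 0 + \<delta> * i) mod 5) [0,1,2,3,4]"
      by (metis list.set(1,2))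
    have "t i = (d + \<delta> * i) mod 5" if "i < 5" for i
      using arg_cong[OF \<delta>(2), of "\<lambda>xs. xs ! i"] that t0 by (auto simp: five_cases[of i])
    then show ?thesis using t(1) \<delta>(1) by metis
  qed
  then obtain \<delta> where \<delta>: "\<And>d. d < 5 \<Longrightarrow> \<delta> d \<in> {2,3,4} \<and> (\<forall>i<5. D i ((d + \<delta> d * i) mod 5) = d)" by metis
  have same: "\<delta> d = \<delta> 0" if d: "d < 5" for d
  proof (rule ccontr)
    assume ne: "\<delta> d \<noteq> \<delta> 0"
    then have d0: "d \<noteq> 0" by metis
    have "\<delta> d = \<delta> 0 \<or> (\<exists>i\<in>set [0,1,2,3,4]. (d + \<delta> d * i) mod 5 = (\<delta> 0 * i) mod 5)"
      by (rule slope5_search[unfolded list_all_iff list_ex_iff, rule_format])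
        (use \<delta>[of d] \<delta>[of 0] d d0 in \<open>auto simp: five_cases\<close>)
    then obtain i where i: "i \<in> set [0,1,2,3,4]" "(d + \<delta> d * i) mod 5 = (\<delta> 0 * i) mod 5" using ne by blast
    then have "i < 5" "(d + \<delta> d * i) mod 5 = (0 + \<delta> 0 * i) mod 5" by auto
    then show False using \<delta>[OF d] \<delta>[of 0] d0 by (metis zero_less_numeral)
  qed
  define a where "a = \<delta> 0"
  have a: "a \<in> {2,3,4}" "\<And>d i. d < 5 \<Longrightarrow> i < 5 \<Longrightarrow> D i ((d + a * i) mod 5) = d"
    using \<delta> same unfolding a_def by (metis zero_less_numeral, metis)
  obtain c c' Y where y: "row_coords 5 C D c c' Y" using g unfolding geo_mols_def by blast
  have c: "c \<noteq> 0" "c' \<noteq> 0" and inj: "\<And>i. i < 5 \<Longrightarrow> i \<noteq> 0 \<Longrightarrow> inj_on (Y i 0) {..<5}"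
    and eq: "\<And>i j j1 j2. i < 5 \<Longrightarrow> i \<noteq> 0 \<Longrightarrow> j < 5 \<Longrightarrow> j1 < 5 \<Longrightarrow> j2 < 5 \<Longrightarrow> C 0 j1 = C i j \<Longrightarrow> D 0 j2 = D i j \<Longrightarrow>
      c * (Y i 0 j2 - Y i 0 j) = c' * (Y i 0 j2 - Y i 0 j1)"
    and cr: "\<exists>\<beta> e. \<forall>j<5. \<forall>j'<5. Y 2 0 j - Y 2 0 j' = \<beta> * e j * e j' * (Y 1 0 j - Y 1 0 j')"
    using y unfolding row_coords_def by simp_all
  \<comment> \<open>In row \<open>i\<close> the symbol \<open>d\<close> of \<open>D\<close> stands
    in column \<open>d + a * i\<close>, where \<open>C\<close> has the value
    \<open>d + (a + 4) * i\<close>; in row 0 both squares are the identity.\<close>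
  have E: "c * (Y i 0 d - Y i 0 ((d + a * i) mod 5)) = c' * (Y i 0 d - Y i 0 ((d + (a + 4) * i) mod 5))"
    if "d < 5" "i < 5" "i \<noteq> 0" for d i
  proof (rule eq[OF that(2,3)])
    show "C 0 ((d + (a + 4) * i) mod 5) = C i ((d + a * i) mod 5)"
      using that by (simp add: C mod_simps algebra_simps)
    show "D 0 d = D i ((d + a * i) mod 5)" using a(2) D0 that by simp
  qed (use that in auto)
  obtain \<beta> e where e: "\<And>j j'. j < 5 \<Longrightarrow> j' < 5 \<Longrightarrow> Y 2 0 j - Y 2 0 j' = \<beta> * e j * e j' * (Y 1 0 j - Y 1 0 j')"
    using cr by blast
  show False
    by (rule order5_geometry[OF a(1) c, of "Y 1 0" "Y 2 0" \<beta> e])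
      (use E[of _ 1] E[of _ 2] inj[of 1] inj[of 2] e in simp_all)
qed

section \<open>Order six\<close>

definition sdiff :: "'a set \<Rightarrow> 'a set \<Rightarrow> 'a set" where
  "sdiff A B = (A - B) \<union> (B - A)"

lemma in_sdiff: "x \<in> sdiff A B \<longleftrightarrow> (x \<in> A) \<noteq> (x \<in> B)"
  by (auto simp: sdiff_def)

lemma sdiff_cancel [simp]: "sdiff (sdiff A B) B = A" "sdiff A {} = A" "sdiff A A = {}"
  by (auto simp: sdiff_def)

lemma sdiff_Int: "sdiff A B \<inter> C = sdiff (A \<inter> C) (B \<inter> C)"
  by (auto simp: sdiff_def)

lemma odd_card_sdiff:
  assumes "finite A" "finite B"
  shows "odd (card (sdiff A B)) \<longleftrightarrow> odd (card A) \<noteq> odd (card B)"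
proof -
  have "card (sdiff A B) = card (A - B) + card (B - A)"
    unfolding sdiff_def using assms by (intro card_Un_disjoint) auto
  moreover have "card A = card (A - B) + card (A \<inter> B)" "card B = card (B - A) + card (A \<inter> B)"
    using assms by (metis Int_commute card_Diff_subset_Int card_Int_Diff finite_Int add.commute)+
  ultimately show ?thesis by presburger
qed

lemma sum_sign_flip:
  fixes f :: "'a set \<Rightarrow> int"
  assumes "finite G" and G: "\<And>A. A \<in> G \<Longrightarrow> sdiff A B \<in> G" and f: "\<And>A. A \<in> G \<Longrightarrow> f (sdiff A B) = - f A"
  shows "sum f G = 0"
proof -
  have "sum f G = sum (\<lambda>A. f (sdiff A B)) G"
    by (rule sum.reindex_bij_witness[of _ "\<lambda>A. sdiff A B" "\<lambda>A. sdiff A B"]) (use G in auto)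
  also have "\<dots> = - sum f G" by (simp add: f sum_negf)
  finally show ?thesis by simp
qed

text \<open>\<open>W\<close> and \<open>X\<close> are orthogonal over the field with two elements; the proof sums the characters
  of \<open>W\<close> over all subsets of \<open>P\<close>.\<close>

lemma card_orthogonal:
  assumes P: "finite P" and W: "W \<subseteq> Pow P" "{} \<in> W" "\<And>A B. A \<in> W \<Longrightarrow> B \<in> W \<Longrightarrow> sdiff A B \<in> W"
    and X: "X \<subseteq> Pow P" "\<And>w x. w \<in> W \<Longrightarrow> x \<in> X \<Longrightarrow> even (card (w \<inter> x))"
  shows "card W * card X \<le> 2 ^ card P"
proof -
  let ?s = "\<lambda>w x. (- 1) ^ card (w \<inter> x) :: int"
  have fin: "finite W" "finite X" "finite (Pow P)" "\<And>A. A \<in> Pow P \<Longrightarrow> finite A"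
    using P W(1) X(1) by (auto intro: finite_subset)
  have flip: "?s (sdiff A B) x = - ?s A x" if "odd (card (B \<inter> x))" "A \<subseteq> P" "B \<subseteq> P" for A B x
    using odd_card_sdiff[of "A \<inter> x" "B \<inter> x"] that finite_subset[OF that(2) P] finite_subset[OF that(3) P]
    by (simp add: sdiff_Int minus_one_power_iff)
  \<comment> \<open>A character sum over the group \<open>W\<close> is \<open>card W\<close> or 0.
    Being nonnegative, the terms outside \<open>X\<close> may be added, which enlarges the range of
    \<open>x\<close> to all subsets of \<open>P\<close>.\<close>
  have nonneg: "(\<Sum>w\<in>W. ?s w x) \<ge> 0" if x: "x \<in> Pow P" for x
  proof (cases "\<forall>w\<in>W. even (card (w \<inter> x))")
    case True then show ?thesis by (intro sum_nonneg) simp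
  next
    case False
    then obtain B where "B \<in> W" "odd (card (B \<inter> x))" by blast
    then have "(\<Sum>w\<in>W. ?s w x) = 0" using W fin(1)
      by (intro sum_sign_flip[of _ B]) (auto intro!: flip)
    then show ?thesis by simp
  qed
  have row: "(\<Sum>x\<in>Pow P. ?s w x) = (if w = {} then 2 ^ card P else 0)" if w: "w \<in> W" for w
  proof (cases "w = {}")
    case True then show ?thesis by (simp add: card_Pow P)
  next
    case False
    then obtain p where p: "p \<in> w" "p \<in> P" using W(1) w by blast
    have "(\<Sum>x\<in>Pow P. ?s x w) = 0"
    proof (rule sum_sign_flip[of _ "{p}"])
      fix A assume A: "A \<in> Pow P"
      show "sdiff A {p} \<in> Pow P" using A p(2) by (auto simp: sdiff_def)
      show "?s (sdiff A {p}) w = - ?s A w" using A p by (intro flip) auto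
    qed (use fin in auto)
    then show ?thesis using False by (simp add: Int_commute)
  qed
  have "int (card W * card X) = (\<Sum>x\<in>X. \<Sum>w\<in>W. ?s w x)" using X(2) by simp
  also have "\<dots> \<le> (\<Sum>x\<in>Pow P. \<Sum>w\<in>W. ?s w x)"
    using fin X(1) nonneg by (intro sum_mono2) auto
  also have "\<dots> = (\<Sum>w\<in>W. \<Sum>x\<in>Pow P. ?s w x)" by (rule sum.swap)
  also have "\<dots> = (\<Sum>w\<in>W. if w = {} then 2 ^ card P else 0)" by (intro sum.cong refl row)
  also have "\<dots> = 2 ^ card P" using W(2) fin(1) by simp
  finally show ?thesis by (metis of_nat_le_iff of_nat_numeral of_nat_power)
qed

text \<open>The fibres of an additive map are translates of its kernel, so the kernel is large when
  the target is small.\<close>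

lemma card_kernel:
  assumes G: "finite G" "\<And>A B. A \<in> G \<Longrightarrow> B \<in> G \<Longrightarrow> sdiff A B \<in> G"
    and f: "\<And>A B. A \<in> G \<Longrightarrow> B \<in> G \<Longrightarrow> f (sdiff A B) = sdiff (f A) (f B)"
    and im: "f ` G \<subseteq> Pow Q" "finite Q"
  shows "card G \<le> card {A \<in> G. f A = {}} * 2 ^ card Q"
proof -
  let ?K = "{A \<in> G. f A = {}}"
  have fib: "card {A \<in> G. f A = y} \<le> card ?K" if y: "y \<in> f ` G" for y
  proof -
    obtain B where B: "B \<in> G" "f B = y" using y by auto
    have "inj_on (\<lambda>A. sdiff A B) {A \<in> G. f A = y}" by (rule inj_onI) (metis sdiff_cancel(1))
    moreover have "(\<lambda>A. sdiff A B) ` {A \<in> G. f A = y} \<subseteq> ?K" using B G(2) f by auto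
    moreover have "finite ?K" using G(1) by simp
    ultimately show ?thesis by (rule card_inj_on_le)
  qed
  have "card G = (\<Sum>y\<in>f ` G. card {A \<in> G. f A = y})"
    using sum.image_gen[OF G(1), of "\<lambda>_. 1::nat" f] by simp
  also have "\<dots> \<le> (\<Sum>y\<in>f ` G. card ?K)" by (rule sum_mono) (rule fib)
  also have "\<dots> = card ?K * card (f ` G)" by simp
  also have "card (f ` G) \<le> card (Pow Q)" using im by (intro card_mono) auto
  finally show ?thesis by (simp add: card_Pow im(2))
qed

section \<open>Incidences in a net of order six\<close>

definition lbl :: "(nat \<Rightarrow> nat \<Rightarrow> nat) \<Rightarrow> (nat \<Rightarrow> nat \<Rightarrow> nat) \<Rightarrow> nat \<Rightarrow> nat \<times> nat \<Rightarrow> nat" where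
  "lbl C D w p = (if w = 0 then fst p else if w = 1 then snd p else if w = 2 then C (fst p) (snd p) else D (fst p) (snd p))"

locale mols6 =
  fixes C D :: "nat \<Rightarrow> nat \<Rightarrow> nat"
  assumes m: "mols 6 C D"
begin

abbreviation P :: "(nat \<times> nat) set" where "P \<equiv> {..<6} \<times> {..<6}"
abbreviation l :: "nat \<Rightarrow> nat \<times> nat \<Rightarrow> nat" where "l \<equiv> lbl C D"

lemma four: "(w::nat) < 4 \<longleftrightarrow> w = 0 \<or> w = 1 \<or> w = 2 \<or> w = 3"
  by auto

lemma l_lt: "p \<in> P \<Longrightarrow> l w p < 6"
  using molsD(1,2)[OF m, of "fst p" "snd p"] by (auto simp: lbl_def)

lemma l_inj:
  assumes "w < 4" "x < 4" "w \<noteq> x" "p \<in> P" "q \<in> P" "l w p = l w q" "l x p = l x q" shows "p = q"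
proof -
  obtain i j i' j' where pq: "p = (i, j)" "q = (i', j')" by (cases p, cases q)
  have lt: "i < 6" "j < 6" "i' < 6" "j' < 6" using assms(4,5) pq by auto
  have e: "i = i' \<Longrightarrow> C i j = C i' j' \<Longrightarrow> j = j'" "i = i' \<Longrightarrow> D i j = D i' j' \<Longrightarrow> j = j'"
    "j = j' \<Longrightarrow> C i j = C i' j' \<Longrightarrow> i = i'" "j = j' \<Longrightarrow> D i j = D i' j' \<Longrightarrow> i = i'"
    "C i j = C i' j' \<Longrightarrow> D i j = D i' j' \<Longrightarrow> i = i' \<and> j = j'"
    using molsD(3-6)[OF m] molsD(7)[OF m lt(1,3,2,4)] lt by auto
  have "i = i' \<and> j = j'" using assms(1-3,6,7) unfolding four lbl_def pq fst_conv snd_conv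
    by (elim disjE; simp; fail | elim disjE; simp; use e in blast)
  then show ?thesis using pq by simp
qed

lemma l_bij:
  assumes "w < 4" "x < 4" "w \<noteq> x" shows "bij_betw (\<lambda>p. (l w p, l x p)) P P"
proof -
  have "inj_on (\<lambda>p. (l w p, l x p)) P" using l_inj[OF assms] by (auto intro!: inj_onI)
  moreover have "(\<lambda>p. (l w p, l x p)) ` P \<subseteq> P" using l_lt by fastforce
  ultimately show ?thesis by (simp add: bij_betw_def endo_inj_surj)
qed

lemma l_ex:
  assumes "w < 4" "x < 4" "w \<noteq> x" "u < 6" "v < 6" obtains p where "p \<in> P" "l w p = u" "l x p = v"
proof -
  have "(u, v) \<in> (\<lambda>p. (l w p, l x p)) ` P"
    using l_bij[OF assms(1-3)] assms(4,5) by (simp add: bij_betw_def)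
  then show thesis using that by auto
qed

text \<open>A set of lines is given by its sections \<open>S w\<close>, the indices of its members in class \<open>w\<close>.\<close>

definition cnt :: "(nat \<Rightarrow> nat set) \<Rightarrow> nat \<times> nat \<Rightarrow> nat" where
  "cnt S p = (\<Sum>w<4. of_bool (l w p \<in> S w))"

lemma sum_pair:
  fixes f :: "nat \<Rightarrow> nat \<Rightarrow> nat"
  assumes "w < 4" "x < 4" "w \<noteq> x"
  shows "(\<Sum>p\<in>P. f (l w p) (l x p)) = (\<Sum>u<6. \<Sum>v<6. f u v)"
proof -
  have "(\<Sum>u<6. \<Sum>v<6. f u v) = (\<Sum>q\<in>P. f (fst q) (snd q))"
    by (simp add: sum.cartesian_product case_prod_beta)
  also have "\<dots> = (\<Sum>p\<in>P. f (l w p) (l x p))"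
    using sum.reindex_bij_betw[OF l_bij[OF assms], of "\<lambda>q. f (fst q) (snd q)"] by simp
  finally show ?thesis by simp
qed

lemma sum_of_bool_section: "S \<subseteq> {..<6} \<Longrightarrow> (\<Sum>u<6. of_bool (u \<in> S)) = card S" for S :: "nat set"
  by (simp add: of_bool_def sum.If_cases Int_absorb1)

text \<open>Both sides count triples of a point, a line of \<open>S\<close> and a line of
  \<open>T\<close> through it. Lines of different classes share one point, equal lines share six,
  and distinct lines of one class share none.\<close>

lemma sum_cnt_product:
  assumes S: "\<And>w. S w \<subseteq> {..<6}" and T: "\<And>w. T w \<subseteq> {..<6}"
  shows "(\<Sum>p\<in>P. cnt S p * cnt T p) =
    (\<Sum>w<4. \<Sum>x<4. if w = x then 6 * card (S w \<inter> T w) else card (S w) * card (T x))"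
proof -
  have "(\<Sum>p\<in>P. cnt S p * cnt T p) = (\<Sum>p\<in>P. \<Sum>w<4. \<Sum>x<4. of_bool (l w p \<in> S w) * of_bool (l x p \<in> T x))"
    by (simp only: cnt_def sum_product)
  also have "\<dots> = (\<Sum>w<4. \<Sum>x<4. \<Sum>p\<in>P. of_bool (l w p \<in> S w) * of_bool (l x p \<in> T x))"
    by (subst sum.swap, rule sum.cong[OF refl], rule sum.swap)
  also have "\<dots> = (\<Sum>w<4. \<Sum>x<4. if w = x then 6 * card (S w \<inter> T w) else card (S w) * card (T x))"
  proof (intro sum.cong refl)
    fix w x :: nat assume wx: "w \<in> {..<4}" "x \<in> {..<4}"
    show "(\<Sum>p\<in>P. of_bool (l w p \<in> S w) * of_bool (l x p \<in> T x)) =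
      (if w = x then 6 * card (S w \<inter> T w) else card (S w) * card (T x))"
    proof (cases "w = x")
      case True
      obtain y where y: "y < 4" "y \<noteq> w" using that[of 0] that[of 1] by auto
      have "(\<Sum>p\<in>P. of_bool (l w p \<in> S w) * of_bool (l w p \<in> T w) :: nat) = (\<Sum>p\<in>P. of_bool (l w p \<in> S w \<inter> T w))"
        by (intro sum.cong refl) auto
      also have "\<dots> = (\<Sum>u<6. \<Sum>v<6::nat. of_bool (u \<in> S w \<inter> T w))"
        using sum_pair[of w y "\<lambda>u v. of_bool (u \<in> S w \<inter> T w)"] wx y by simp
      also have "\<dots> = 6 * (\<Sum>u<6. of_bool (u \<in> S w \<inter> T w))" by (simp add: sum_distrib_left)
      also have "\<dots> = 6 * card (S w \<inter> T w)" using S[of w] by (subst sum_of_bool_section) auto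
      finally show ?thesis using True by simp
    next
      case False
      have "(\<Sum>p\<in>P. of_bool (l w p \<in> S w) * of_bool (l x p \<in> T x)) =
          (\<Sum>u<6. \<Sum>v<6. of_bool (u \<in> S w) * of_bool (v \<in> T x) :: nat)"
        using sum_pair[of w x "\<lambda>u v. of_bool (u \<in> S w) * of_bool (v \<in> T x)"] wx False by simp
      also have "\<dots> = (\<Sum>u<6. of_bool (u \<in> S w)) * (\<Sum>v<6. of_bool (v \<in> T x))"
        by (simp only: sum_product)
      also have "\<dots> = card (S w) * card (T x)" by (simp only: sum_of_bool_section S T)
      finally show ?thesis using False by simp
    qed
  qed
  finally show ?thesis .
qed

lemma sum_four: "(\<Sum>w<4. f w) = f 0 + f 1 + f 2 + f (3::nat)" for f :: "nat \<Rightarrow> 'a::comm_monoid_add"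
  by (simp add: numeral_eq_Suc add.assoc)

lemma cnt_card: "cnt S p = card {w \<in> {..<4}. l w p \<in> S w}"
  by (simp add: cnt_def of_bool_def sum.If_cases Int_def)

definition sec :: "(nat \<times> nat) set \<Rightarrow> nat \<Rightarrow> nat set" where
  "sec U w = {i. (w, i) \<in> U}"

lemma sec_sdiff: "sec (sdiff U V) w = sdiff (sec U w) (sec V w)"
  by (auto simp: sec_def sdiff_def)

text \<open>The incidence matrix of the 24 lines and 36 points has rank at most 20 over the field with
  two elements, so there is a dependency besides the three coming from the classes.\<close>

lemma relation_ex:
  "\<exists>S. (\<forall>w. S w \<subseteq> {..<6}) \<and> (\<forall>p\<in>P. even (cnt S p)) \<and> (\<exists>w<4. S w \<noteq> {} \<and> S w \<noteq> {..<6})"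
proof -
  \<comment> \<open>Every class covers all 36 points once, which accounts for three dependencies.
    Leaving out one line of each of the classes 1, 2 and 3 removes them.\<close>
  define L :: "(nat \<times> nat) set" where "L = {..<4} \<times> {..<6} - {(1, 5), (2, 5), (3, 5)}"
  have finL: "finite L" by (simp add: L_def)
  have cardL: "card L = 21" unfolding L_def by (subst card_Diff_subset) auto
  define \<phi> where "\<phi> U = {p \<in> P. odd (cnt (sec U) p)}" for U
  define par where "par U = {w \<in> {..<4}. odd (card (sec U w))}" for U
  have sec6: "sec U w \<subseteq> {..<6}" if "U \<in> Pow L" for U w using that by (auto simp: sec_def L_def)
  have finsec: "finite (sec U w)" if "U \<in> Pow L" for U w using sec6[OF that] finite_subset by blast
  have closed: "sdiff U V \<in> Pow L" if "U \<in> Pow L" "V \<in> Pow L" for U V using that by (auto simp: sdiff_def)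
  have \<phi>: "\<phi> (sdiff U V) = sdiff (\<phi> U) (\<phi> V)" for U V
  proof -
    have "odd (cnt (sec (sdiff U V)) p) \<longleftrightarrow> odd (cnt (sec U) p) \<noteq> odd (cnt (sec V) p)" for p
    proof -
      have "{w \<in> {..<4}. l w p \<in> sec (sdiff U V) w} =
          sdiff {w \<in> {..<4}. l w p \<in> sec U w} {w \<in> {..<4}. l w p \<in> sec V w}"
        by (auto simp: sec_sdiff in_sdiff)
      then show ?thesis unfolding cnt_card by (simp add: odd_card_sdiff)
    qed
    then show ?thesis by (auto simp: \<phi>_def in_sdiff)
  qed
  have par: "par (sdiff U V) = sdiff (par U) (par V)" if "U \<in> Pow L" "V \<in> Pow L" for U V
    using odd_card_sdiff[OF finsec[OF that(1)] finsec[OF that(2)]]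
    by (auto simp: par_def sec_sdiff in_sdiff)
  define E where "E = {U \<in> Pow L. par U = {}}"
  have orth: "even (card (\<phi> U \<inter> \<phi> V))" if "U \<in> E" "V \<in> Pow L" for U V
  proof -
    have U: "U \<in> Pow L" "\<And>w. w < 4 \<Longrightarrow> even (card (sec U w))" using that(1) by (auto simp: E_def par_def)
    have "even (\<Sum>p\<in>P. cnt (sec U) p * cnt (sec V) p)"
      unfolding sum_cnt_product[OF sec6[OF U(1)] sec6[OF that(2)]]
      by (intro dvd_sum) (use U(2) in auto)
    then have "even (card {p \<in> P. odd (cnt (sec U) p * cnt (sec V) p)})"
      by (subst (asm) even_sum_iff) simp_all
    moreover have "{p \<in> P. odd (cnt (sec U) p * cnt (sec V) p)} = \<phi> U \<inter> \<phi> V"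
      by (auto simp: \<phi>_def)
    ultimately show ?thesis by simp
  qed
  \<comment> \<open>The sets in \<open>E\<close>, even in every class, have images orthogonal to all
    images. Since parity in four classes costs at most a factor \<open>2 ^ 4\<close>, an injective
    \<open>\<phi>\<close> would give orthogonal families of at least \<open>2 ^ 17\<close> and of
    \<open>2 ^ 21\<close> subsets of 36 points, and 17 + 21 > 36.\<close>
  have "\<not> inj_on \<phi> (Pow L)"
  proof
    assume inj: "inj_on \<phi> (Pow L)"
    have "card (Pow L) \<le> card {U \<in> Pow L. par U = {}} * 2 ^ card {..<4::nat}"
      by (rule card_kernel) (use finL closed par in \<open>auto simp: par_def\<close>)
    then have "card (Pow L) \<le> card E * 2 ^ card {..<4::nat}" unfolding E_def .
    then have cE: "2 ^ 17 \<le> card E" by (simp add: card_Pow finL cardL)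
    have inj': "inj_on \<phi> E" by (rule inj_on_subset[OF inj]) (auto simp: E_def)
    have "card (\<phi> ` E) * card (\<phi> ` Pow L) \<le> 2 ^ card P"
    proof (rule card_orthogonal)
      have "{} \<in> E" "\<phi> {} = {}" by (auto simp: E_def par_def sec_def \<phi>_def cnt_def)
      then show "{} \<in> \<phi> ` E" by force
      show "sdiff A B \<in> \<phi> ` E" if "A \<in> \<phi> ` E" "B \<in> \<phi> ` E" for A B
      proof -
        from that obtain U V where UV: "U \<in> E" "V \<in> E" "A = \<phi> U" "B = \<phi> V" by auto
        then have "sdiff U V \<in> E" using closed par by (auto simp: E_def)
        then show ?thesis using UV \<phi> by auto
      qed
      show "even (card (w \<inter> x))" if "w \<in> \<phi> ` E" "x \<in> \<phi> ` Pow L" for w x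
        using that orth by auto
    qed (auto simp: \<phi>_def)
    then have "card E * 2 ^ 21 \<le> 2 ^ 36"
      by (simp add: card_image[OF inj] card_image[OF inj'] card_Pow finL cardL)
    then show False using cE by simp
  qed
  then obtain U V where UV: "U \<in> Pow L" "V \<in> Pow L" "\<phi> U = \<phi> V" "U \<noteq> V" by (auto simp: inj_on_def)
  define T where "T = sdiff U V"
  have T: "T \<in> Pow L" "T \<noteq> {}" using UV closed by (auto simp: T_def sdiff_def)
  have T3: "\<phi> T = {}" using UV(3) by (simp add: T_def \<phi>)
  have ev: "even (cnt (sec T) p)" if "p \<in> P" for p using T3 that by (auto simp: \<phi>_def)
  have "\<exists>w<4. sec T w \<noteq> {} \<and> sec T w \<noteq> {..<6}"
  proof (rule ccontr)
    assume "\<not> ?thesis"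
    then have triv: "sec T w = {} \<or> sec T w = {..<6}" if "w < 4" for w using that by blast
    have no5: "5 \<notin> sec T w" if "w \<in> {1,2,3}" for w using T(1) that by (auto simp: L_def sec_def)
    have e: "sec T w = {}" if "w \<in> {1,2,3}" for w using triv[of w] no5[OF that] that by auto
    have "sec T 0 \<noteq> {}"
    proof
      assume e0: "sec T 0 = {}"
      obtain w i where wi: "(w, i) \<in> T" using T(2) by auto
      then have "w < 4" using T(1) by (auto simp: L_def)
      then have "sec T w = {}" using e e0 by (auto simp: four)
      then show False using wi by (auto simp: sec_def)
    qed
    then have "sec T 0 = {..<6}" using triv[of 0] by simp
    then have "cnt (sec T) (0, 0) = 1" using e by (simp add: cnt_def sum_four lbl_def)
    then show False using ev[of "(0, 0)"] by simp
  qed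
  then show ?thesis
    by (intro exI[of _ "sec T"] conjI allI ballI sec6[OF T(1)] ev)
qed

lemma small_sections:
  "\<exists>V. (\<forall>w<4. V w \<subseteq> {..<6} \<and> card (V w) = 2) \<and> (\<forall>p\<in>P. cnt V p = 0 \<or> cnt V p = 2)"
proof -
  obtain S where "(\<forall>w. S w \<subseteq> {..<6}) \<and> (\<forall>p\<in>P. even (cnt S p)) \<and> (\<exists>w<4. S w \<noteq> {} \<and> S w \<noteq> {..<6})"
    using relation_ex ..
  then have S1: "\<forall>w. S w \<subseteq> {..<6}" and S2: "\<forall>p\<in>P. even (cnt S p)"
    and S3: "\<exists>w<4. S w \<noteq> {} \<and> S w \<noteq> {..<6}"
    by simp_all
  note S = S1[THEN spec] S2[THEN bspec] S3
  have fin: "finite (S w)" for w using S(1)[of w] finite_subset by blast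
  have "even (\<Sum>x<4. if w = x then 0 else card (S x))" if w: "w < 4" for w
  proof -
    let ?T = "\<lambda>x. if x = w then {0::nat} else {}"
    have "even (\<Sum>p\<in>P. cnt ?T p * cnt S p)" by (intro dvd_sum) (simp add: S(2))
    then have "even (\<Sum>y<4. \<Sum>x<4. if y = x then 6 * card (?T y \<inter> S y) else card (?T y) * card (S x))"
      by (subst (asm) sum_cnt_product) (use S(1) in auto)
    moreover have "(\<Sum>y<4. \<Sum>x<4. if y = x then 6 * card (?T y \<inter> S y) else card (?T y) * card (S x)) =
        6 * card ({0} \<inter> S w) + (\<Sum>x<4. if w = x then 0 else card (S x))"
      using w unfolding four sum_four by (elim disjE) simp_all
    ultimately show ?thesis by simp
  qed
  from this[of 0] this[of 1] this[of 2] this[of 3]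
  have evS: "even (card (S w))" if "w < 4" for w using that unfolding four sum_four by auto
  have le6: "card (S w) \<le> 6" for w using card_mono[OF _ S(1)[of w]] by simp
  \<comment> \<open>Complementing the sections with four or six lines leaves 0 or 2 lines in each
    class. Each complement flips the parity at every point, so the parity of the counts is
    constant.\<close>
  define Fl where "Fl = {w \<in> {..<4}. 3 < card (S w)}"
  define V where "V w = (if w \<in> Fl then {..<6} - S w else if w < 4 then S w else {})" for w
  have V6: "V w \<subseteq> {..<6}" for w using S(1) by (auto simp: V_def)
  have Vc: "card (V w) = 0 \<or> card (V w) = 2" for w
  proof (cases "w < 4")
    case True
    have "card ({..<6} - S w) = 6 - card (S w)" using card_Diff_subset[OF fin S(1)] by simp
    then show ?thesis using evS[OF True] le6[of w] True unfolding V_def Fl_def by (auto elim!: evenE)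
  qed (auto simp: V_def Fl_def)
  have Vp: "odd (cnt V p) \<longleftrightarrow> odd (card Fl)" if p: "p \<in> P" for p
  proof -
    have "{w \<in> {..<4}. l w p \<in> V w} = sdiff {w \<in> {..<4}. l w p \<in> S w} Fl"
      using l_lt[OF p] by (auto simp: V_def in_sdiff Fl_def)
    then show ?thesis using S(2)[OF p] odd_card_sdiff[of "{w \<in> {..<4}. l w p \<in> S w}" Fl]
      unfolding cnt_card by (simp add: Fl_def)
  qed
  have Vle: "cnt V p \<le> 4" for p unfolding cnt_card using card_mono[of "{..<4::nat}" "{w \<in> {..<4}. l w p \<in> V w}"] by auto
  let ?a = "\<lambda>w. int (card (V w))"
  have s1: "(\<Sum>p\<in>P. int (cnt V p)) = 6 * (?a 0 + ?a 1 + ?a 2 + ?a 3)"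
  proof -
    let ?T = "\<lambda>x::nat. if x = 0 then {..<6::nat} else {}"
    have h: "cnt V p * cnt ?T p = cnt V p" if "p \<in> P" for p
      using l_lt[OF that, of 0] by (simp add: cnt_def[of ?T] sum_four)
    have "(\<Sum>p\<in>P. cnt V p) = (\<Sum>p\<in>P. cnt V p * cnt ?T p)"
      by (intro sum.cong refl) (rule h[symmetric])
    also have "\<dots> = 6 * (card (V 0) + card (V 1) + card (V 2) + card (V 3))"
      by (subst sum_cnt_product[OF V6]) (auto simp: sum_four Int_absorb2[OF V6])
    finally show ?thesis by (simp flip: of_nat_sum)
  qed
  have s2: "(\<Sum>p\<in>P. int (cnt V p) * int (cnt V p)) = 6 * (?a 0 + ?a 1 + ?a 2 + ?a 3) +
     2 * (?a 0 * ?a 1 + ?a 0 * ?a 2 + ?a 0 * ?a 3 + ?a 1 * ?a 2 + ?a 1 * ?a 3 + ?a 2 * ?a 3)"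
  proof -
    have "(\<Sum>p\<in>P. cnt V p * cnt V p) = 6 * (card (V 0) + card (V 1) + card (V 2) + card (V 3)) +
       2 * (card (V 0) * card (V 1) + card (V 0) * card (V 2) + card (V 0) * card (V 3) +
         card (V 1) * card (V 2) + card (V 1) * card (V 3) + card (V 2) * card (V 3))"
      unfolding sum_cnt_product[OF V6 V6] sum_four by simp
    then show ?thesis by (simp flip: of_nat_sum of_nat_mult)
  qed
  note Va = Vc[of 0] Vc[of 1] Vc[of 2] Vc[of 3]
  \<comment> \<open>If \<open>t\<close> classes of \<open>V\<close> have two lines, then
    \<open>s1\<close> is \<open>12 t\<close> and \<open>s2\<close> is \<open>4 t (t + 2)\<close>.
    Odd counts are 1 or 3 and would force \<open>4 t^2 - 40 t + 108 = 0\<close>, but this is at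
    least 12 for \<open>t \<le> 4\<close>.\<close>
  have evF: "even (card Fl)"
  proof (rule ccontr)
    assume o: "odd (card Fl)"
    have "(int (cnt V p) - 1) * (int (cnt V p) - 3) = 0" if "p \<in> P" for p
    proof -
      have "odd (cnt V p)" using Vp[OF that] o by simp
      moreover have "c = 1 \<or> c = 3" if "odd c" "c \<le> 4" for c :: nat using that by presburger
      ultimately have "cnt V p = 1 \<or> cnt V p = 3" using Vle[of p] by blast
      then show ?thesis by auto
    qed
    then have "0 = (\<Sum>p\<in>P. (int (cnt V p) - 1) * (int (cnt V p) - 3))"
      by (intro sum.neutral[symmetric] ballI)
    also have "\<dots> = (\<Sum>p\<in>P. int (cnt V p) * int (cnt V p)) - 4 * (\<Sum>p\<in>P. int (cnt V p)) + 108"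
      by (simp add: algebra_simps sum.distrib sum_subtractf sum_distrib_left)
    finally show False unfolding s1 s2 using Va by auto
  qed
  have nn: "int (cnt V p) * (int (cnt V p) - 2) \<ge> 0" if "p \<in> P" for p
  proof -
    have "c = 0 \<or> c \<ge> 2" if "even c" for c :: nat using that by presburger
    then have "cnt V p = 0 \<or> cnt V p \<ge> 2" using Vp[OF that] evF by blast
    then show ?thesis by auto
  qed
  have tot: "(\<Sum>p\<in>P. int (cnt V p) * (int (cnt V p) - 2)) =
      (\<Sum>p\<in>P. int (cnt V p) * int (cnt V p)) - 2 * (\<Sum>p\<in>P. int (cnt V p))"
    by (simp add: algebra_simps sum_subtractf sum_distrib_left)
  moreover have "(\<Sum>p\<in>P. int (cnt V p) * (int (cnt V p) - 2)) \<ge> 0" by (intro sum_nonneg nn)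
  \<comment> \<open>With \<open>t\<close> classes of two lines the sum is
    \<open>4 t (t - 4)\<close>. It is nonnegative only for \<open>t = 0\<close> and
    \<open>t = 4\<close>, and in the latter case it vanishes, which rules out points with four
    lines.\<close>
  ultimately have all: "(\<forall>w<4. card (V w) = 0) \<or> (\<forall>w<4. card (V w) = 2)"
    unfolding s1 s2 four using Va by auto
  have "\<not> (\<forall>w<4. card (V w) = 0)"
  proof
    assume a: "\<forall>w<4. card (V w) = 0"
    obtain w where w: "w < 4" "S w \<noteq> {}" "S w \<noteq> {..<6}" using S(3) by blast
    have "V w = {}" using a w(1) V6[of w] by (metis card_eq_0_iff finite_lessThan finite_subset)
    then show False using w S(1)[of w] by (auto simp: V_def split: if_splits)
  qed
  with all have a2: "\<forall>w<4. card (V w) = 2" by blast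
  have "(\<Sum>p\<in>P. int (cnt V p) * (int (cnt V p) - 2)) = 0" unfolding tot s1 s2 using a2 by simp
  then have "int (cnt V p) * (int (cnt V p) - 2) = 0" if "p \<in> P" for p
    using sum_nonneg_eq_0_iff[of P "\<lambda>p. int (cnt V p) * (int (cnt V p) - 2)"] nn that by blast
  then have c02: "cnt V p = 0 \<or> cnt V p = 2" if "p \<in> P" for p using that by fastforce
  show ?thesis
  proof (intro exI[of _ V] conjI allI impI ballI)
    show "V w \<subseteq> {..<6}" "w < 4 \<Longrightarrow> card (V w) = 2" for w using V6 a2 by blast+
  qed (rule c02)
qed

end

section \<open>The eight small lines, that is, the members of the sets \<open>V w\<close>\<close>

locale small6 = mols6 +
  fixes V :: "nat \<Rightarrow> nat set" and a a' :: nat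
  assumes V: "\<And>w. w < 4 \<Longrightarrow> V w \<subseteq> {..<6}" "\<And>w. w < 4 \<Longrightarrow> card (V w) = 2"
    and V02: "\<And>p. p \<in> P \<Longrightarrow> cnt V p = 0 \<or> cnt V p = 2"
    and a: "a \<noteq> a'" "V 0 = {a, a'}"
begin

lemma class_cases:
  assumes "w < 4" "x < 4" "y < 4" "z < 4" "distinct [w, x, y, z]" "v < (4::nat)"
  shows "v = w \<or> v = x \<or> v = y \<or> v = z"
proof -
  have "card {w, x, y, z} = 4" using assms(5) by simp
  then have "{w, x, y, z} = {..<4}" using assms by (intro card_subset_eq) auto
  then show ?thesis using assms(6) by (metis insertE lessThan_iff singletonD)
qed

lemma not_three:
  assumes "p \<in> P" "x < 4" "y < 4" "z < 4" "x \<noteq> y" "y \<noteq> z" "x \<noteq> z" "l x p \<in> V x" "l y p \<in> V y"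
  shows "l z p \<notin> V z"
proof
  assume z: "l z p \<in> V z"
  have "card {x, y, z} \<le> card {w \<in> {..<4}. l w p \<in> V w}"
    using assms z by (intro card_mono) auto
  moreover have "card {x, y, z} = 3" using assms by simp
  ultimately show False using V02[OF assms(1)] unfolding cnt_card by linarith
qed

lemma second_small:
  assumes "p \<in> P" "x < 4" "l x p \<in> V x" obtains y where "y < 4" "y \<noteq> x" "l y p \<in> V y"
proof -
  let ?A = "{w \<in> {..<4}. l w p \<in> V w}"
  have "x \<in> ?A" using assms by simp
  moreover have "finite ?A" by simp
  ultimately have "card ?A \<noteq> 0" by (metis card_0_eq empty_iff)
  then have "card ?A = 2" using V02[OF assms(1)] unfolding cnt_card by auto
  then have "card (?A - {x}) = 1" using \<open>x \<in> ?A\<close> by simp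
  then obtain y where "?A - {x} = {y}" by (rule card_1_singletonE)
  then have "y \<in> ?A - {x}" by blast
  then show thesis using that[of y] by simp
qed

lemma V_eq: assumes "w < 4" "u \<in> V w" "v \<in> V w" "u \<noteq> v" shows "V w = {u, v}"
proof -
  have "finite (V w)" using V(1)[OF assms(1)] finite_subset by blast
  then have "{u, v} = V w" by (rule card_subset_eq) (use assms V(2) in auto)
  then show ?thesis by simp
qed

text \<open>Two such points would use both small lines of class \<open>x\<close> and both of class
  \<open>y\<close>. Their common line of class \<open>w\<close> meets a small line of class
  \<open>z\<close> in a point \<open>r\<close>, whose second small line has class \<open>x\<close>
  or \<open>y\<close>. So \<open>r\<close> is \<open>p\<close> or \<open>q\<close>, which would then
  lie on three small lines.\<close>

lemma same_type:
  assumes wxyz: "w < 4" "x < 4" "y < 4" "z < 4" "distinct [w, x, y, z]"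
    and p: "p \<in> P" "l x p \<in> V x" "l y p \<in> V y" and q: "q \<in> P" "l x q \<in> V x" "l y q \<in> V y"
    and pq: "l w p = l w q"
  shows "p = q"
proof (rule ccontr)
  assume ne: "p \<noteq> q"
  have d: "w \<noteq> x" "w \<noteq> y" "w \<noteq> z" "x \<noteq> y" "x \<noteq> z" "y \<noteq> z" using wxyz(5) by auto
  note all4 = class_cases[OF wxyz]
  have "l x p \<noteq> l x q" "l y p \<noteq> l y q" using l_inj[OF wxyz(1,2) d(1) p(1) q(1) pq] l_inj[OF wxyz(1,3) d(2) p(1) q(1) pq] ne by auto
  then have Vx: "V x = {l x p, l x q}" and Vy: "V y = {l y p, l y q}"
    using V_eq wxyz p q by auto
  obtain v where v: "v \<in> V z" using V(2)[OF wxyz(4)] by fastforce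
  then have v6: "v < 6" using V(1)[OF wxyz(4)] by auto
  obtain r where r: "r \<in> P" "l w r = l w p" "l z r = v" using l_ex[OF wxyz(1,4) d(3) l_lt[OF p(1)] v6] .
  have pw: "l w p \<notin> V w" using not_three[OF p(1) wxyz(2,3,1)] d p by auto
  obtain u where u: "u < 4" "u \<noteq> z" "l u r \<in> V u" using second_small[OF r(1) wxyz(4)] r(3) v by auto
  have "u = x \<or> u = y" using all4[of u] u pw r(2) by auto
  then have "r = p \<or> r = q"
  proof
    assume "u = x"
    then have "l x r = l x p \<or> l x r = l x q" using u(3) Vx by auto
    then show ?thesis using l_inj[OF wxyz(1,2) d(1) r(1)] p(1) q(1) r(2) pq by auto
  next
    assume "u = y"
    then have "l y r = l y p \<or> l y r = l y q" using u(3) Vy by auto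
    then show ?thesis using l_inj[OF wxyz(1,3) d(2) r(1)] p(1) q(1) r(2) pq by auto
  qed
  then show False using not_three[OF p(1) wxyz(2,3,4)] not_three[OF q(1) wxyz(2,3,4)] p q d r(3) v by auto
qed

text \<open>A second small line passes through \<open>q\<close>. Its class is not \<open>y\<close>,
  since the line of class \<open>y\<close> also contains \<open>p\<close>, and it is not
  \<open>x\<close> by \<open>same_type\<close>.\<close>

lemma switch:
  assumes wxyz: "x < 4" "y < 4" "z < 4" "distinct [0, x, y, z]"
    and p: "p \<in> P" "l 0 p \<in> V 0" "l x p \<in> V x" and q: "q \<in> P" "l 0 q \<in> V 0" "l 0 q \<noteq> l 0 p"
    and pq: "l y p = l y q"
  shows "l z q \<in> V z"
proof -
  have d: "0 \<noteq> x" "0 \<noteq> y" "0 \<noteq> z" "x \<noteq> y" "x \<noteq> z" "y \<noteq> z" using wxyz(4) by auto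
  note all4 = class_cases[OF _ wxyz]
  obtain u where u: "u < 4" "u \<noteq> 0" "l u q \<in> V u" using second_small[OF q(1) _ q(2)] by auto
  have "l y q \<notin> V y" using not_three[OF p(1), of 0 x y] wxyz d p pq by auto
  then have "u \<noteq> y" using u by auto
  moreover have "u \<noteq> x"
  proof
    assume "u = x"
    then have "p = q" using same_type[of y 0 x z p q] wxyz d p q u pq by auto
    then show False using q(3) by simp
  qed
  ultimately show ?thesis using all4[of u] u by auto
qed

text \<open>The line of class \<open>z\<close> through \<open>p\<close> and \<open>q\<close> is not
  small. The second small line through \<open>s\<close> is not of class 0 either, because that would
  make \<open>s\<close> equal to \<open>p\<close> or \<open>q\<close>.\<close>

lemma third_point:
  assumes xyz: "x < 4" "y < 4" "z < 4" "distinct [0, x, y, z]"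
    and P: "p \<in> P" "q \<in> P" "s \<in> P" and rows: "l 0 p \<in> V 0" "l 0 q \<in> V 0" "l 0 p \<noteq> l 0 q"
    and pq: "l x p \<in> V x" "l y q \<in> V y" "l z p = l z q"
    and s: "l z s = l z p" "l x s \<in> V x" "l x s \<noteq> l x p"
  shows "l y s \<in> V y" "l y s \<noteq> l y q"
proof -
  have d: "0 \<noteq> x" "0 \<noteq> y" "0 \<noteq> z" "x \<noteq> y" "x \<noteq> z" "y \<noteq> z" using xyz(4) by auto
  have V0: "V 0 = {l 0 p, l 0 q}" using V_eq[of 0 "l 0 p" "l 0 q"] rows by auto
  have "l z p \<notin> V z" using not_three[OF P(1), of 0 x z] xyz d rows pq by auto
  have sq: "s \<noteq> q" using not_three[OF P(3), of 0 y x] xyz d rows pq s by auto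
  obtain u where u: "u < 4" "u \<noteq> x" "l u s \<in> V u" using second_small[OF P(3) xyz(1)] s by auto
  have "u \<noteq> z" using u \<open>l z p \<notin> V z\<close> s by auto
  moreover have "u \<noteq> 0"
  proof
    assume "u = 0"
    then have "l 0 s = l 0 p \<or> l 0 s = l 0 q" using u V0 by auto
    then have "s = p \<or> s = q" using l_inj[of 0 z s p] l_inj[of 0 z s q] xyz d P s pq by auto
    then show False using s sq by auto
  qed
  ultimately have "u = y" using class_cases[OF _ xyz, of u] u by auto
  then show "l y s \<in> V y" using u by simp
  show "l y s \<noteq> l y q" using l_inj[of y z s q] xyz d s P pq sq by auto
qed

text \<open>By \<open>third_point\<close>, both lines of class \<open>z\<close> pass through the
  meet of the other small lines of classes \<open>x\<close> and \<open>y\<close>. Hence they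
  coincide, and \<open>p1 = p2\<close> lies on three small lines.\<close>

lemma no_return:
  assumes xyz: "x < 4" "y < 4" "z < 4" "distinct [0, x, y, z]"
    and P: "p1 \<in> P" "q1 \<in> P" "p2 \<in> P" "q2 \<in> P"
    and rows: "l 0 p1 = r" "l 0 p2 = r" "l 0 q1 = r'" "l 0 q2 = r'" "r \<noteq> r'" "r \<in> V 0" "r' \<in> V 0"
    and bc: "l x p1 = b" "l y q1 = c" "l z p1 = l z q1" "l y p2 = c" "l x q2 = b" "l z p2 = l z q2"
      "b \<in> V x" "c \<in> V y"
  shows False
proof -
  have d: "0 \<noteq> x" "0 \<noteq> y" "0 \<noteq> z" "x \<noteq> y" "x \<noteq> z" "y \<noteq> z" using xyz(4) by auto
  have V0: "V 0 = {r, r'}" using V_eq[of 0 r r'] rows by auto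
  have other: "\<exists>b'. b' \<in> V w \<and> b' \<noteq> b \<and> b' < 6" if "w < 4" "b \<in> V w" for w b
  proof -
    have "card (V w - {b}) = 1" using V(2)[OF that(1)] that(2) by simp
    then obtain b' where "V w - {b} = {b'}" by (rule card_1_singletonE)
    then have "b' \<in> V w - {b}" by blast
    then show ?thesis using V(1)[OF that(1)] by auto
  qed
  obtain b' where b': "b' \<in> V x" "b' \<noteq> b" "b' < 6" using other[OF xyz(1) bc(7)] by blast
  obtain c' where c': "c' \<in> V y" "c' \<noteq> c" "c' < 6" using other[OF xyz(2) bc(8)] by blast
  have Vx: "V x = {b, b'}" and Vy: "V y = {c, c'}" using V_eq xyz bc b' c' by auto
  obtain s where s: "s \<in> P" "l z s = l z p1" "l x s = b'" using l_ex[of z x "l z p1" b'] xyz d l_lt[OF P(1)] b' by auto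
  obtain t where t: "t \<in> P" "l z t = l z p2" "l y t = c'" using l_ex[of z y "l z p2" c'] xyz d l_lt[OF P(3)] c' by auto
  have "l y s = c'"
    using third_point[OF xyz P(1,2) s(1)] rows bc s b' Vy by auto
  moreover have "l x t = b'"
    using third_point[of y x z p2 q2 t] xyz d P t rows bc c' Vx by auto
  ultimately have "s = t" using l_inj[of x y s t] xyz d s t by auto
  then have "p1 = p2" using l_inj[of 0 z p1 p2] xyz d P rows s t by auto
  then show False using not_three[OF P(1), of 0 x y] xyz d bc rows by auto
qed

definition R :: "nat \<Rightarrow> nat \<Rightarrow> nat \<Rightarrow> nat \<times> nat" where
  "R r x v = (SOME p. p \<in> P \<and> l 0 p = r \<and> l x p = v)"

lemma R:
  assumes "r < 6" "v < 6" "x < 4" "x \<noteq> 0"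
  shows "R r x v \<in> P" "l 0 (R r x v) = r" "l x (R r x v) = v"
proof -
  obtain p where "p \<in> P" "l 0 p = r" "l x p = v" using l_ex[of 0 x r v] assms by auto
  then have "\<exists>p. p \<in> P \<and> l 0 p = r \<and> l x p = v" by blast
  from someI_ex[OF this] show "R r x v \<in> P" "l 0 (R r x v) = r" "l x (R r x v) = v"
    unfolding R_def by simp_all
qed

lemma R_unique:
  assumes "p \<in> P" "x < 4" "x \<noteq> 0" shows "R (l 0 p) x (l x p) = p"
  using R[OF l_lt[OF assms(1)] l_lt[OF assms(1)] assms(2,3), of 0 x] assms
  by (intro l_inj[of 0 x]) auto

text \<open>\<open>g x y v\<close>: leave row \<open>a\<close> at its point on the small line \<open>v\<close> of class \<open>x\<close> along the line of
  class \<open>y\<close>; this arrives in row \<open>a'\<close> on a small line of the remaining class \<open>6 - x - y\<close>.\<close>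

definition g :: "nat \<Rightarrow> nat \<Rightarrow> nat \<Rightarrow> nat" where
  "g x y v = l (6 - x - y) (R a' y (l y (R a x v)))"

lemma a6: "a < 6" "a' < 6" "a \<in> V 0" "a' \<in> V 0"
  using a V(1)[of 0] by auto

lemma V6: "w < 4 \<Longrightarrow> v \<in> V w \<Longrightarrow> v < 6"
  using V(1) by blast

text \<open>Landing on a small line is \<open>switch\<close>, injectivity holds because the walk can
  be retraced, and the last inequality is \<open>no_return\<close>.\<close>

lemma g:
  assumes xyz: "(x, y, z) \<in> {(1,2,3), (1,3,2), (2,1,3), (2,3,1), (3,1,2), (3,2,1)}" and v: "v \<in> V x"
  shows "g x y v \<in> V z" "R a' y (l y (R a x v)) = R a' z (g x y v)"
    "\<And>u. u \<in> V x \<Longrightarrow> g x y u = g x y v \<Longrightarrow> u = v" "g z y (g x y v) \<noteq> v"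
proof -
  have d: "x < 4" "y < 4" "z < 4" "distinct [0, x, y, z]" "z = 6 - x - y" "x = 6 - z - y" "x \<noteq> 0" "y \<noteq> 0" "z \<noteq> 0"
    "x \<noteq> y" "distinct [0, x, z, y]" using xyz by auto
  have p: "R a x u \<in> P" "l 0 (R a x u) = a" "l x (R a x u) = u" if "u \<in> V x" for u
    using R[OF a6(1) V6[OF d(1) that] d(1,7)] by simp_all
  have q: "R a' y (l y p) \<in> P" "l 0 (R a' y (l y p)) = a'" "l y (R a' y (l y p)) = l y p" if "p \<in> P" for p
    using R[OF a6(2) l_lt[OF that] d(2,8)] by simp_all
  show G1: "g x y v \<in> V z" unfolding g_def d(5)[symmetric]
    by (rule switch[OF d(1-4), of "R a x v"]) (use p[OF v] q[OF p(1)[OF v]] a6 a v in auto)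
  show G2: "R a' y (l y (R a x v)) = R a' z (g x y v)"
    unfolding g_def d(5)[symmetric] using R_unique[OF q(1)[OF p(1)[OF v]] d(3,9)] q(2)[OF p(1)[OF v]] by simp
  show "u = v" if u: "u \<in> V x" and e: "g x y u = g x y v" for u
  proof -
    have "R a' y (l y (R a x u)) = R a' y (l y (R a x v))"
      using q[OF p(1)[OF u]] q[OF p(1)[OF v]] e d unfolding g_def d(5)[symmetric] by (intro l_inj[of 0 z]) auto
    from arg_cong[OF this, of "l y"] have "l y (R a x u) = l y (R a x v)"
      unfolding q(3)[OF p(1)[OF u]] q(3)[OF p(1)[OF v]] .
    then have "R a x u = R a x v"
      by (rule l_inj[OF zero_less_numeral d(2) not_sym[OF d(8)] p(1)[OF u] p(1)[OF v]
          trans[OF p(2)[OF u] p(2)[OF v, symmetric]]])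
    from arg_cong[OF this, of "l x"] show ?thesis unfolding p(3)[OF u] p(3)[OF v] .
  qed
  show "g z y (g x y v) \<noteq> v"
  proof
    assume e: "g z y (g x y v) = v"
    have p': "R a z (g x y v) \<in> P" "l 0 (R a z (g x y v)) = a" "l z (R a z (g x y v)) = g x y v"
      using R[OF a6(1) V6[OF d(3) G1] d(3,9)] by simp_all
    show False
    proof (rule no_return[OF d(1,3,2,11), of "R a x v" "R a' y (l y (R a x v))"
          "R a z (g x y v)" "R a' y (l y (R a z (g x y v)))" a a' v "g x y v"])
      show "l x (R a' y (l y (R a z (g x y v)))) = v" using e unfolding g_def[of z] d(6)[symmetric] .
      show "l z (R a' y (l y (R a x v))) = g x y v" unfolding g_def d(5)[symmetric] ..
    qed (use p[OF v] p' q[OF p(1)[OF v]] q[OF p'(1)] a a6 v G1 in auto)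
  qed
qed

end

text \<open>The unknowns are the coordinates of the six points of row \<open>a'\<close> on small
  lines of classes 1, 2 and 3. The disjunction covers the two ways of matching class 2 with class 3
  along class 1. In both cases the system implies that \<open>c * c' * (c - c') * (b0 - b1)\<close>
  vanishes, and \<open>c = c'\<close> would give \<open>b0 = d0\<close>.\<close>

lemma six_equations:
  fixes b0 b1 c0 c1 d0 d1 c c' :: complex
  assumes cc: "c \<noteq> 0" "c' \<noteq> 0" "b0 \<noteq> d0"
    and 1: "c * (c0 - b0) = c' * (c0 - d0)" "c * (c1 - b1) = c' * (c1 - d1)"
    and 2: "c * (b1 - d0) = c' * (b1 - c0) \<and> c * (b0 - d1) = c' * (b0 - c1) \<and>
        c * (d0 - c1) = c' * (d0 - b1) \<and> c * (d1 - c0) = c' * (d1 - b0) \<or>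
      c * (b1 - d1) = c' * (b1 - c0) \<and> c * (b0 - d0) = c' * (b0 - c1) \<and>
        c * (d1 - c1) = c' * (d1 - b0) \<and> c * (d0 - c0) = c' * (d0 - b1)"
  shows "b0 = b1"
proof -
  have ne: "c \<noteq> c'" using 1(1) cc by auto
  have "4 * c * c' * (c - c') * (b0 - b1) = 0" using 1 2 by algebra
  then show ?thesis using cc ne by simp
qed

lemma no_geo_mols_6: "\<not> geo_mols 6 C D"
proof
  assume "geo_mols 6 C D"
  then have m: "mols 6 C D" and "\<exists>c c' Y. row_coords 6 C D c c' Y" by (auto simp: geo_mols_def)
  then obtain c c' Y where y: "row_coords 6 C D c c' Y" by blast
  interpret mols6 C D by unfold_locales (rule m)
  obtain V where "(\<forall>w<4. V w \<subseteq> {..<6} \<and> card (V w) = 2) \<and> (\<forall>p\<in>P. cnt V p = 0 \<or> cnt V p = 2)"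
    using small_sections ..
  then have V1: "\<forall>w<4. V w \<subseteq> {..<6} \<and> card (V w) = 2" and V2: "\<forall>p\<in>P. cnt V p = 0 \<or> cnt V p = 2" by simp_all
  have "card (V 0) = 2" using V1 by simp
  then obtain a a' where a: "a \<noteq> a'" "V 0 = {a, a'}" by (auto simp: card_2_iff)
  interpret small6 C D V a a' by unfold_locales (use V1 V2 a in auto)
  define f where "f q = Y a a' (snd q)" for q :: "nat \<times> nat"
  have c: "c \<noteq> 0" "c' \<noteq> 0" and inj: "inj_on (Y a a') {..<6}"
    and eq: "\<And>j j1 j2. j < 6 \<Longrightarrow> j1 < 6 \<Longrightarrow> j2 < 6 \<Longrightarrow> C a' j1 = C a j \<Longrightarrow> D a' j2 = D a j \<Longrightarrow>
      c * (Y a a' j2 - Y a a' j) = c' * (Y a a' j2 - Y a a' j1)"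
    using y a6 a unfolding row_coords_def by simp_all
  have fne: "q = q'" if "q \<in> P" "q' \<in> P" "l 0 q = a'" "l 0 q' = a'" "f q = f q'" for q q'
  proof -
    have "snd q = snd q'" using that inj_onD[OF inj, of "snd q" "snd q'"] by (auto simp: f_def)
    then show ?thesis using that by (auto simp: lbl_def prod_eq_iff)
  qed
  have EQ: "c * (f q3 - f q1) = c' * (f q3 - f q2)"
    if "p \<in> P" "q1 \<in> P" "q2 \<in> P" "q3 \<in> P" "l 0 p = a" "l 0 q1 = a'" "l 0 q2 = a'" "l 0 q3 = a'"
      "l 1 q1 = l 1 p" "l 2 q2 = l 2 p" "l 3 q3 = l 3 p" for p q1 q2 q3
    using eq[of "snd p" "snd q2" "snd q3"] that by (auto simp: lbl_def f_def)
  let ?h = "\<lambda>x v y. R a' y (l y (R a x v))"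
  have EQ': "c * (f (?h x v 3) - f (?h x v 1)) = c' * (f (?h x v 3) - f (?h x v 2))"
    if "x \<in> {1,2,3}" "v \<in> V x" for x v
  proof -
    have x: "x < 4" "x \<noteq> 0" using that(1) by auto
    note p = R[OF a6(1) V6[OF x(1) that(2)] x]
    note q = R[OF a6(2) l_lt[OF p(1)]]
    show ?thesis by (rule EQ[OF p(1)]) (use p q in auto)
  qed
  have self: "?h x v x = R a' x v" if "x \<in> {1,2,3}" "v \<in> V x" for x v
    using R(3)[OF a6(1) V6[OF _ that(2)]] that(1) by auto
  have RP: "R a' x v \<in> P" "l 0 (R a' x v) = a'" "l x (R a' x v) = v" if "x \<in> {1,2,3}" "v \<in> V x" for x v
    using R[OF a6(2) V6[OF _ that(2)]] that(1) by auto
  have "card (V 1) = 2" using V1 by simp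
  then obtain b0 b1 where b: "b0 \<noteq> b1" "V 1 = {b0, b1}" by (auto simp: card_2_iff)
  define c0 c1 d0 d1 where cd: "c0 = g 1 3 b0" "c1 = g 1 3 b1" "d0 = g 1 2 b0" "d1 = g 1 2 b1"
  have bV: "b0 \<in> V 1" "b1 \<in> V 1" using b by auto
  have cV: "c0 \<in> V 2" "c1 \<in> V 2" "c0 \<noteq> c1" and dV: "d0 \<in> V 3" "d1 \<in> V 3" "d0 \<noteq> d1"
    using g(1,3)[of 1 3 2] g(1,3)[of 1 2 3] bV b(1) by (auto simp: cd)
  have V2: "V 2 = {c0, c1}" and V3: "V 3 = {d0, d1}" using V_eq[of 2] V_eq[of 3] cV dV by auto
  \<comment> \<open>A class has two small lines, so the inequality \<open>g(4)\<close> determines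
    these values. Only the matching by \<open>g 2 1\<close> stays open and leads to the case
    distinction below.\<close>
  have g23: "g 2 3 c0 = b1" "g 2 3 c1 = b0"
    using g(1)[of 2 3 1 c0] g(1)[of 2 3 1 c1] g(4)[of 1 3 2 b0] g(4)[of 1 3 2 b1] cV bV b(2) by (auto simp: cd)
  have g32: "g 3 2 d0 = b1" "g 3 2 d1 = b0"
    using g(1)[of 3 2 1 d0] g(1)[of 3 2 1 d1] g(4)[of 1 2 3 b0] g(4)[of 1 2 3 b1] dV bV b(2) by (auto simp: cd)
  have g31: "g 3 1 (g 2 1 v) \<noteq> v" "g 3 1 (g 2 1 v) \<in> V 2" if "v \<in> V 2" for v
    using g(4)[of 2 1 3 v] g(1)[of 2 1 3 v] g(1)[of 3 1 2 "g 2 1 v"] that by auto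
  let ?b = "\<lambda>v. f (R a' 1 v)" and ?c = "\<lambda>v. f (R a' 2 v)" and ?d = "\<lambda>v. f (R a' 3 v)"
  have E1: "c * (?c (g 1 3 v) - ?b v) = c' * (?c (g 1 3 v) - ?d (g 1 2 v))" if "v \<in> V 1" for v
    using EQ'[of 1 v] self[of 1 v] g(2)[of 1 3 2 v] g(2)[of 1 2 3 v] that by simp
  have E2: "c * (?b (g 2 3 v) - ?d (g 2 1 v)) = c' * (?b (g 2 3 v) - ?c v)" if "v \<in> V 2" for v
    using EQ'[of 2 v] self[of 2 v] g(2)[of 2 3 1 v] g(2)[of 2 1 3 v] that by simp
  have E3: "c * (?d v - ?c (g 3 1 v)) = c' * (?d v - ?b (g 3 2 v))" if "v \<in> V 3" for v
    using EQ'[of 3 v] self[of 3 v] g(2)[of 3 1 2 v] g(2)[of 3 2 1 v] that by simp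
  have bd: "?b b0 \<noteq> ?d d0"
  proof
    assume "?b b0 = ?d d0"
    then have e: "R a' 1 b0 = R a' 3 d0" using RP[of 1 b0] RP[of 3 d0] bV dV by (intro fne) auto
    then show False using not_three[of "R a' 1 b0" 0 1 3] RP[of 1 b0] RP[of 3 d0] bV dV a6 by auto
  qed
  have "g 2 1 c0 \<in> V 3" "g 2 1 c1 \<in> V 3" "g 2 1 c0 \<noteq> g 2 1 c1"
    using g(1,3)[of 2 1 3] cV by auto
  then consider "g 2 1 c0 = d0" "g 2 1 c1 = d1" | "g 2 1 c0 = d1" "g 2 1 c1 = d0" using V3 by auto
  then have "?b b0 = ?b b1"
  proof cases
    case 1
    have "g 3 1 d0 = c1" "g 3 1 d1 = c0" using g31[OF cV(1)] g31[OF cV(2)] V2 1 by auto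
    then show ?thesis
      using six_equations[OF c bd, of "?c c0" "?c c1" "?b b1" "?d d1"] E1[OF bV(1)] E1[OF bV(2)]
        E2[OF cV(1)] E2[OF cV(2)] E3[OF dV(1)] E3[OF dV(2)] g23 g32 1 unfolding cd[symmetric] by simp
  next
    case 2
    have "g 3 1 d1 = c1" "g 3 1 d0 = c0" using g31[OF cV(1)] g31[OF cV(2)] V2 2 by auto
    then show ?thesis
      using six_equations[OF c bd, of "?c c0" "?c c1" "?b b1" "?d d1"] E1[OF bV(1)] E1[OF bV(2)]
        E2[OF cV(1)] E2[OF cV(2)] E3[OF dV(1)] E3[OF dV(2)] g23 g32 2 unfolding cd[symmetric] by simp
  qed
  then have "R a' 1 b0 = R a' 1 b1" using RP[of 1 b0] RP[of 1 b1] bV by (intro fne) auto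
  then show False using RP(3)[of 1 b0] RP(3)[of 1 b1] bV b(1) by simp
qed

section \<open>The Hessian arrangement\<close>

abbreviation vec3 :: "complex \<Rightarrow> complex \<Rightarrow> complex \<Rightarrow> complex^3" where
  "vec3 a b c \<equiv> vector [a, b, c]"

lemma line_eq_plane: "line_eq a b c = plane (vec3 a b c)"
  by (simp add: line_eq_def plane_def dot3_def vector_3)

lemma dot3_vec3: "dot3 (vec3 a b c) v = a * v$1 + b * v$2 + c * v$3"
  by (simp add: dot3_def vector_3)

lemma plane_Int_span:
  assumes "crs m n \<noteq> 0" "dot3 m p = 0" "dot3 n p = 0" "p \<noteq> 0"
  shows "plane m \<inter> plane n = vec.span {p}"
proof -
  obtain a where a: "p = a *s crs m n" using dot3_both_0[OF assms(1-3)] .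
  then have "a \<noteq> 0" using assms(4) by auto
  then have "vec.span {p} = vec.span {crs m n}" using vec.span_image_scale[of "{crs m n}" "\<lambda>_. a"] a by simp
  then show ?thesis using plane_Int[OF assms(1)] by simp
qed

section \<open>Cube roots of unity and the nine base points\<close>

definition U3 :: "complex set" where "U3 = {z. z ^ 3 = 1}"

lemma U3_mult: "x \<in> U3 \<Longrightarrow> y \<in> U3 \<Longrightarrow> x * y \<in> U3"
  and U3_div: "x \<in> U3 \<Longrightarrow> y \<in> U3 \<Longrightarrow> x / y \<in> U3"
  and U3_nz: "x \<in> U3 \<Longrightarrow> x \<noteq> 0" and U3_1: "1 \<in> U3"
  by (auto simp: U3_def power_mult_distrib power_divide)

text \<open>Both numbers are roots of \<open>z^2 + z + 1\<close>, whose constant term is their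
  product.\<close>

lemma U3_prod_1:
  assumes "x \<in> U3" "y \<in> U3" "x \<noteq> 1" "y \<noteq> 1" "x \<noteq> y" shows "x * y = 1"
proof -
  have h: "z\<^sup>2 + z + 1 = 0" if "z \<in> U3" "z \<noteq> 1" for z
  proof -
    have "(z - 1) * (z\<^sup>2 + z + 1) = z ^ 3 - 1" by (simp add: algebra_simps power2_eq_square power3_eq_cube)
    then show ?thesis using that by (auto simp: U3_def)
  qed
  have "(x - y) * (x + y + 1) = 0" using h[OF assms(1,3)] h[OF assms(2,4)] by algebra
  then have "x + y + 1 = 0" using assms(5) by simp
  then show ?thesis using h[OF assms(1,3)] by algebra
qed

locale cube_root =
  fixes \<omega> :: complex
  assumes prim: "primitive_root_of_unity 3 \<omega>"
begin

lemma w3: "\<omega> ^ 3 = 1" and w1: "\<omega> \<noteq> 1" and w2: "\<omega>\<^sup>2 \<noteq> 1"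
proof -
  have p: "\<omega> ^ 3 = 1" "\<forall>m. 0 < m \<and> m < 3 \<longrightarrow> \<omega> ^ m \<noteq> 1"
    using prim unfolding primitive_root_of_unity_def by blast+
  show "\<omega> ^ 3 = 1" "\<omega> \<noteq> 1" "\<omega>\<^sup>2 \<noteq> 1" using p(1) p(2)[rule_format, of 1] p(2)[rule_format, of 2] by simp_all
qed

lemma w_pow_mod: "\<omega> ^ a = \<omega> ^ (a mod 3)"
proof -
  have "\<omega> ^ a = \<omega> ^ (3 * (a div 3) + a mod 3)" by simp
  also have "\<dots> = \<omega> ^ (a mod 3)" by (simp only: power_add power_mult w3) simp
  finally show ?thesis .
qed

lemma w_distinct: "\<omega> \<noteq> \<omega>\<^sup>2" "\<omega> \<noteq> 0"
proof -
  show 0: "\<omega> \<noteq> 0" using w3 by (metis power_zero_numeral zero_neq_one)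
  show "\<omega> \<noteq> \<omega>\<^sup>2" using 0 w1 by (simp add: power2_eq_square)
qed

lemma w_pow_eq_iff: "\<omega> ^ a = \<omega> ^ b \<longleftrightarrow> a mod 3 = b mod 3"
proof
  assume e: "\<omega> ^ a = \<omega> ^ b"
  have "a mod 3 = 0 \<or> a mod 3 = 1 \<or> a mod 3 = 2" "b mod 3 = 0 \<or> b mod 3 = 1 \<or> b mod 3 = 2" by auto
  then show "a mod 3 = b mod 3" using e w1 w2 w_distinct w_pow_mod[of a] w_pow_mod[of b] by auto
qed (metis w_pow_mod)

lemma U3_eq: "U3 = {1, \<omega>, \<omega>\<^sup>2}"
proof -
  have "\<omega> \<in> U3" "\<omega>\<^sup>2 \<in> U3" using w3 U3_mult[of \<omega> \<omega>] by (auto simp: U3_def power2_eq_square)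
  moreover have "z \<in> {1, \<omega>, \<omega>\<^sup>2}" if "z \<in> U3" for z
  proof (rule ccontr)
    assume n: "z \<notin> {1, \<omega>, \<omega>\<^sup>2}"
    have "z * \<omega> = 1" "z * \<omega>\<^sup>2 = 1"
      using U3_prod_1[of z \<omega>] U3_prod_1[of z "\<omega>\<^sup>2"] n that w1 w2 calculation by auto
    then have "z * \<omega> = z * \<omega>\<^sup>2" by simp
    then show False using U3_nz[OF that] w_distinct(1) by simp
  qed
  ultimately show ?thesis using U3_1 by auto
qed

lemma card_U3: "card U3 = 3" and finite_U3: "finite U3"
  unfolding U3_eq using w1 w2 w_distinct by (auto simp: card_insert_if)

lemma U3_pow: "x \<in> U3 \<longleftrightarrow> (\<exists>i\<in>{0,1,2}. x = \<omega> ^ i)"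
  unfolding U3_eq by auto

text \<open>The congruence for \<open>i + j\<close> becomes a condition on the product of the two
  coefficients.\<close>

definition H :: "complex \<Rightarrow> (complex \<times> complex) set" where
  "H \<kappa> = {(\<beta>, \<gamma>). \<beta> \<in> U3 \<and> \<gamma> \<in> U3 \<and> \<beta> * \<gamma> = \<kappa>}"

definition hline :: "complex \<times> complex \<Rightarrow> (complex^3) set" where
  "hline = (\<lambda>(\<beta>, \<gamma>). plane (vec3 1 \<beta> \<gamma>))"

lemma H_image: "\<kappa> \<in> U3 \<Longrightarrow> H \<kappa> = (\<lambda>\<beta>. (\<beta>, \<kappa> / \<beta>)) ` U3"
  unfolding H_def using U3_div U3_nz by (auto simp: image_iff)

lemma card_H: "\<kappa> \<in> U3 \<Longrightarrow> card (H \<kappa>) = 3" and finite_H: "\<kappa> \<in> U3 \<Longrightarrow> finite (H \<kappa>)"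
  using card_image[of "\<lambda>\<beta>. (\<beta>, \<kappa> / \<beta>)" U3] card_U3 finite_U3 by (auto simp: H_image inj_on_def)

lemma crs_hline:
  "crs (vec3 1 \<beta> \<gamma>) (vec3 1 \<beta>' \<gamma>') = 0 \<longleftrightarrow> \<beta> = \<beta>' \<and> \<gamma> = \<gamma>'"
  by (auto simp: vec3_eq_iff vector_3)

lemma vec3_nz: "vec3 1 \<beta> \<gamma> \<noteq> 0" "vec3 0 1 \<gamma> \<noteq> 0" "vec3 0 0 1 \<noteq> 0"
  by (auto simp: vec3_eq_iff vector_3)

lemma inj_hline: "inj hline"
  by (rule injI) (auto simp: hline_def plane_eq_iff vec3_nz crs_hline)

lemma hessian_class_1: "hessian_class \<omega> 1 = {plane (vec3 1 0 0), plane (vec3 0 1 0), plane (vec3 0 0 1)}"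
  by (simp add: hessian_class_def coord_lines_def line_eq_plane)

text \<open>The predicate \<open>Q\<close> lets one computation serve a single class and, as a
  constant, all nine lines.\<close>

lemma hessian_family:
  "{line_eq 1 (\<omega> ^ i) (\<omega> ^ j) | i j. i \<in> {0,1,2} \<and> j \<in> {0,1,2} \<and> Q (\<omega> ^ (i + j))} =
   hline ` {(\<beta>, \<gamma>). \<beta> \<in> U3 \<and> \<gamma> \<in> U3 \<and> Q (\<beta> * \<gamma>)}" (is "?L = ?R")
proof (intro set_eqI iffI)
  fix x assume "x \<in> ?L"
  then obtain i j where ij: "x = line_eq 1 (\<omega> ^ i) (\<omega> ^ j)" "i \<in> {0,1,2}" "j \<in> {0,1,2}" "Q (\<omega> ^ (i + j))" by blast
  have "\<omega> ^ i \<in> U3" "\<omega> ^ j \<in> U3" using ij(2,3) U3_pow by blast+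
  then show "x \<in> ?R" using ij(1,4) by (intro image_eqI[of _ _ "(\<omega> ^ i, \<omega> ^ j)"]) (simp_all add: hline_def line_eq_plane power_add)
next
  fix x assume "x \<in> ?R"
  then obtain \<beta> \<gamma> where x: "x = hline (\<beta>, \<gamma>)" "\<beta> \<in> U3" "\<gamma> \<in> U3" "Q (\<beta> * \<gamma>)" by blast
  obtain i j where ij: "i \<in> {0,1,2}" "\<beta> = \<omega> ^ i" "j \<in> {0,1,2}" "\<gamma> = \<omega> ^ j" using x(2,3) U3_pow by metis
  have "x = line_eq 1 (\<omega> ^ i) (\<omega> ^ j)" "Q (\<omega> ^ (i + j))" using x ij by (simp_all add: hline_def line_eq_plane power_add)
  then show "x \<in> ?L" using ij(1,3) by blast
qed

lemma hessian_class_H: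
  assumes "m \<in> {2, 3, 4}" shows "hessian_class \<omega> m = hline ` H (\<omega> ^ (m - 2))"
proof -
  have "m \<noteq> 1" using assms by auto
  then have "hessian_class \<omega> m = {line_eq 1 (\<omega> ^ i) (\<omega> ^ j) | i j. i \<in> {0,1,2} \<and> j \<in> {0,1,2} \<and> \<omega> ^ (i + j) = \<omega> ^ (m - 2)}"
    unfolding hessian_class_def w_pow_eq_iff by simp
  then show ?thesis unfolding H_def hessian_family[of "\<lambda>z. z = \<omega> ^ (m - 2)"] .
qed

lemma hessian_lines_Union: "hessian_lines \<omega> = (\<Union>m\<in>{1..4}. hessian_class \<omega> m)"
proof -
  have e: "{1..4::nat} = {1, 2, 3, 4}" by auto
  have prod: "{(\<beta>, \<gamma>). \<beta> \<in> U3 \<and> \<gamma> \<in> U3 \<and> True} = U3 \<times> U3" by auto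
  have "{line_eq 1 (\<omega> ^ i) (\<omega> ^ j) | i j. i \<in> {0,1,2} \<and> j \<in> {0,1,2}} = hline ` (U3 \<times> U3)"
    using hessian_family[of "\<lambda>_. True"] unfolding prod by simp
  also have "U3 \<times> U3 = H 1 \<union> H \<omega> \<union> H (\<omega>\<^sup>2)"
  proof -
    have "\<beta> * \<gamma> = 1 \<or> \<beta> * \<gamma> = \<omega> \<or> \<beta> * \<gamma> = \<omega>\<^sup>2" if "\<beta> \<in> U3" "\<gamma> \<in> U3" for \<beta> \<gamma>
      using U3_mult[OF that] unfolding U3_eq by simp
    then show ?thesis unfolding H_def by auto
  qed
  finally show ?thesis unfolding hessian_lines_def e
    using hessian_class_1 hessian_class_H[of 2] hessian_class_H[of 3] hessian_class_H[of 4]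
    by (simp add: image_Un Un_assoc coord_lines_def line_eq_plane)
qed

text \<open>For \<open>r\<close> in \<open>U3\<close> these are the nine inflection points of the
  cubic \<open>x^3 + y^3 + z^3 = 0\<close>; \<open>c\<close> tells which coordinate
  vanishes.\<close>

definition hpoint :: "nat \<Rightarrow> complex \<Rightarrow> complex^3" where
  "hpoint c r = (if c = 0 then vec3 0 1 (- r) else if c = 1 then vec3 (- r) 0 1 else vec3 (- r) 1 0)"

lemma hpoint_nz: "hpoint c r \<noteq> 0"
  by (auto simp: hpoint_def vec3_eq_iff vector_3)

lemma hpoint_on_hline:
  assumes "\<beta> \<in> U3" "\<gamma> \<in> U3"
  shows "dot3 (vec3 1 \<beta> \<gamma>) (hpoint c r) = 0 \<longleftrightarrow> r = (if c = 0 then \<beta> / \<gamma> else if c = 1 then \<gamma> else \<beta>)"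
  using U3_nz[OF assms(2)] by (auto simp: hpoint_def dot3_vec3 vector_3 field_simps)

lemma hpoint_on_coord:
  assumes "r \<in> U3"
  shows "dot3 (vec3 1 0 0) (hpoint c r) = 0 \<longleftrightarrow> c = 0" "dot3 (vec3 0 1 0) (hpoint c r) = 0 \<longleftrightarrow> c = 1"
    "dot3 (vec3 0 0 1) (hpoint c r) = 0 \<longleftrightarrow> c \<noteq> 0 \<and> c \<noteq> 1"
  using U3_nz[OF assms] by (auto simp: hpoint_def dot3_vec3 vector_3)

definition hchi :: "(complex^3) set set" where
  "hchi = {vec.span {hpoint c r} | c r. c < 3 \<and> r \<in> U3}"

lemma hchi_unique_H:
  assumes "\<kappa> \<in> U3" "r \<in> U3" "c < 3"
  shows "\<exists>!l. l \<in> hline ` H \<kappa> \<and> vec.span {hpoint c r} \<subseteq> l"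
proof -
  let ?b = "\<lambda>\<beta> \<gamma>. r = (if c = 0 then \<beta> / \<gamma> else if c = 1 then \<gamma> else \<beta>)"
  have on: "vec.span {hpoint c r} \<subseteq> hline (\<beta>, \<gamma>) \<longleftrightarrow> ?b \<beta> \<gamma>" if "(\<beta>, \<gamma>) \<in> H \<kappa>" for \<beta> \<gamma>
    using that hpoint_on_hline[of \<beta> \<gamma> c r] by (simp add: H_def hline_def span_singleton_subset_plane)
  have r: "r \<noteq> 0" "\<kappa> \<noteq> 0" "r ^ 3 = 1" "\<kappa> ^ 3 = 1" using assms U3_nz by (auto simp: U3_def)
  have "\<exists>\<beta> \<gamma>. (\<beta>, \<gamma>) \<in> H \<kappa> \<and> ?b \<beta> \<gamma> \<and> (\<forall>\<beta>' \<gamma>'. (\<beta>', \<gamma>') \<in> H \<kappa> \<longrightarrow> ?b \<beta>' \<gamma>' \<longrightarrow> \<beta>' = \<beta> \<and> \<gamma>' = \<gamma>)"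
  proof -
    consider "c = 0" | "c = 1" | "c = 2" using assms(3) by linarith
    then show ?thesis
    proof cases
      case 1
      \<comment> \<open>The conditions amount to \<gamma> squared being \<open>\<kappa> / r\<close>,
        and squaring is its own inverse on the cube roots of unity.\<close>
      define \<gamma> where "\<gamma> = (\<kappa> / r)\<^sup>2"
      have k: "\<kappa> / r \<in> U3" using U3_div assms by simp
      have g1: "\<gamma> \<in> U3" unfolding \<gamma>_def power2_eq_square by (rule U3_mult[OF k k])
      note g = g1 U3_mult[OF assms(2) g1]
      have "\<gamma> * \<gamma> = (\<kappa> / r) ^ 3 * (\<kappa> / r)" by (simp add: \<gamma>_def power2_eq_square power3_eq_cube mult_ac)
      also have "\<dots> = \<kappa> / r" using k by (simp add: U3_def)
      finally have gg: "r * \<gamma> * \<gamma> = \<kappa>" using r by (simp add: mult.assoc)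
      have u0: "\<beta>' = r * \<gamma> \<and> \<gamma>' = \<gamma>" if "(\<beta>', \<gamma>') \<in> H \<kappa>" "r = \<beta>' / \<gamma>'" for \<beta>' \<gamma>'
      proof -
        have b: "\<beta>' \<in> U3" "\<gamma>' \<in> U3" "\<beta>' * \<gamma>' = \<kappa>" "\<gamma>' \<noteq> 0" "\<gamma>' ^ 3 = 1" using that(1) U3_nz by (auto simp: H_def U3_def)
        have e: "\<beta>' = r * \<gamma>'" using that(2) b(4) nonzero_eq_divide_eq by metis
        then have e2: "\<kappa> / r = \<gamma>' * \<gamma>'" using b(3) r by (simp add: field_simps)
        have "\<gamma> = \<gamma>' ^ 3 * \<gamma>'" unfolding \<gamma>_def e2 by (simp add: power2_eq_square power3_eq_cube)
        then show ?thesis using b e by simp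
      qed
      have "(r * \<gamma>, \<gamma>) \<in> H \<kappa>" "r = r * \<gamma> / \<gamma>" using g gg U3_nz[OF g(1)] by (simp_all add: H_def)
      then show ?thesis unfolding if_P[OF 1] using u0 by blast
    next
      case 2
      have "(\<kappa> / r, r) \<in> H \<kappa>" using r assms U3_div by (simp add: H_def)
      moreover have "\<beta>' = \<kappa> / r" if "(\<beta>', r) \<in> H \<kappa>" for \<beta>' using that r by (auto simp: H_def)
      ultimately have "\<exists>\<beta> \<gamma>. (\<beta>, \<gamma>) \<in> H \<kappa> \<and> r = \<gamma> \<and> (\<forall>\<beta>' \<gamma>'. (\<beta>', \<gamma>') \<in> H \<kappa> \<longrightarrow> r = \<gamma>' \<longrightarrow> \<beta>' = \<beta> \<and> \<gamma>' = \<gamma>)" by blast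
      then show ?thesis by (simp only: 2 one_neq_zero if_False if_True refl)
    next
      case 3
      have "(r, \<kappa> / r) \<in> H \<kappa>" using r assms U3_div by (simp add: H_def)
      moreover have "\<gamma>' = \<kappa> / r" if "(r, \<gamma>') \<in> H \<kappa>" for \<gamma>' using that r by (auto simp: H_def)
      ultimately have "\<exists>\<beta> \<gamma>. (\<beta>, \<gamma>) \<in> H \<kappa> \<and> r = \<beta> \<and> (\<forall>\<beta>' \<gamma>'. (\<beta>', \<gamma>') \<in> H \<kappa> \<longrightarrow> r = \<beta>' \<longrightarrow> \<beta>' = \<beta> \<and> \<gamma>' = \<gamma>)" by blast
      moreover have "c \<noteq> 0" "c \<noteq> 1" using 3 by simp_all
      ultimately show ?thesis by (simp only: if_False)
    qed
  qed
  then obtain \<beta> \<gamma> where bg: "(\<beta>, \<gamma>) \<in> H \<kappa>" "?b \<beta> \<gamma>" and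
    u: "\<And>\<beta>' \<gamma>'. (\<beta>', \<gamma>') \<in> H \<kappa> \<Longrightarrow> ?b \<beta>' \<gamma>' \<Longrightarrow> \<beta>' = \<beta> \<and> \<gamma>' = \<gamma>" by blast
  show ?thesis
  proof (intro ex1I[of _ "hline (\<beta>, \<gamma>)"] conjI)
    show "hline (\<beta>, \<gamma>) \<in> hline ` H \<kappa>" "vec.span {hpoint c r} \<subseteq> hline (\<beta>, \<gamma>)" using bg on by auto
    fix l assume l: "l \<in> hline ` H \<kappa> \<and> vec.span {hpoint c r} \<subseteq> l"
    then obtain \<beta>' \<gamma>' where "(\<beta>', \<gamma>') \<in> H \<kappa>" "l = hline (\<beta>', \<gamma>')" by auto
    then show "l = hline (\<beta>, \<gamma>)" using u on l by metis
  qed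
qed

lemma hchi_unique_coord:
  assumes "r \<in> U3" "c < 3" shows "\<exists>!l. l \<in> hessian_class \<omega> 1 \<and> vec.span {hpoint c r} \<subseteq> l"
proof -
  note on = hpoint_on_coord[OF assms(1), of c, folded span_singleton_subset_plane]
  consider "c = 0" | "c = 1" | "c = 2" using assms(2) by linarith
  then show ?thesis
  proof cases
    case 1 then show ?thesis using on unfolding hessian_class_1
      by (intro ex1I[of _ "plane (vec3 1 0 0)"]) (simp, elim conjE insertE emptyE, simp_all)
  next
    case 2 then show ?thesis using on unfolding hessian_class_1
      by (intro ex1I[of _ "plane (vec3 0 1 0)"]) (simp, elim conjE insertE emptyE, simp_all)
  next
    case 3 then show ?thesis using on unfolding hessian_class_1
      by (intro ex1I[of _ "plane (vec3 0 0 1)"]) (simp, elim conjE insertE emptyE, simp_all)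
  qed
qed

lemma hline_Int_coord:
  assumes "(\<beta>, \<gamma>) \<in> H \<kappa>" "l \<in> hessian_class \<omega> 1" shows "hline (\<beta>, \<gamma>) \<inter> l \<in> hchi"
proof -
  have b: "\<beta> \<in> U3" "\<gamma> \<in> U3" using assms(1) by (auto simp: H_def)
  have key: "hline (\<beta>, \<gamma>) \<inter> plane m \<in> hchi"
    if "crs (vec3 1 \<beta> \<gamma>) m \<noteq> 0" "dot3 m (hpoint c r) = 0" "c < 3"
      "r = (if c = 0 then \<beta> / \<gamma> else if c = 1 then \<gamma> else \<beta>)" for m c r
  proof -
    have "hline (\<beta>, \<gamma>) \<inter> plane m = vec.span {hpoint c r}"
      unfolding hline_def prod.case
      by (rule plane_Int_span[OF that(1) _ that(2) hpoint_nz]) (use hpoint_on_hline[OF b, of c r] that(4) in simp)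
    moreover have "r \<in> U3" using that(4) b U3_div by auto
    ultimately show ?thesis using that(3) unfolding hchi_def by blast
  qed
  have nz: "\<beta> \<noteq> 0" "\<gamma> \<noteq> 0" using b U3_nz by auto
  from assms(2) consider "l = plane (vec3 1 0 0)" | "l = plane (vec3 0 1 0)" | "l = plane (vec3 0 0 1)"
    unfolding hessian_class_1 by blast
  then show ?thesis
  proof cases
    case 1 then show ?thesis using key[of "vec3 1 0 0" 0 "\<beta> / \<gamma>"] hpoint_on_coord(1)[OF U3_div[OF b]] nz
      by (simp add: vec3_eq_iff vector_3)
  next
    case 2 then show ?thesis using key[of "vec3 0 1 0" 1 "\<gamma>"] hpoint_on_coord(2)[OF b(2)] nz
      by (simp add: vec3_eq_iff vector_3)
  next
    case 3 then show ?thesis using key[of "vec3 0 0 1" 2 "\<beta>"] hpoint_on_coord(3)[OF b(1)] nz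
      by (simp add: vec3_eq_iff vector_3)
  qed
qed

lemma hline_Int_hline:
  assumes "(\<beta>, \<gamma>) \<in> H \<kappa>" "(\<beta>', \<gamma>') \<in> H \<kappa>'" "\<kappa> \<noteq> \<kappa>'" shows "hline (\<beta>, \<gamma>) \<inter> hline (\<beta>', \<gamma>') \<in> hchi"
proof -
  have b: "\<beta> \<in> U3" "\<gamma> \<in> U3" "\<beta> * \<gamma> = \<kappa>" and b': "\<beta>' \<in> U3" "\<gamma>' \<in> U3" "\<beta>' * \<gamma>' = \<kappa>'"
    using assms by (auto simp: H_def)
  have nz: "\<beta> \<noteq> 0" "\<gamma> \<noteq> 0" "\<beta>' \<noteq> 0" "\<gamma>' \<noteq> 0" using b b' U3_nz by auto
  have cr: "crs (vec3 1 \<beta> \<gamma>) (vec3 1 \<beta>' \<gamma>') \<noteq> 0" using assms(3) b b' crs_hline by auto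
  let ?f = "\<lambda>c \<beta> \<gamma>. if c = 0 then \<beta> / \<gamma> else if c = (1::nat) then \<gamma> else \<beta> :: complex"
  have "\<exists>c<3. ?f c \<beta> \<gamma> = ?f c \<beta>' \<gamma>'"
  proof (cases "\<beta> = \<beta>' \<or> \<gamma> = \<gamma>'")
    case True
    then show ?thesis
    proof
      assume "\<beta> = \<beta>'" then show ?thesis by (intro exI[of _ 2]) simp
    next
      assume "\<gamma> = \<gamma>'" then show ?thesis by (intro exI[of _ 1]) simp
    qed
  next
    case False
    \<comment> \<open>Otherwise the two ratios are distinct and nontrivial cube roots of unity.
      Their product would be 1, which means \<open>\<kappa> = \<kappa>'\<close>.\<close>
    have "\<beta>' / \<beta> = \<gamma>' / \<gamma>"
    proof (rule ccontr)
      assume n: "\<beta>' / \<beta> \<noteq> \<gamma>' / \<gamma>"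
      have "\<beta>' / \<beta> * (\<gamma>' / \<gamma>) = 1"
        using n False nz by (intro U3_prod_1 U3_div b b') auto
      then show False using assms(3) b b' nz by (simp add: field_simps)
    qed
    then have "\<beta> / \<gamma> = \<beta>' / \<gamma>'" using nz by (simp add: field_simps)
    then show ?thesis by (intro exI[of _ 0]) simp
  qed
  then obtain c where c: "c < 3" "?f c \<beta> \<gamma> = ?f c \<beta>' \<gamma>'" by blast
  have "hline (\<beta>, \<gamma>) \<inter> hline (\<beta>', \<gamma>') = vec.span {hpoint c (?f c \<beta> \<gamma>)}"
    unfolding hline_def prod.case
    by (rule plane_Int_span[OF cr _ _ hpoint_nz])
      (use hpoint_on_hline[OF b(1,2), of c "?f c \<beta> \<gamma>"] hpoint_on_hline[OF b'(1,2), of c "?f c \<beta> \<gamma>"] c(2) in simp_all)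
  moreover have "?f c \<beta> \<gamma> \<in> U3" using b U3_div by auto
  ultimately show ?thesis using c(1) unfolding hchi_def by blast
qed

lemma hline_neq_coord:
  assumes "(\<beta>, \<gamma>) \<in> H \<kappa>" shows "hline (\<beta>, \<gamma>) \<notin> hessian_class \<omega> 1"
proof -
  have "\<beta> \<noteq> 0" "\<gamma> \<noteq> 0" using assms U3_nz by (auto simp: H_def)
  then show ?thesis unfolding hessian_class_1
    by (simp add: hline_def plane_eq_iff vec3_nz) (simp add: vec3_eq_iff vector_3)
qed

lemma pow_U3: "\<omega> ^ n \<in> U3"
proof -
  have "(\<omega> ^ n) ^ 3 = (\<omega> ^ 3) ^ n" by (simp only: power_mult[symmetric] mult.commute)
  then show ?thesis by (simp add: U3_def w3)
qed

lemma hessian_net: "is_net 4 3 (hessian_lines \<omega>) (hessian_class \<omega>) hchi"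
proof -
  have cases4: "m = 1 \<or> m \<in> {2, 3, 4}" if "m \<in> {1..4}" for m :: nat using that by auto
  have kne: "\<omega> ^ (m - 2) \<noteq> \<omega> ^ (m' - 2)" if "m \<in> {2, 3, 4}" "m' \<in> {2, 3, 4}" "m \<noteq> m'" for m m'
    using that unfolding w_pow_eq_iff by auto
  have H_disj: "p \<notin> H \<kappa>'" if "p \<in> H \<kappa>" "\<kappa> \<noteq> \<kappa>'" for p \<kappa> \<kappa>' using that by (auto simp: H_def)
  have uniq: "\<exists>!l. l \<in> hessian_class \<omega> m \<and> X \<subseteq> l" if X0: "X \<in> hchi" and m4: "m \<in> {1..4}" for X m
  proof -
    obtain c r where X: "X = vec.span {hpoint c r}" "c < 3" "r \<in> U3" using X0 by (auto simp: hchi_def)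
    show ?thesis
    proof (cases "m = 1")
      case True then show ?thesis using hchi_unique_coord[OF X(3,2)] X(1) by simp
    next
      case False
      then have "m \<in> {2, 3, 4}" using cases4[OF m4] by simp
      then show ?thesis using hchi_unique_H[OF pow_U3 X(3,2)] X(1) hessian_class_H by simp
    qed
  qed
  have meet: "l \<inter> l' \<in> hchi" if h: "m \<in> {1..4}" "m' \<in> {1..4}" "m \<noteq> m'" "l \<in> hessian_class \<omega> m" "l' \<in> hessian_class \<omega> m'" for m m' l l'
  proof -
    have one: "l \<inter> l' \<in> hchi" if o: "m' \<in> {2, 3, 4}" "l \<in> hessian_class \<omega> 1" "l' \<in> hessian_class \<omega> m'" for m' l l'
    proof -
      obtain \<beta> \<gamma> where "(\<beta>, \<gamma>) \<in> H (\<omega> ^ (m' - 2))" "l' = hline (\<beta>, \<gamma>)" using o hessian_class_H by auto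
      then show ?thesis using hline_Int_coord[of \<beta> \<gamma> _ l] o(2) by (simp add: Int_commute)
    qed
    consider "m = 1" "m' \<in> {2, 3, 4}" | "m' = 1" "m \<in> {2, 3, 4}" | "m \<in> {2, 3, 4}" "m' \<in> {2, 3, 4}"
      using cases4[OF h(1)] cases4[OF h(2)] h(3) by blast
    then show ?thesis
    proof cases
      case 1 then show ?thesis using one[of m' l l'] h by simp
    next
      case 2 then show ?thesis using one[of m l' l] h by (simp add: Int_commute)
    next
      case 3
      obtain \<beta> \<gamma> where 1: "(\<beta>, \<gamma>) \<in> H (\<omega> ^ (m - 2))" "l = hline (\<beta>, \<gamma>)" using h 3 hessian_class_H by auto
      obtain \<beta>' \<gamma>' where 2: "(\<beta>', \<gamma>') \<in> H (\<omega> ^ (m' - 2))" "l' = hline (\<beta>', \<gamma>')" using h 3 hessian_class_H by auto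
      show ?thesis using hline_Int_hline[OF 1(1) 2(1) kne[OF 3 h(3)]] 1(2) 2(2) by simp
    qed
  qed
  have disj: "l \<notin> hessian_class \<omega> m'" if "m \<in> {1..4}" "m' \<in> {1..4}" "m \<noteq> m'" "l \<in> hessian_class \<omega> m" for m m' l
  proof
    assume l': "l \<in> hessian_class \<omega> m'"
    have 1: "m \<noteq> 1" if "m' \<in> {2, 3, 4}" "l \<in> hessian_class \<omega> m" "l \<in> hessian_class \<omega> m'" for m m'
      using that hessian_class_H hline_neq_coord by auto
    have "m \<in> {2, 3, 4}" "m' \<in> {2, 3, 4}"
      using 1[of m' m] 1[of m m'] cases4[OF that(1)] cases4[OF that(2)] that l' by auto
    then show False using that(3,4) l' hessian_class_H kne H_disj inj_hline
      by (metis (no_types, lifting) imageE injD)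
  qed
  have card: "finite (hessian_class \<omega> m) \<and> card (hessian_class \<omega> m) = 3" if "m \<in> {1..4}" for m
  proof (cases "m = 1")
    case True
    have "plane (vec3 1 0 0) \<noteq> plane (vec3 0 1 0)" "plane (vec3 1 0 0) \<noteq> plane (vec3 0 0 1)" "plane (vec3 0 1 0) \<noteq> plane (vec3 0 0 1)"
      by (simp_all add: plane_eq_iff vec3_nz) (simp_all add: vec3_eq_iff vector_3)
    then show ?thesis using True hessian_class_1 by simp
  next
    case False
    then have "m \<in> {2, 3, 4}" using cases4[OF that] by simp
    then show ?thesis using hessian_class_H card_H[OF pow_U3] finite_H[OF pow_U3]
      by (simp add: card_image inj_on_subset[OF inj_hline])
  qed
  have lines: "l \<in> cp2_lines" if "m \<in> {1..4}" "l \<in> hessian_class \<omega> m" for m l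
    using cases4[OF that(1)]
  proof
    assume "m = 1"
    then show ?thesis using that(2) hessian_class_1 by (auto intro!: plane_in_cp2_lines vec3_nz)
  next
    assume "m \<in> {2, 3, 4}"
    then show ?thesis using that(2) hessian_class_H by (auto simp: hline_def intro!: plane_in_cp2_lines vec3_nz)
  qed
  have "hchi = (\<lambda>(c, r). vec.span {hpoint c r}) ` ({..<3} \<times> U3)" by (auto simp: hchi_def)
  then have fin: "finite hchi" using finite_U3 by (metis finite_SigmaI finite_imageI finite_lessThan)
  show ?thesis unfolding is_net_def
  proof (intro conjI ballI impI)
    show "hessian_lines \<omega> \<subseteq> cp2_lines" unfolding hessian_lines_Union using lines by blast
    show "hchi \<subseteq> cp2_points" unfolding hchi_def using span_singleton_cp2_points hpoint_nz by blast
    show "\<exists>l\<in>hessian_lines \<omega>. X \<subseteq> l" if X: "X \<in> hchi" for X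
    proof -
      have "\<exists>l. l \<in> hessian_class \<omega> 1 \<and> X \<subseteq> l" using uniq[OF X, of 1] by (intro ex1_implies_ex) simp
      then obtain l where "l \<in> hessian_class \<omega> 1" "X \<subseteq> l" by blast
      then show ?thesis unfolding hessian_lines_Union by (intro bexI[of _ l] UN_I[of 1]) simp_all
    qed
    show "disjoint_family_on (hessian_class \<omega>) {1..4}" unfolding disjoint_family_on_def using disj by blast
  qed (use fin card meet uniq hessian_lines_Union in auto)
qed

end

section \<open>Uniqueness in order three\<close>

text \<open>The hypotheses force \<open>W = A\<close> and \<open>A = - B\<close>, so
  \<open>A\<close> is closed under addition. Translation by \<open>a\<close> permutes
  \<open>A\<close>; comparing sums gives \<open>3 * a = 0\<close>.\<close>

lemma additive_grid:
  fixes A B W :: "complex set"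
  assumes c: "card A = 3" "card W = 3" "card B = 3" and 0: "0 \<in> A" "0 \<in> B"
    and W: "\<And>a b. a \<in> A \<Longrightarrow> b \<in> B \<Longrightarrow> a - b \<in> W"
  shows False
proof -
  have fin: "finite A" "finite B" "finite W" using c by (simp_all add: card_ge_0_finite)
  have "A \<subseteq> W" using W[OF _ 0(2)] by auto
  then have WA: "W = A" using card_subset_eq[OF fin(3)] c by metis
  have "uminus ` B \<subseteq> A" using W[OF 0(1)] WA by auto
  moreover have "card (uminus ` B) = 3" using c by (simp add: card_image)
  ultimately have BA: "uminus ` B = A" using card_subset_eq[OF fin(1)] c by metis
  have closed: "x + a \<in> A" if x: "x \<in> A" and a: "a \<in> A" for x a
  proof -
    obtain b where "b \<in> B" "a = - b" using a BA by blast
    then show ?thesis using W[OF x] WA by force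
  qed
  have "a = 0" if a: "a \<in> A" for a
  proof -
    have "(\<lambda>x. x + a) ` A \<subseteq> A" using closed a by auto
    then have e: "(\<lambda>x. x + a) ` A = A" using fin(1) by (intro endo_inj_surj) auto
    have "sum id A = sum id ((\<lambda>x. x + a) ` A)" unfolding e ..
    also have "\<dots> = (\<Sum>x\<in>A. x + a)" by (subst sum.reindex) auto
    also have "\<dots> = sum id A + 3 * a" using c(1) by (simp add: sum.distrib)
    finally show ?thesis by simp
  qed
  then have "A \<subseteq> {0}" by auto
  then have "card A \<le> 1" using card_mono[of "{0::complex}" A] by simp
  then show False using c by simp
qed

text \<open>Here \<open>W = B\<close> and \<open>B\<close> consists of the inverses of
  \<open>A\<close>, so \<open>B\<close> is closed under multiplication. Comparing products over
  \<open>B\<close> before and after multiplication by \<open>b\<close> gives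
  \<open>b ^ 3 = 1\<close>.\<close>

lemma multiplicative_grid:
  fixes A B W :: "complex set"
  assumes c: "card A = 3" "card W = 3" "card B = 3" and 1: "1 \<in> A" "1 \<in> B" and nz: "0 \<notin> A" "0 \<notin> B"
    and W: "\<And>a b. a \<in> A \<Longrightarrow> b \<in> B \<Longrightarrow> b / a \<in> W"
  shows "A \<subseteq> U3" "B \<subseteq> U3"
proof -
  have fin: "finite A" "finite B" "finite W" using c by (simp_all add: card_ge_0_finite)
  have "B \<subseteq> W" using W[OF 1(1)] by auto
  then have WB: "W = B" using card_subset_eq[OF fin(3)] c by metis
  have "inverse ` A \<subseteq> B" using W[OF _ 1(2)] WB by (auto simp: inverse_eq_divide)
  moreover have "card (inverse ` A) = 3" using c by (subst card_image) (auto intro: inj_onI)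
  ultimately have AB: "inverse ` A = B" using card_subset_eq[OF fin(2)] c by metis
  have closed: "x * b \<in> B" if x: "x \<in> B" and b: "b \<in> B" for x b
  proof -
    obtain a where "a \<in> A" "b = inverse a" using b AB by blast
    then show ?thesis using W[OF _ x] WB by (auto simp: divide_inverse)
  qed
  have U: "b \<in> U3" if b: "b \<in> B" for b
  proof -
    have b0: "b \<noteq> 0" using b nz by auto
    have inj: "inj_on (\<lambda>x. x * b) B" using b0 by (auto simp: inj_on_def)
    have "(\<lambda>x. x * b) ` B \<subseteq> B" using closed b by auto
    then have e: "(\<lambda>x. x * b) ` B = B" using fin(2) inj by (intro endo_inj_surj) auto
    have "prod id B = prod id ((\<lambda>x. x * b) ` B)" unfolding e ..
    also have "\<dots> = (\<Prod>x\<in>B. x * b)" using inj by (subst prod.reindex) auto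
    also have "\<dots> = prod id B * b ^ 3" using c(3) by (simp add: prod.distrib)
    finally have "prod id B * (b ^ 3 - 1) = 0" by (simp add: algebra_simps)
    moreover have "prod id B \<noteq> 0" using nz(2) fin(2) by simp
    ultimately show ?thesis by (simp add: U3_def)
  qed
  then show "B \<subseteq> U3" by auto
  show "A \<subseteq> U3"
  proof
    fix a assume "a \<in> A"
    then have "1 / a \<in> U3" using U W[OF _ 1(2)] WB by blast
    then have "1 / (1 / a) \<in> U3" using U3_div U3_1 by blast
    then show "a \<in> U3" by simp
  qed
qed

lemma frame_identity:
  "dot3 e0 (crs e1 e2) *s m = dot3 m (crs e1 e2) *s e0 + dot3 m (crs e2 e0) *s e1 + dot3 m (crs e0 e1) *s e2"
  by (simp add: vec3_eq_iff dot3_def algebra_simps)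

lemma frame_meet:
  "dot3 e0 (crs e1 e2) * dot3 m' (crs e0 m) = dot3 m (crs e2 e0) * dot3 m' (crs e0 e1) - dot3 m (crs e0 e1) * dot3 m' (crs e2 e0)"
  by (simp add: dot3_def algebra_simps)

lemma frame_cycle: "dot3 e0 (crs e1 e2) = dot3 e1 (crs e2 e0)" "dot3 e0 (crs e1 e2) = dot3 e2 (crs e0 e1)"
  by (simp_all add: dot3_def algebra_simps)

lemma proj_map_eqI:
  assumes "invertible M" "\<And>v. v \<in> X \<longleftrightarrow> M *v v \<in> Y" shows "proj_map M X = Y"
proof -
  obtain N where N: "M ** N = mat 1" using assms(1) by (auto simp: invertible_def)
  have "M *v (N *v w) = w" for w by (simp add: matrix_vector_mul_assoc N)
  then have "w \<in> proj_map M X" if "w \<in> Y" for w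
    unfolding proj_map_def using assms(2) that by (intro image_eqI[of _ _ "N *v w"]) simp_all
  then show ?thesis using assms(2) by (auto simp: proj_map_def)
qed

lemma dot3_crs_combination: "dot3 m' (crs (a *s p + b *s q) m) = a * dot3 m' (crs p m) + b * dot3 m' (crs q m)"
  by (simp add: dot3_def algebra_simps)

section \<open>Coordinates adapted to the lines of class 0\<close>

locale net3 = net 3 n + cube_root \<omega> for n \<omega>
begin

abbreviation M :: "(nat \<times> nat) set" where "M \<equiv> {1, 2, 3} \<times> {..<3}"
abbreviation N :: "nat \<times> nat \<Rightarrow> complex^3" where "N m \<equiv> n (fst m) (snd m)"
abbreviation E :: "nat \<Rightarrow> complex^3" where "E \<equiv> n 0"

text \<open>Line \<open>m'\<close> passes through the meet of line \<open>m\<close> with line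
  \<open>r\<close> of class 0.\<close>

definition same :: "nat \<Rightarrow> nat \<times> nat \<Rightarrow> nat \<times> nat \<Rightarrow> bool" where
  "same r m m' \<longleftrightarrow> dot3 (N m') (crs (E r) (N m)) = 0"

lemma chi_EN: "r < 3 \<Longrightarrow> m \<in> M \<Longrightarrow> chi (crs (E r) (N m))"
  by (rule chi_crs) auto

lemma card_M: "card M = 9" "finite M"
  by (simp_all add: card_cartesian_product)

lemma same_class:
  assumes "r < 3" "(w, i) \<in> M" "(w, j) \<in> M" "same r (w, i) (w, j)" shows "i = j"
proof -
  have c: "chi (crs (E r) (n w i))" using chi_EN[OF assms(1,2)] by simp
  have "idx w (crs (E r) (n w i)) = i" "idx w (crs (E r) (n w i)) = j"
    using assms by (intro idx_eq[OF c]; force simp: same_def)+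
  then show ?thesis by simp
qed

lemma same_two:
  assumes r: "r < 3" "r' < 3" "r \<noteq> r'" and m: "m \<in> M" "m' \<in> M" and s: "same r m m'" "same r' m m'"
  shows "m = m'"
proof (rule ccontr)
  assume ne: "m \<noteq> m'"
  let ?p = "crs (E r) (N m)" and ?q = "crs (E r') (N m)"
  have c: "crs (N m) (N m') \<noteq> 0" using m ne by (intro crs_nz) (auto simp: prod_eq_iff)
  obtain a where a: "?p = a *s crs (N m) (N m')" using dot3_both_0[OF c, of ?p] s(1) by (auto simp: same_def)
  obtain b where b: "?q = b *s crs (N m) (N m')" using dot3_both_0[OF c, of ?q] s(2) by (auto simp: same_def)
  have p: "chi ?p" and q: "chi ?q" using chi_EN r m by auto
  have ab: "a \<noteq> 0" "b \<noteq> 0" using a b p q unfolding chi_def by auto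
  have "?p = (a / b) *s ?q" using a b ab by simp
  then have "idx 0 ?p = idx 0 ?q" using idx_parallel(2)[OF q, of ?p "a / b" 0] ab by simp
  moreover have "idx 0 ?p = r" "idx 0 ?q = r'" using r by (intro idx_eq p q; simp)+
  ultimately show False using r(3) by simp
qed

text \<open>Each base point of line \<open>r\<close> lies on exactly one line of class 1, so that
  class alone takes every value of \<open>u\<close> once.\<close>

lemma card_values:
  fixes u :: "nat \<times> nat \<Rightarrow> complex"
  assumes r: "r < 3" and u: "\<And>m m'. m \<in> M \<Longrightarrow> m' \<in> M \<Longrightarrow> u m = u m' \<longleftrightarrow> same r m m'"
  shows "card (u ` M) = 3"
proof -
  have "u m \<in> u ` ({1} \<times> {..<3})" if m: "m \<in> M" for m
  proof -
    let ?j = "idx 1 (crs (E r) (N m))"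
    have j: "?j < 3" "dot3 (n 1 ?j) (crs (E r) (N m)) = 0" using idx[OF chi_EN[OF r m], of 1] by auto
    then have "u m = u (1, ?j)" using u[OF m, of "(1, ?j)"] by (simp add: same_def)
    then show ?thesis using j(1) by (intro image_eqI[of _ _ "(1, ?j)"]) auto
  qed
  then have "u ` M \<subseteq> u ` ({1} \<times> {..<3})" by blast
  moreover have "u ` ({1} \<times> {..<3}) \<subseteq> u ` M" by (intro image_mono) auto
  ultimately have "u ` M = u ` ({1} \<times> {..<3})" by (rule subset_antisym)
  moreover have "inj_on u ({1} \<times> {..<3})"
  proof (rule inj_onI)
    fix m m' assume h: "m \<in> {1} \<times> {..<3}" "m' \<in> {1} \<times> {..<3}" "u m = u m'"
    then have M: "m \<in> M" "m' \<in> M" by auto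
    have "same r m m'" using u[OF M] h(3) by simp
    then have "snd m = snd m'" using same_class[OF r, of 1 "snd m" "snd m'"] h M by (auto simp: same_def)
    then show "m = m'" using h by (auto simp: prod_eq_iff)
  qed
  ultimately show ?thesis by (simp add: card_image card_cartesian_product)
qed

lemma grid:
  fixes u v :: "nat \<times> nat \<Rightarrow> complex"
  assumes r: "r < 3" "r' < 3" "r \<noteq> r'"
    and u: "\<And>m m'. m \<in> M \<Longrightarrow> m' \<in> M \<Longrightarrow> u m = u m' \<longleftrightarrow> same r m m'"
    and v: "\<And>m m'. m \<in> M \<Longrightarrow> m' \<in> M \<Longrightarrow> v m = v m' \<longleftrightarrow> same r' m m'"
  shows "inj_on (\<lambda>m. (u m, v m)) M" "(\<lambda>m. (u m, v m)) ` M = u ` M \<times> v ` M"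
proof -
  show inj: "inj_on (\<lambda>m. (u m, v m)) M"
  proof (rule inj_onI)
    fix m m' assume m: "m \<in> M" "m' \<in> M" "(u m, v m) = (u m', v m')"
    then have "same r m m'" "same r' m m'" using u[OF m(1,2)] v[OF m(1,2)] by simp_all
    then show "m = m'" by (rule same_two[OF r m(1,2)])
  qed
  have fin: "finite (u ` M \<times> v ` M)" using card_M(2) by simp
  have "card ((\<lambda>m. (u m, v m)) ` M) = 9" using card_image[OF inj] card_M by simp
  moreover have "card (u ` M \<times> v ` M) = 9"
    using card_values[OF r(1) u] card_values[OF r(2) v] by (simp add: card_cartesian_product)
  ultimately show "(\<lambda>m. (u m, v m)) ` M = u ` M \<times> v ` M"
    by (intro card_subset_eq[OF fin]) auto
qed

text \<open>If class 0 were concurrent, \<open>E 2\<close> would be a combination of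
  \<open>E 0\<close> and \<open>E 1\<close>. In the frame \<open>E 0\<close>, \<open>E 1\<close>,
  \<open>?h\<close> a line \<open>m\<close> has coefficients proportional to \<open>X m\<close>,
  \<open>Y m\<close>, \<open>t m\<close>; the scaled quotients \<open>u\<close>, \<open>v\<close>
  and their difference then classify the nine lines by their meets with the three lines of class 0.
  This is the configuration excluded by \<open>additive_grid\<close>; taking \<open>?h\<close> among
  the nine lines puts 0 into both value sets.\<close>

lemma E_independent: "dot3 (E 0) (crs (E 1) (E 2)) \<noteq> 0"
proof
  assume z: "dot3 (E 0) (crs (E 1) (E 2)) = 0"
  let ?Q = "crs (E 0) (E 1)" and ?h = "N (1, 0)"
  have fr: "free 0 ?Q" using free_crs[of 0 0 1] by simp
  have Q0: "?Q \<noteq> 0" "crs (E 1) (E 2) \<noteq> 0" "crs (E 0) (E 2) \<noteq> 0" using crs_nz[of 0 0 0 1] crs_nz[of 0 0 1 2] crs_nz[of 0 0 0 2] by simp_all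
  have "dot3 ?Q (E 2) = 0" using z frame_cycle(2)[of "E 0" "E 1" "E 2"] by (simp add: dot3_commute)
  then obtain \<alpha> \<beta> where E2: "E 2 = \<alpha> *s E 0 + \<beta> *s E 1"
    using plane_span[OF Q0(1) _ _ Q0(1), of "E 2"] by auto
  have \<alpha>: "\<alpha> \<noteq> 0"
  proof
    assume "\<alpha> = 0"
    then have "crs (E 1) (E 2) = 0" by (simp add: E2 vec3_eq_iff)
    then show False using Q0 by simp
  qed
  have \<beta>: "\<beta> \<noteq> 0"
  proof
    assume "\<beta> = 0"
    then have "crs (E 0) (E 2) = 0" by (simp add: E2 vec3_eq_iff)
    then show False using Q0 by simp
  qed
  define t X Y where d: "t m = dot3 (N m) ?Q" "X m = dot3 (N m) (crs (E 1) ?h)" "Y m = dot3 (N m) (crs ?h (E 0))" for m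
  define T where "T = dot3 (E 0) (crs (E 1) ?h)"
  have t: "t m \<noteq> 0" if "m \<in> M" for m using fr that unfolding free_def d by auto
  have T: "T \<noteq> 0" using t[of "(1, 0)"] frame_cycle(2)[of "E 0" "E 1" ?h] by (simp add: T_def d)
  have m0: "T * dot3 (N m') (crs (E 0) (N m)) = Y m * t m' - t m * Y m'" for m m'
    using frame_meet[of "E 0" "E 1" ?h "N m'" "N m"] by (simp add: T_def d)
  have m1: "T * dot3 (N m') (crs (E 1) (N m)) = t m * X m' - X m * t m'" for m m'
    using frame_meet[of "E 1" ?h "E 0" "N m'" "N m"] frame_cycle(1)[of "E 0" "E 1" ?h] by (simp add: T_def d)
  define u v where uv: "u m = \<alpha> * (Y m / t m)" "v m = \<beta> * (X m / t m)" for m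
  have s0: "u m = u m' \<longleftrightarrow> same 0 m m'" if "m \<in> M" "m' \<in> M" for m m'
  proof -
    have "same 0 m m' \<longleftrightarrow> Y m * t m' - t m * Y m' = 0" unfolding same_def m0[symmetric] using T by simp
    also have "\<dots> \<longleftrightarrow> u m = u m'" using t[OF that(1)] t[OF that(2)] \<alpha> by (auto simp: uv field_simps)
    finally show ?thesis by simp
  qed
  have s1: "v m = v m' \<longleftrightarrow> same 1 m m'" if "m \<in> M" "m' \<in> M" for m m'
  proof -
    have "same 1 m m' \<longleftrightarrow> t m * X m' - X m * t m' = 0" unfolding same_def m1[symmetric] using T by simp
    also have "\<dots> \<longleftrightarrow> v m = v m'" using t[OF that(1)] t[OF that(2)] \<beta> by (auto simp: uv field_simps)
    finally show ?thesis by simp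
  qed
  have s2: "u m - v m = u m' - v m' \<longleftrightarrow> same 2 m m'" if "m \<in> M" "m' \<in> M" for m m'
  proof -
    have "T * dot3 (N m') (crs (E 2) (N m)) = \<alpha> * (Y m * t m' - t m * Y m') + \<beta> * (t m * X m' - X m * t m')"
      unfolding E2 dot3_crs_combination m0[symmetric] m1[symmetric] by (simp add: algebra_simps)
    also have "\<dots> = t m * t m' * ((u m - v m) - (u m' - v m'))"
      using t[OF that(1)] t[OF that(2)] by (simp add: uv field_simps)
    finally show ?thesis using T t[OF that(1)] t[OF that(2)] unfolding same_def
      by (metis mult_eq_0_iff right_minus_eq)
  qed
  have z0: "u (1, 0) = 0" "v (1, 0) = 0" by (simp_all add: uv d)
  show False
  proof (rule additive_grid[of "u ` M" "(\<lambda>m. u m - v m) ` M" "v ` M"])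
    show "card (u ` M) = 3" by (rule card_values[of 0, OF _ s0]) simp_all
    show "card (v ` M) = 3" by (rule card_values[of 1, OF _ s1]) simp_all
    show "card ((\<lambda>m. u m - v m) ` M) = 3" by (rule card_values[of 2, OF _ s2]) simp_all
    show "0 \<in> u ` M" "0 \<in> v ` M" using z0 by (intro image_eqI[of _ _ "(1, 0)"]; simp)+
    fix a b assume "a \<in> u ` M" "b \<in> v ` M"
    then have "(a, b) \<in> (\<lambda>m. (u m, v m)) ` M" using grid(2)[of 0 1 u v, OF _ _ _ s0 s1] by simp
    then obtain m where "m \<in> M" "a = u m" "b = v m" by blast
    then show "a - b \<in> (\<lambda>m. u m - v m) ` M" by blast
  qed
qed

definition a0 :: "nat \<times> nat \<Rightarrow> complex" where "a0 m = dot3 (N m) (crs (E 1) (E 2))"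
definition a1 :: "nat \<times> nat \<Rightarrow> complex" where "a1 m = dot3 (N m) (crs (E 2) (E 0))"
definition a2 :: "nat \<times> nat \<Rightarrow> complex" where "a2 m = dot3 (N m) (crs (E 0) (E 1))"

lemma a_nz: assumes "m \<in> M" shows "a0 m \<noteq> 0" "a1 m \<noteq> 0" "a2 m \<noteq> 0"
  using assms free_crs[of 0 1 2] free_crs[of 0 2 0] free_crs[of 0 0 1] unfolding free_def a0_def a1_def a2_def by auto

text \<open>Ratio of frame coefficients, normalised so that the line \<open>(1, 0)\<close> becomes
  \<open>x + y + z = 0\<close>.\<close>

definition bt :: "nat \<times> nat \<Rightarrow> complex" where "bt m = (a1 m / a0 m) / (a1 (1, 0) / a0 (1, 0))"
definition gm :: "nat \<times> nat \<Rightarrow> complex" where "gm m = (a2 m / a0 m) / (a2 (1, 0) / a0 (1, 0))"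

lemma bt_gm_nz: "m \<in> M \<Longrightarrow> bt m \<noteq> 0" "m \<in> M \<Longrightarrow> gm m \<noteq> 0"
  using a_nz a_nz[of "(1, 0)"] by (simp_all add: bt_def gm_def)

lemma same_iff:
  assumes m: "m \<in> M" "m' \<in> M"
  shows "bt m = bt m' \<longleftrightarrow> same 2 m m'" "gm m = gm m' \<longleftrightarrow> same 1 m m'"
    "gm m / bt m = gm m' / bt m' \<longleftrightarrow> same 0 m m'"
proof -
  note nz = a_nz[OF m(1)] a_nz[OF m(2)] a_nz[of "(1, 0)", simplified]
  let ?D = "dot3 (E 0) (crs (E 1) (E 2))"
  have D: "?D \<noteq> 0" by (rule E_independent)
  have "?D * dot3 (N m') (crs (E 0) (N m)) = a1 m * a2 m' - a2 m * a1 m'"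
    using frame_meet[of "E 0" "E 1" "E 2" "N m'" "N m"] by (simp add: a1_def a2_def)
  then have 0: "same 0 m m' \<longleftrightarrow> a1 m * a2 m' = a2 m * a1 m'" unfolding same_def using D by (metis mult_eq_0_iff right_minus_eq)
  have "?D * dot3 (N m') (crs (E 1) (N m)) = a2 m * a0 m' - a0 m * a2 m'"
    using frame_meet[of "E 1" "E 2" "E 0" "N m'" "N m"] frame_cycle(1)[of "E 0" "E 1" "E 2"] by (simp add: a0_def a2_def)
  then have 1: "same 1 m m' \<longleftrightarrow> a2 m * a0 m' = a0 m * a2 m'" unfolding same_def using D by (metis mult_eq_0_iff right_minus_eq)
  have "?D * dot3 (N m') (crs (E 2) (N m)) = a0 m * a1 m' - a1 m * a0 m'"
    using frame_meet[of "E 2" "E 0" "E 1" "N m'" "N m"] frame_cycle(2)[of "E 0" "E 1" "E 2"] by (simp add: a0_def a1_def)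
  then have 2: "same 2 m m' \<longleftrightarrow> a0 m * a1 m' = a1 m * a0 m'" unfolding same_def using D by (metis mult_eq_0_iff right_minus_eq)
  show "bt m = bt m' \<longleftrightarrow> same 2 m m'" unfolding 2 bt_def using nz by (auto simp: field_simps)
  show "gm m = gm m' \<longleftrightarrow> same 1 m m'" unfolding 1 gm_def using nz by (auto simp: field_simps)
  show "gm m / bt m = gm m' / bt m' \<longleftrightarrow> same 0 m m'" unfolding 0 gm_def bt_def using nz by (auto simp: field_simps)
qed

definition pos :: "nat \<times> nat \<Rightarrow> complex \<times> complex" where "pos m = (bt m, gm m)"

lemma pos: "inj_on pos M" "pos ` M = U3 \<times> U3"
proof -
  have c: "card (bt ` M) = 3" "card (gm ` M) = 3" "card ((\<lambda>m. gm m / bt m) ` M) = 3"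
    by (rule card_values[of 2, OF _ same_iff(1)] card_values[of 1, OF _ same_iff(2)]
        card_values[of 0, OF _ same_iff(3)]; simp)+
  have g: "inj_on pos M" "pos ` M = bt ` M \<times> gm ` M"
    using grid[of 2 1 bt gm, OF _ _ _ same_iff(1,2)] by (simp_all add: pos_def[abs_def])
  have one: "bt (1, 0) = 1" "gm (1, 0) = 1" using a_nz[of "(1, 0)"] by (simp_all add: bt_def gm_def)
  have 1: "1 \<in> bt ` M" "1 \<in> gm ` M" using one by (intro image_eqI[of _ _ "(1, 0)"]; simp)+
  have nz: "0 \<notin> bt ` M" "0 \<notin> gm ` M" using bt_gm_nz by fastforce+
  have q: "b / a \<in> (\<lambda>m. gm m / bt m) ` M" if "a \<in> bt ` M" "b \<in> gm ` M" for a b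
  proof -
    have "(a, b) \<in> pos ` M" using that g(2) by simp
    then show ?thesis by (auto simp: pos_def)
  qed
  have "bt ` M \<subseteq> U3" "gm ` M \<subseteq> U3" using multiplicative_grid[OF c(1,3,2) 1 nz q] by blast+
  then have "bt ` M = U3" "gm ` M = U3"
    using card_subset_eq[OF finite_U3, of "bt ` M"] card_subset_eq[OF finite_U3, of "gm ` M"] c card_U3 by metis+
  then show "inj_on pos M" "pos ` M = U3 \<times> U3" using g by simp_all
qed

text \<open>Two lines of one class meet every line of class 0 in different points. So the quotients
  of their values of \<open>bt\<close> and of \<open>gm\<close> are distinct nontrivial cube roots
  of unity, and by \<open>U3_prod_1\<close> the product \<open>bt * gm\<close> is the same for
  both.\<close>

lemma class_H:
  assumes w: "w \<in> {1, 2, 3}" shows "\<exists>\<kappa>\<in>U3. pos ` ({w} \<times> {..<3}) = H \<kappa>"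
proof -
  have U: "bt m \<in> U3" "gm m \<in> U3" if "m \<in> M" for m using pos(2) that unfolding pos_def by blast+
  have wM: "(w, i) \<in> M" if "i < 3" for i using w that by auto
  define \<kappa> where "\<kappa> = bt (w, 0) * gm (w, 0)"
  have k: "\<kappa> \<in> U3" unfolding \<kappa>_def using U[OF wM[of 0]] U3_mult by simp
  have "bt (w, i) * gm (w, i) = \<kappa>" if i: "i < 3" for i
  proof (cases "i = 0")
    case False
    have ns: "\<not> same r (w, 0) (w, i)" if "r < 3" for r
      using same_class[OF that wM[of 0] wM[OF i]] False by auto
    let ?x = "bt (w, i) / bt (w, 0)" and ?y = "gm (w, i) / gm (w, 0)"
    have w0: "(w, 0) \<in> M" using w by auto
    note u0 = U[OF w0] and ui = U[OF wM[OF i]]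
    note nz = U3_nz[OF u0(1)] U3_nz[OF u0(2)] U3_nz[OF ui(1)] U3_nz[OF ui(2)]
    have "bt (w, 0) \<noteq> bt (w, i)" "gm (w, 0) \<noteq> gm (w, i)" "gm (w, 0) / bt (w, 0) \<noteq> gm (w, i) / bt (w, i)"
      using same_iff[OF wM[of 0] wM[OF i]] ns[of 0] ns[of 1] ns[of 2] by auto
    then have "?x \<noteq> 1" "?y \<noteq> 1" "?x \<noteq> ?y" using nz by (auto simp: field_simps)
    then have "?x * ?y = 1" using U3_prod_1[OF U3_div[OF ui(1) u0(1)] U3_div[OF ui(2) u0(2)]] by blast
    then show ?thesis using nz by (simp add: \<kappa>_def field_simps)
  qed (simp add: \<kappa>_def)
  then have sub: "pos ` ({w} \<times> {..<3}) \<subseteq> H \<kappa>" using U wM by (auto simp: pos_def H_def)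
  have "inj_on pos ({w} \<times> {..<3})" by (rule inj_on_subset[OF pos(1)]) (use w in auto)
  then have "card (pos ` ({w} \<times> {..<3})) = 3" by (simp add: card_image card_cartesian_product)
  then have "pos ` ({w} \<times> {..<3}) = H \<kappa>" using card_subset_eq[OF finite_H[OF k] sub] card_H[OF k] by simp
  then show ?thesis using k by blast
qed

lemma classes_H: "(\<lambda>w. pos ` ({w} \<times> {..<3})) ` {1, 2, 3} = H ` U3"
proof -
  obtain \<kappa> where k: "\<And>w. w \<in> {1, 2, 3} \<Longrightarrow> \<kappa> w \<in> U3 \<and> pos ` ({w} \<times> {..<3}) = H (\<kappa> w)"
    using class_H by metis
  have "inj_on \<kappa> {1, 2, 3}"
  proof (rule inj_onI)
    fix w w' assume w: "w \<in> {1, 2, 3::nat}" "w' \<in> {1, 2, 3}" "\<kappa> w = \<kappa> w'"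
    have "pos (w, 0) \<in> pos ` ({w} \<times> {..<3})" by (rule imageI) simp
    then have "pos (w, 0) \<in> pos ` ({w'} \<times> {..<3})" using k[OF w(1)] k[OF w(2)] w(3) by metis
    then obtain i where "i < 3" "pos (w, 0) = pos (w', i)" by auto
    then have "(w, 0) = (w', i)" using inj_onD[OF pos(1), of "(w, 0)" "(w', i)"] w by simp
    then show "w = w'" by simp
  qed
  then have "card (\<kappa> ` {1, 2, 3}) = 3" by (subst card_image) auto
  moreover have "\<kappa> ` {1, 2, 3} \<subseteq> U3" using k by blast
  ultimately have "\<kappa> ` {1, 2, 3} = U3" using card_subset_eq[OF finite_U3] card_U3 by metis
  then have "H ` U3 = (\<lambda>w. H (\<kappa> w)) ` {1, 2, 3}" by (metis image_image)
  also have "\<dots> = (\<lambda>w. pos ` ({w} \<times> {..<3})) ` {1, 2, 3}" by (intro image_cong refl) (use k in auto)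
  finally show ?thesis by simp
qed

lemma frame_map:
  "\<exists>T. invertible T \<and> proj_map T (plane (E 0)) = plane (vec3 1 0 0) \<and>
     proj_map T (plane (E 1)) = plane (vec3 0 1 0) \<and> proj_map T (plane (E 2)) = plane (vec3 0 0 1) \<and>
     (\<forall>m\<in>M. proj_map T (plane (N m)) = hline (pos m))"
proof -
  define c0 c1 c2 where c: "c0 = a0 (1, 0)" "c1 = a1 (1, 0)" "c2 = a2 (1, 0)"
  have nz: "c0 \<noteq> 0" "c1 \<noteq> 0" "c2 \<noteq> 0" using a_nz[of "(1, 0)"] by (simp_all add: c)
  let ?D = "dot3 (E 0) (crs (E 1) (E 2))"
  \<comment> \<open>The rows are the lines of class 0, scaled by the frame coefficients of the line
    \<open>(1, 0)\<close>; this matches the normalisation of \<open>bt\<close> and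
    \<open>gm\<close>.\<close>
  define T :: "complex^3^3" where "T = vector [c0 *s E 0, c1 *s E 1, c2 *s E 2]"
  have Tv: "(T *v v) $ 1 = c0 * dot3 (E 0) v" "(T *v v) $ 2 = c1 * dot3 (E 1) v" "(T *v v) $ 3 = c2 * dot3 (E 2) v" for v
    by (simp_all add: T_def matrix_vector_mult_def sum_3 vector_3 dot3_def algebra_simps)
  have "det T = c0 * c1 * c2 * ?D" by (simp add: det_3 T_def vector_3 dot3_def algebra_simps)
  then have inv: "invertible T" using nz E_independent by (simp add: invertible_det_nz)
  have N: "proj_map T (plane (N m)) = hline (pos m)" if m: "m \<in> M" for m
  proof (rule proj_map_eqI[OF inv])
    fix v
    have "?D * dot3 (N m) v = a0 m * dot3 (E 0) v + a1 m * dot3 (E 1) v + a2 m * dot3 (E 2) v"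
      using arg_cong[OF frame_identity[of "E 0" "E 1" "E 2" "N m"], of "\<lambda>x. dot3 x v"] by (simp add: a0_def a1_def a2_def)
    also have "\<dots> = a0 m / c0 * dot3 (vec3 1 (bt m) (gm m)) (T *v v)"
      unfolding dot3_vec3 Tv bt_def gm_def c[symmetric] using nz a_nz[OF m] by (simp add: field_simps)
    finally have "dot3 (N m) v = 0 \<longleftrightarrow> dot3 (vec3 1 (bt m) (gm m)) (T *v v) = 0"
      using nz a_nz[OF m] E_independent by (metis divide_eq_0_iff mult_eq_0_iff)
    then show "v \<in> plane (N m) \<longleftrightarrow> T *v v \<in> hline (pos m)" by (simp add: plane_def hline_def pos_def)
  qed
  have E: "proj_map T (plane (E 0)) = plane (vec3 1 0 0)" "proj_map T (plane (E 1)) = plane (vec3 0 1 0)"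
    "proj_map T (plane (E 2)) = plane (vec3 0 0 1)"
    by (rule proj_map_eqI[OF inv]; use nz in \<open>simp add: plane_def dot3_vec3 Tv\<close>)+
  show ?thesis by (intro exI[of _ T] conjI ballI inv E N)
qed

end

lemma net_3_unique:
  assumes net: "is_net 4 3 L A chi" and \<omega>: "primitive_root_of_unity 3 \<omega>"
  shows "proj_isomorphic 4 L A (hessian_lines \<omega>) (hessian_class \<omega>)"
proof -
  obtain n where n: "vnet 3 n" and bij: "\<And>w. w < 4 \<Longrightarrow> bij_betw (\<lambda>i. plane (n w i)) {..<3} (A (Suc w))"
    using is_net_imp_vnet[OF net] by metis
  interpret net3 n \<omega> by unfold_locales (use n \<omega> in auto)
  obtain T where T: "invertible T" "proj_map T (plane (n 0 0)) = plane (vec3 1 0 0)"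
    "proj_map T (plane (n 0 1)) = plane (vec3 0 1 0)" "proj_map T (plane (n 0 2)) = plane (vec3 0 0 1)"
    and TN: "\<forall>m\<in>M. proj_map T (plane (N m)) = hline (pos m)" using frame_map by (elim exE conjE)
  have Aw: "proj_map T ` A (Suc w) = (\<lambda>i. proj_map T (plane (n w i))) ` {..<3}" if "w < 4" for w
    using bij_betw_imp_surj_on[OF bij[OF that], symmetric] by (simp only: image_image)
  have A1: "proj_map T ` A 1 = hessian_class \<omega> 1"
  proof -
    have "{..<3::nat} = {0, 1, 2}" by auto
    then show ?thesis using Aw[of 0] T(2-4) by (simp add: hessian_class_1[simplified])
  qed
  have Aw': "proj_map T ` A (Suc w) = hline ` pos ` ({w} \<times> {..<3})" if "w \<in> {1, 2, 3}" for w
  proof -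
    have w4: "w < 4" using that by auto
    have "proj_map T ` A (Suc w) = (\<lambda>i. hline (pos (w, i))) ` {..<3}"
      unfolding Aw[OF w4] by (intro image_cong refl) (use TN that in force)
    then show ?thesis by (auto simp: image_iff)
  qed
  have e: "{1..4::nat} = insert 1 (Suc ` {1, 2, 3})" by auto
  have "(\<lambda>i. proj_map T ` A i) ` Suc ` {1, 2, 3} = (\<lambda>S. hline ` S) ` (\<lambda>w. pos ` ({w} \<times> {..<3})) ` {1, 2, 3}"
    unfolding image_image by (intro image_cong refl) (use Aw' in \<open>simp add: image_image\<close>)
  also have "\<dots> = (\<lambda>\<kappa>. hline ` H \<kappa>) ` U3" unfolding classes_H by (simp add: image_image)
  also have "\<dots> = hessian_class \<omega> ` Suc ` {1, 2, 3}"
    using hessian_class_H[of 2] hessian_class_H[of 3] hessian_class_H[of 4] unfolding U3_eq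
    by (simp add: numeral_2_eq_2[symmetric])
  finally have cl: "(\<lambda>i. proj_map T ` A i) ` {1..4} = hessian_class \<omega> ` {1..4}"
    unfolding e image_insert A1 by simp
  have "L = (\<Union>i\<in>{1..4}. A i)" using net unfolding is_net_def by (elim conjE)
  then have "proj_map T ` L = \<Union>((\<lambda>i. proj_map T ` A i) ` {1..4})" by auto
  also have "\<dots> = hessian_lines \<omega>" unfolding cl hessian_lines_Union ..
  finally show ?thesis unfolding proj_isomorphic_def using T(1) cl by blast
qed

theorem theorem1p3:
  fixes \<omega> :: complex
  assumes "primitive_root_of_unity 3 \<omega>"
  shows "(\<exists>chi. is_net 4 3 (hessian_lines \<omega>) (hessian_class \<omega>) chi) \<and>
         (\<forall>L A chi. is_net 4 3 L A chi \<longrightarrow>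
            proj_isomorphic 4 L A (hessian_lines \<omega>) (hessian_class \<omega>)) \<and>
         (\<forall>k\<in>{4,5,6}. \<not> (\<exists>L A chi. is_net 4 k L A chi))"
proof (intro conjI allI impI ballI notI)
  interpret cube_root \<omega> by unfold_locales (rule assms)
  show "\<exists>chi. is_net 4 3 (hessian_lines \<omega>) (hessian_class \<omega>) chi" using hessian_net by blast
next
  fix L A chi assume "is_net 4 3 L A chi"
  then show "proj_isomorphic 4 L A (hessian_lines \<omega>) (hessian_class \<omega>)" by (rule net_3_unique[OF _ assms])
next
  fix k :: nat assume k: "k \<in> {4, 5, 6}" and "\<exists>L A chi. is_net 4 k L A chi"
  then obtain L A chi where net: "is_net 4 k L A chi" by blast
  have "2 \<le> k" using k by auto
  then obtain C D where "geo_mols k C D" using is_net_imp_geo_mols[OF net] by blast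
  then show False using k no_geo_mols_4 no_geo_mols_5 no_geo_mols_6 by auto
qed

end
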